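(* Let $\alpha\ge2$ and consider the Hill's type lunar problem $$\ddot x-2\dot y=-V_x,\qquad \ddot y+2\dot x=-V_y,\qquad V(x,y)=-\frac{\alpha+2}{2}x^2-\frac{\alpha+2}{r^\alpha},\quad r=\sqrt{x^2+y^2}.$$ Let $$\tilde{\mathcal W}_+=\{\Gamma: E(\Gamma)=E^*,\ W(\Gamma)>0\},\qquad \tilde{\mathcal W}_-=\{\Gamma: E(\Gamma)=E^*,\ W(\Gamma)\le 0\}.$$ Then $\tilde{\mathcal W}_+$ and $\tilde{\mathcal W}_-$ are invariant. Each solution in $\tilde{\mathcal W}_-$ either has a finite time collision with the origin or approaches the ground states $\pm Q$ as $t\to\infty$; moreover, it approaches the ground states only when it lies on the stable manifolds of the ground states. Solutions in $\tilde{\mathcal W}_+$ exist globally.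
   Context: The phase space consists of $\Gamma=(x,y,\dot x,\dot y)\in\mathbb R^4$ with $(x,y)\ne(0,0)$. The energy $E(\Gamma)=\frac12(\dot x^2+\dot y^2)+V(x,y)$ is conserved. Put $W(\Gamma)=-xV_x-yV_y=(\alpha+2)\left(x^2-\frac{\alpha}{r^\alpha}\right)$. The ground states are the equilibria $\pm Q=(\pm\alpha^{1/(\alpha+2)},0,0,0)$, and the ground state energy is $E^*=\inf\{E(\Gamma): W(\Gamma)=0\}=E(\pm Q)=-\frac12(\alpha+2)^2\alpha^{-\alpha/(\alpha+2)}$. Each of $\pm Q$ is of saddle-center type: the linearization has eigenvalues $\pm k$ with $k>0$ and $\pm i\omega$ with $\omega>0$. The stable manifold of an equilibrium is the (global) invariant manifold associated with the eigenvalue $-k$, i.e. the set of points (including the equilibrium) whose forward orbits converge exponentially to it, tangent there to the $-k$ eigenspace. Solutions are defined on a maximal forward interval $[0,T_{\max})$. Global existence means $T_{\max}=\infty$. Finite time collision means $T_{\max}<\infty$ and $(x(t),y(t))\to(0,0)$ as $t\to T_{\max}$. A set is invariant if a solution starting in it stays in it as long as it exists. *)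

theory Defs
  imports "HOL-Analysis.Analysis"
begin

type_synonym state = "real \<times> real \<times> real \<times> real"

definition V :: "real \<Rightarrow> real \<Rightarrow> real \<Rightarrow> real" where
  "V \<alpha> x y = - (\<alpha> + 2) / 2 * x\<^sup>2 - (\<alpha> + 2) / sqrt (x\<^sup>2 + y\<^sup>2) powr \<alpha>"

definition V_x :: "real \<Rightarrow> real \<Rightarrow> real \<Rightarrow> real" where
  "V_x \<alpha> x y = deriv (\<lambda>u. V \<alpha> u y) x"

definition V_y :: "real \<Rightarrow> real \<Rightarrow> real \<Rightarrow> real" where
  "V_y \<alpha> x y = deriv (\<lambda>u. V \<alpha> x u) y"

text \<open>A state is \<open>(x, y, x', y')\<close>, position followed by velocity. All functions below are total;
  their values at collision states carry no meaning, hence the explicit restrictions to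
  \<open>phase_space\<close>.\<close>

definition phase_space :: "state set" where
  "phase_space = {(x, y, p, q). (x, y) \<noteq> (0, 0)}"

definition energy :: "real \<Rightarrow> state \<Rightarrow> real" where
  "energy \<alpha> = (\<lambda>(x, y, p, q). (p\<^sup>2 + q\<^sup>2) / 2 + V \<alpha> x y)"

definition W :: "real \<Rightarrow> state \<Rightarrow> real" where
  "W \<alpha> = (\<lambda>(x, y, p, q). - x * V_x \<alpha> x y - y * V_y \<alpha> x y)"

lemma DERIV_V_aux:
  fixes \<alpha> x y :: real
  assumes "(x, y) \<noteq> (0, 0)"
  shows "((\<lambda>u. (\<alpha> + 2) / sqrt (u\<^sup>2 + y\<^sup>2) powr \<alpha>) has_real_derivative
           - ((\<alpha> + 2) * \<alpha> * x / sqrt (x\<^sup>2 + y\<^sup>2) powr (\<alpha> + 2))) (at x)"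
proof -
  have pos: "x\<^sup>2 + y\<^sup>2 > 0" using assms by (simp add: sum_power2_gt_zero_iff)
  define r where "r = sqrt (x\<^sup>2 + y\<^sup>2)"
  have r: "r > 0" using pos by (simp add: r_def)
  have e: "r powr (\<alpha> + 2) = r powr \<alpha> * r\<^sup>2" "r powr (\<alpha> - 1) = r powr \<alpha> / r"
    using r by (simp_all add: powr_add powr_diff)
  have s: "((\<lambda>u. sqrt (u\<^sup>2 + y\<^sup>2)) has_real_derivative x / r) (at x)"
    using pos by (auto intro!: derivative_eq_intros simp: r_def field_simps)
  have "((\<lambda>z. z powr (- \<alpha>)) has_real_derivative - \<alpha> * r powr (- \<alpha> - 1)) (at (sqrt (x\<^sup>2 + y\<^sup>2)))"
    using has_real_derivative_powr[OF r, of "- \<alpha>"] by (simp add: r_def)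
  from DERIV_cmult[OF DERIV_chain2[OF this s], of "\<alpha> + 2"]
  have "((\<lambda>u. (\<alpha> + 2) * sqrt (u\<^sup>2 + y\<^sup>2) powr (- \<alpha>)) has_real_derivative
           (\<alpha> + 2) * (- \<alpha> * r powr (- \<alpha> - 1) * (x / r))) (at x)" .
  moreover have "(\<alpha> + 2) * (- \<alpha> * r powr (- \<alpha> - 1) * (x / r)) = - ((\<alpha> + 2) * \<alpha> * x / r powr (\<alpha> + 2))"
    using r by (simp add: e powr_diff powr_minus field_simps power2_eq_square)
  ultimately show ?thesis by (simp add: r_def powr_minus field_simps)
qed

lemma V_x_eq:
  assumes "(x, y) \<noteq> (0, 0)"
  shows "V_x \<alpha> x y = - (\<alpha> + 2) * x + (\<alpha> + 2) * \<alpha> * x / sqrt (x\<^sup>2 + y\<^sup>2) powr (\<alpha> + 2)"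
  unfolding V_x_def V_def
proof (rule DERIV_imp_deriv)
  have "((\<lambda>u. - (\<alpha> + 2) / 2 * u\<^sup>2) has_real_derivative - (\<alpha> + 2) * x) (at x)"
    by (auto intro!: derivative_eq_intros)
  from DERIV_diff[OF this DERIV_V_aux[OF assms]]
  show "((\<lambda>u. - (\<alpha> + 2) / 2 * u\<^sup>2 - (\<alpha> + 2) / sqrt (u\<^sup>2 + y\<^sup>2) powr \<alpha>) has_real_derivative
    - (\<alpha> + 2) * x + (\<alpha> + 2) * \<alpha> * x / sqrt (x\<^sup>2 + y\<^sup>2) powr (\<alpha> + 2)) (at x)" by simp
qed

lemma V_y_eq:
  assumes "(x, y) \<noteq> (0, 0)"
  shows "V_y \<alpha> x y = (\<alpha> + 2) * \<alpha> * y / sqrt (x\<^sup>2 + y\<^sup>2) powr (\<alpha> + 2)"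
proof -
  have a: "(y, x) \<noteq> (0, 0)" using assms by auto
  from DERIV_diff[OF DERIV_const DERIV_V_aux[OF a], of "- (\<alpha> + 2) / 2 * x\<^sup>2" \<alpha>]
  show ?thesis unfolding V_y_def V_def
    by (intro DERIV_imp_deriv) (simp add: add.commute)
qed

lemma W_eq:
  assumes "(x, y) \<noteq> (0, 0)"
  shows "W \<alpha> (x, y, p, q) = (\<alpha> + 2) * (x\<^sup>2 - \<alpha> / sqrt (x\<^sup>2 + y\<^sup>2) powr \<alpha>)"
proof -
  define r where "r = sqrt (x\<^sup>2 + y\<^sup>2)"
  have pos: "x\<^sup>2 + y\<^sup>2 > 0" using assms by (simp add: sum_power2_gt_zero_iff)
  then have r: "r > 0" "x\<^sup>2 + y\<^sup>2 = r\<^sup>2" by (simp_all add: r_def)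
  have "W \<alpha> (x, y, p, q) = (\<alpha> + 2) * x\<^sup>2 - (\<alpha> + 2) * \<alpha> * (x\<^sup>2 + y\<^sup>2) / r powr (\<alpha> + 2)"
    using assms by (simp add: W_def V_x_eq V_y_eq r_def[symmetric]) (simp add: power2_eq_square algebra_simps add_divide_distrib diff_divide_distrib)
  also have "\<dots> = (\<alpha> + 2) * (x\<^sup>2 - \<alpha> / r powr \<alpha>)"
    using r by (simp add: powr_add algebra_simps add_divide_distrib)
  finally show ?thesis by (simp add: r_def)
qed

definition ground_state :: "real \<Rightarrow> state" where
  "ground_state \<alpha> = (\<alpha> powr (1 / (\<alpha> + 2)), 0, 0, 0)"

definition ground_energy :: "real \<Rightarrow> real" where
  "ground_energy \<alpha> = Inf (energy \<alpha> ` {\<Gamma> \<in> phase_space. W \<alpha> \<Gamma> = 0})"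

text \<open>The first-order form of
  \<open>x'' - 2 y' = - V\<^sub>x\<close>, \<open>y'' + 2 x' = - V\<^sub>y\<close>.\<close>

definition hill_field :: "real \<Rightarrow> state \<Rightarrow> state" where
  "hill_field \<alpha> = (\<lambda>(x, y, p, q). (p, q, 2 * q - V_x \<alpha> x y, - 2 * p - V_y \<alpha> x y))"

text \<open>Solutions live on \<open>[0, T)\<close> with \<open>0 < T \<le> \<infinity>\<close>; the values of \<open>\<Gamma>\<close> outside this interval are
  irrelevant, and the derivative at \<open>0\<close> is one-sided.\<close>

definition time_interval :: "ereal \<Rightarrow> real set" where
  "time_interval T = {t. 0 \<le> t \<and> ereal t < T}"

definition solution :: "real \<Rightarrow> ereal \<Rightarrow> (real \<Rightarrow> state) \<Rightarrow> bool" where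
  "solution \<alpha> T \<Gamma> \<longleftrightarrow> 0 < T \<and>
     (\<forall>t \<in> time_interval T. \<Gamma> t \<in> phase_space \<and>
        (\<Gamma> has_vector_derivative hill_field \<alpha> (\<Gamma> t)) (at t within time_interval T))"

definition maximal_solution :: "real \<Rightarrow> ereal \<Rightarrow> (real \<Rightarrow> state) \<Rightarrow> bool" where
  "maximal_solution \<alpha> T \<Gamma> \<longleftrightarrow> solution \<alpha> T \<Gamma> \<and>
     (\<forall>T' \<Gamma>'. solution \<alpha> T' \<Gamma>' \<and> T \<le> T' \<and> (\<forall>t \<in> time_interval T. \<Gamma>' t = \<Gamma> t) \<longrightarrow> T' = T)"

definition invariant_set :: "real \<Rightarrow> state set \<Rightarrow> bool" where
  "invariant_set \<alpha> S \<longleftrightarrow>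
     (\<forall>T \<Gamma>. maximal_solution \<alpha> T \<Gamma> \<and> \<Gamma> 0 \<in> S \<longrightarrow> (\<forall>t \<in> time_interval T. \<Gamma> t \<in> S))"

definition finite_time_collision :: "ereal \<Rightarrow> (real \<Rightarrow> state) \<Rightarrow> bool" where
  "finite_time_collision T \<Gamma> \<longleftrightarrow>
     (\<exists>\<tau>. T = ereal \<tau> \<and> ((\<lambda>t. (fst (\<Gamma> t), fst (snd (\<Gamma> t)))) \<longlongrightarrow> (0, 0)) (at_left \<tau>))"

definition approaches :: "ereal \<Rightarrow> (real \<Rightarrow> state) \<Rightarrow> state \<Rightarrow> bool" where
  "approaches T \<Gamma> P \<longleftrightarrow> T = \<infinity> \<and> (\<Gamma> \<longlongrightarrow> P) at_top"

definition linearization :: "real \<Rightarrow> state \<Rightarrow> state \<Rightarrow> state" where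
  "linearization \<alpha> P = frechet_derivative (hill_field \<alpha>) (at P)"

text \<open>At the ground states the linearization has exactly one negative real eigenvalue;
  \<open>stable_rate\<close> is its absolute value.\<close>

definition stable_rate :: "real \<Rightarrow> state \<Rightarrow> real" where
  "stable_rate \<alpha> P = (THE k. k > 0 \<and> (\<exists>v. v \<noteq> 0 \<and> linearization \<alpha> P v = (- k) *\<^sub>R v))"

definition stable_eigenspace :: "real \<Rightarrow> state \<Rightarrow> state set" where
  "stable_eigenspace \<alpha> P = {v. linearization \<alpha> P v = (- stable_rate \<alpha> P) *\<^sub>R v}"

text \<open>Tangency to the stable eigenspace is required of each orbit as it tends to \<open>P\<close>, since the
  global manifold as a point set may return to a neighbourhood of \<open>P\<close>. The constant orbit
  satisfies both conditions trivially.\<close>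

definition stable_manifold :: "real \<Rightarrow> state \<Rightarrow> state set" where
  "stable_manifold \<alpha> P = {\<Gamma>\<^sub>0. \<exists>\<Gamma>. solution \<alpha> \<infinity> \<Gamma> \<and> \<Gamma> 0 = \<Gamma>\<^sub>0 \<and>
     (\<exists>C c. c > 0 \<and> (\<forall>t \<ge> 0. norm (\<Gamma> t - P) \<le> C * exp (- c * t))) \<and>
     (\<lambda>t. infdist (\<Gamma> t - P) (stable_eigenspace \<alpha> P)) \<in> o[at_top](\<lambda>t. norm (\<Gamma> t - P))}"

definition W_plus :: "real \<Rightarrow> state set" where
  "W_plus \<alpha> = {\<Gamma> \<in> phase_space. energy \<alpha> \<Gamma> = ground_energy \<alpha> \<and> W \<alpha> \<Gamma> > 0}"

definition W_minus :: "real \<Rightarrow> state set" where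
  "W_minus \<alpha> = {\<Gamma> \<in> phase_space. energy \<alpha> \<Gamma> = ground_energy \<alpha> \<and> W \<alpha> \<Gamma> \<le> 0}"

end

theory Submission
  imports Defs
begin

text \<open>On the energy level \<open>E\<^sup>*\<close> the function \<open>W\<close> vanishes only at the equilibria \<open>\<plusminus>Q\<close>, so by
  uniqueness of solutions its sign is preserved. Where \<open>W > 0\<close>, the radius is at least
  \<open>r\<^sub>* = \<bar>Q\<bar>\<close>; away from the origin the vector field is globally Lipschitz and solutions
  extend for all time. Where \<open>W \<le> 0\<close>, the radius is at most \<open>r\<^sub>*\<close>, and \<open>\<delta> = r\<^sub>*\<^sup>2 - r\<^sup>2\<close>
  satisfies \<open>\<delta>'' \<ge> (4 (\<alpha> + 2) / \<alpha>) \<delta>\<close>: the Coriolis term is absorbed by Cauchy-Schwarz and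
  Bernoulli's inequality. So \<open>r\<^sup>2\<close> is concave. If the solution is global, this forces \<open>\<delta> \<rightarrow> 0\<close>
  and conservation of energy gives convergence to \<open>Q\<close> or \<open>-Q\<close>; otherwise \<open>r\<close> has infimum \<open>0\<close> and
  concavity gives \<open>r \<rightarrow> 0\<close>. In the convergent case \<open>\<delta>\<close> decays exponentially and is comparable to the
  distance from the ground state. The components of the solution along the unstable and the central
  directions are driven only by quadratic terms and cannot decay by themselves, so they are
  \<open>O(\<delta>\<^sup>2)\<close>, which is tangency to the stable eigenspace.\<close>

section \<open>Ordinary differential equations with Lipschitz right-hand side\<close>

text \<open>The obstacle to concavity is the Coriolis force:
  \<open>(r^2)'' / 2 = v^2 + 2 (x y' - y x') + W\<close>, and \<open>W \<le> 0\<close> alone does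
  not decide the sign of the right-hand side. On the level E^* the energy equation bounds
  \<open>v^2\<close> by a function of r, which bounds the cross term, and \<open>v^2 + W\<close>
  outweighs it with a margin proportional to \<delta>. This margin is the source of the constant
  \<open>4 (\<alpha> + 2) / \<alpha>\<close>.

  The ground states are saddle-centers, so convergence of an orbit does not by itself give a rate or
  a limiting direction: the pair \<open>\<plusminus> i \<omega>\<close> permits undamped linear
  motion. The rate comes from the differential inequality for \<delta> and not from the spectrum; it
  is the square root \<open>c\<close> of that constant, in general not the eigenvalue rate
  \<open>k\<close>. For tangency it suffices that the quadratic form measuring the deviation, apart
  from forcing of order \<open>\<delta>^4\<close>, loses size at rate at most \<open>c\<close>,
  while it is known to decay at rate \<open>2 c\<close>. No invariant manifold is
  constructed.\<close>

lemma deriv_nonneg_imp_le: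
  fixes f f' :: "real \<Rightarrow> real"
  assumes "a \<le> b" and "{a..b} \<subseteq> S"
    and "\<And>t. t \<in> {a..b} \<Longrightarrow> (f has_real_derivative f' t) (at t within S)"
    and "\<And>t. t \<in> {a..b} \<Longrightarrow> 0 \<le> f' t"
  shows "f a \<le> f b"
proof -
  have "(f has_derivative (\<lambda>h. f' t * h)) (at t within {a..b})" if "a \<le> t" "t \<le> b" for t
    using has_derivative_subset[OF _ assms(2)] assms(3)[of t] that
    by (auto simp: has_field_derivative_def)
  from mvt_very_simple[OF assms(1) this] obtain t where "t \<in> {a..b}" "f b - f a = f' t * (b - a)"
    by blast
  with assms(1,4) show ?thesis
    by (smt (verit) mult_nonneg_nonneg)
qed

text \<open>The product \<open>f t * exp (- c * t)\<close> is nondecreasing. The derivative is taken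
  within a set \<open>S\<close> that may exceed \<open>{a..b}\<close>, because along an orbit it is
  available only within the time interval, one-sided at 0.\<close>

lemma gronwall_ge:
  fixes f f' :: "real \<Rightarrow> real"
  assumes "a \<le> b" and "{a..b} \<subseteq> S"
    and "\<And>t. t \<in> {a..b} \<Longrightarrow> (f has_real_derivative f' t) (at t within S)"
    and "\<And>t. t \<in> {a..b} \<Longrightarrow> c * f t \<le> f' t"
  shows "f a * exp (c * (b - a)) \<le> f b"
proof -
  have "f a * exp (- c * a) \<le> f b * exp (- c * b)"
  proof (rule deriv_nonneg_imp_le[OF assms(1,2)])
    fix t assume t: "t \<in> {a..b}"
    show "((\<lambda>t. f t * exp (- c * t)) has_real_derivative (f' t - c * f t) * exp (- c * t)) (at t within S)"
      by (rule derivative_eq_intros assms(3)[OF t] refl)+ (simp add: algebra_simps)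
    show "0 \<le> (f' t - c * f t) * exp (- c * t)" using assms(4)[OF t] by simp
  qed
  then have "f a * exp (- c * a) * exp (c * b) \<le> f b * exp (- c * b) * exp (c * b)"
    by (rule mult_right_mono) simp
  then show ?thesis
    by (simp add: mult.assoc exp_add[symmetric] algebra_simps)
qed

lemma gronwall_le:
  fixes f f' :: "real \<Rightarrow> real"
  assumes "a \<le> b" and "{a..b} \<subseteq> S"
    and "\<And>t. t \<in> {a..b} \<Longrightarrow> (f has_real_derivative f' t) (at t within S)"
    and "\<And>t. t \<in> {a..b} \<Longrightarrow> f' t \<le> c * f t"
  shows "f b \<le> f a * exp (c * (b - a))"
  using gronwall_ge[OF assms(1,2), of "\<lambda>t. - f t" "\<lambda>t. - f' t" c] assms(3,4)
  by (auto intro: DERIV_minus)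

text \<open>The squared distance \<open>f\<close> satisfies \<open>|f'| \<le> 2 L f\<close>, so
  Gronwall propagates its zero at \<open>t\<^sub>0\<close> in both time directions. Both are used:
  an orbit that meets an equilibrium was there before as well.\<close>

lemma lipschitz_ode_unique:
  fixes g :: "'a::real_inner \<Rightarrow> 'a"
  assumes g: "L-lipschitz_on UNIV g" and S: "is_interval S"
    and u: "\<And>t. t \<in> S \<Longrightarrow> (u has_vector_derivative g (u t)) (at t within S)"
    and v: "\<And>t. t \<in> S \<Longrightarrow> (v has_vector_derivative g (v t)) (at t within S)"
    and t: "t\<^sub>0 \<in> S" "u t\<^sub>0 = v t\<^sub>0" "t \<in> S"
  shows "u t = v t"
proof -
  define f where "f t = (u t - v t) \<bullet> (u t - v t)" for t
  define f' where "f' t = 2 * ((u t - v t) \<bullet> (g (u t) - g (v t)))" for t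
  have f': "(f has_real_derivative f' t) (at t within S)" if "t \<in> S" for t
  proof -
    have "((\<lambda>t. u t - v t) has_vector_derivative g (u t) - g (v t)) (at t within S)"
      using u[OF that] v[OF that] by (rule has_vector_derivative_diff)
    then have d: "((\<lambda>t. u t - v t) has_derivative (\<lambda>h. h *\<^sub>R (g (u t) - g (v t)))) (at t within S)"
      by (simp add: has_vector_derivative_def)
    show ?thesis
      unfolding f_def[abs_def] has_field_derivative_def
      by (rule has_derivative_eq_rhs[OF has_derivative_inner[OF d d]])
        (simp add: f'_def fun_eq_iff inner_commute algebra_simps)
  qed
  have bound: "\<bar>f' t\<bar> \<le> 2 * L * f t" for t
  proof -
    have "\<bar>(u t - v t) \<bullet> (g (u t) - g (v t))\<bar> \<le> norm (u t - v t) * norm (g (u t) - g (v t))"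
      by (rule Cauchy_Schwarz_ineq2)
    also have "\<dots> \<le> norm (u t - v t) * (L * norm (u t - v t))"
      using lipschitz_on_normD[OF g] by (intro mult_left_mono) auto
    also have "\<dots> = L * f t" by (simp add: f_def dot_square_norm power2_eq_square)
    finally show ?thesis by (simp add: f'_def)
  qed
  have pos: "0 \<le> f t" for t by (simp add: f_def)
  have f0: "f t\<^sub>0 = 0" using t by (simp add: f_def)
  have sub: "{a..b} \<subseteq> S" if "a \<in> S" "b \<in> S" for a b
    using mem_is_interval_1_I[OF S that] by auto
  have bound': "f' t \<le> 2 * L * f t" "- (2 * L) * f t \<le> f' t" for t
    using bound[of t] by linarith+
  have "f t = 0"
  proof (cases "t\<^sub>0 \<le> t")
    case True
    have "f t \<le> f t\<^sub>0 * exp (2 * L * (t - t\<^sub>0))"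
    proof (rule gronwall_le[OF True sub])
      fix r assume "r \<in> {t\<^sub>0..t}"
      then show "(f has_real_derivative f' r) (at r within S)" using f' sub t by blast
    qed (use t bound' in auto)
    with f0 pos[of t] show ?thesis by simp
  next
    case False
    then have le: "t \<le> t\<^sub>0" by simp
    have "f t * exp (- (2 * L) * (t\<^sub>0 - t)) \<le> f t\<^sub>0"
    proof (rule gronwall_ge[OF le sub])
      fix r assume "r \<in> {t..t\<^sub>0}"
      then show "(f has_real_derivative f' r) (at r within S)" using f' sub t by blast
    qed (use t bound' in auto)
    with f0 have "f t * exp (- (2 * L) * (t\<^sub>0 - t)) \<le> 0" by simp
    then have "f t \<le> 0" by (simp add: mult_le_0_iff)
    with pos[of t] show ?thesis by simp
  qed
  then show ?thesis by (simp add: f_def)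
qed

text \<open>The length of the existence interval depends only on the Lipschitz constant, so a solution
  can be restarted close to the end of its interval without knowing that it has a limit there.\<close>

lemma lipschitz_ode_exists:
  fixes g :: "'a::euclidean_space \<Rightarrow> 'a"
  assumes g: "L-lipschitz_on UNIV g" and h: "0 \<le> h" "L * h < 1"
  obtains u where "u t\<^sub>0 = z"
    and "\<And>t. t \<in> {t\<^sub>0..t\<^sub>0 + h} \<Longrightarrow> (u has_vector_derivative g (u t)) (at t within {t\<^sub>0..t\<^sub>0 + h})"
proof -
  \<comment> \<open>Clamping time to the interval lets the Picard map act on bounded continuous
    functions on the whole line, a complete space given as a type, where the contraction principle
    applies.\<close>
  define cl where "cl t = max t\<^sub>0 (min t (t\<^sub>0 + h))" for t
  have cl: "cl t \<in> {t\<^sub>0..t\<^sub>0 + h}" for t using h by (auto simp: cl_def)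
  have L: "0 \<le> L" using g by (rule lipschitz_on_nonneg)
  have cont_g: "continuous_on S (\<lambda>s. g (w s))" if "continuous_on S w" for w S
    using continuous_on_compose2[OF lipschitz_on_continuous_on[OF g] that] by simp
  define P where "P w t = z + integral {t\<^sub>0..cl t} (\<lambda>s. g (w s))" for w t
  have P_cont: "P (apply_bcontfun w) \<in> bcontfun" for w :: "real \<Rightarrow>\<^sub>C 'a"
  proof -
    have c: "continuous_on {t\<^sub>0..t\<^sub>0 + h} (\<lambda>t. integral {t\<^sub>0..t} (\<lambda>s. g (w s)))"
      by (intro indefinite_integral_continuous_1 integrable_continuous_real cont_g) auto
    have "continuous_on UNIV cl" unfolding cl_def by (intro continuous_intros)
    then have "continuous_on UNIV (P w)"
      unfolding P_def using continuous_on_compose2[OF c] cl by (intro continuous_intros) blast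
    moreover have "bounded (range (P w))"
    proof -
      have "bounded ((\<lambda>t. z + integral {t\<^sub>0..t} (\<lambda>s. g (w s))) ` {t\<^sub>0..t\<^sub>0 + h})"
        by (intro compact_imp_bounded compact_continuous_image continuous_intros c) simp
      then show ?thesis by (rule bounded_subset) (use cl in \<open>auto simp: P_def\<close>)
    qed
    ultimately show ?thesis by (simp add: bcontfun_def)
  qed
  define \<Phi> where "\<Phi> w = Bcontfun (P (apply_bcontfun w))" for w :: "real \<Rightarrow>\<^sub>C 'a"
  have \<Phi>: "apply_bcontfun (\<Phi> w) = P (apply_bcontfun w)" for w
    by (simp add: \<Phi>_def P_cont Bcontfun_inverse)
  have "dist (\<Phi> v) (\<Phi> w) \<le> L * h * dist v w" for v w
  proof (rule dist_bound)
    fix t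
    have int: "(\<lambda>s. g (x s)) integrable_on {t\<^sub>0..cl t}" for x :: "real \<Rightarrow>\<^sub>C 'a"
      by (intro integrable_continuous_real cont_g) auto
    have "dist (\<Phi> v t) (\<Phi> w t) = norm (integral {t\<^sub>0..cl t} (\<lambda>s. g (v s) - g (w s)))"
      using int by (simp add: \<Phi> P_def dist_norm integral_diff)
    also have "\<dots> \<le> integral {t\<^sub>0..cl t} (\<lambda>s. L * dist v w)"
    proof (rule integral_norm_bound_integral)
      fix s
      have "norm (g (v s) - g (w s)) \<le> L * dist (v s) (w s)"
        using lipschitz_onD[OF g] by (simp add: dist_norm)
      also have "\<dots> \<le> L * dist v w" using L dist_bounded by (intro mult_left_mono) auto
      finally show "norm (g (v s) - g (w s)) \<le> L * dist v w" .
    qed (use int in \<open>auto intro: integrable_diff\<close>)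
    also have "\<dots> = (cl t - t\<^sub>0) * (L * dist v w)" using cl by simp
    also have "\<dots> \<le> h * (L * dist v w)" using cl[of t] L by (intro mult_right_mono) auto
    finally show "dist (\<Phi> v t) (\<Phi> w t) \<le> L * h * dist v w" by (simp add: algebra_simps)
  qed
  then obtain u where u: "\<Phi> u = u"
    using banach_fix_type[of "L * h" \<Phi>] L h by auto
  then have u': "u t = P u t" for t by (metis \<Phi>)
  show thesis
  proof (rule that[of "apply_bcontfun u"])
    show "u t\<^sub>0 = z" using h by (subst u') (simp add: P_def cl_def)
    fix t assume t: "t \<in> {t\<^sub>0..t\<^sub>0 + h}"
    have "((\<lambda>r. z + integral {t\<^sub>0..r} (\<lambda>s. g (u s))) has_vector_derivative 0 + g (u t)) (at t within {t\<^sub>0..t\<^sub>0 + h})"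
      by (intro has_vector_derivative_add has_vector_derivative_const integral_has_vector_derivative
          cont_g t) auto
    then have "((\<lambda>r. z + integral {t\<^sub>0..r} (\<lambda>s. g (u s))) has_vector_derivative g (u t)) (at t within {t\<^sub>0..t\<^sub>0 + h})"
      by simp
    then show "(u has_vector_derivative g (u t)) (at t within {t\<^sub>0..t\<^sub>0 + h})"
    proof (rule has_vector_derivative_transform[rotated -1])
      fix r assume "r \<in> {t\<^sub>0..t\<^sub>0 + h}"
      then have "cl r = r" by (auto simp: cl_def)
      then show "u r = z + integral {t\<^sub>0..r} (\<lambda>s. g (u s))" by (subst u') (simp add: P_def)
    qed (rule t)
  qed
qed

section \<open>Continuation of solutions\<close>

text \<open>Outside radius \<open>c\<close> this is a central force field, inside it is linear. In
  the factor \<open>1 + b\<close>, the 1 accounts for the change of the vector and \<open>b\<close>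
  for the change of the power.\<close>

lemma lipschitz_on_truncated_powr:
  fixes b c :: real
  assumes "0 \<le> b" "0 < c"
  shows "((1 + b) * c powr - b)-lipschitz_on UNIV
    (\<lambda>a :: 'a::real_normed_vector. max (norm a) c powr - b *\<^sub>R a)"
    (is "_-lipschitz_on _ ?G")
proof (rule lipschitz_onI)
  have *: "norm (?G a - ?G a') \<le> (1 + b) * c powr - b * norm (a - a')" if le: "norm a \<le> norm a'" for a a' :: 'a
  proof -
    define m m' where "m = max (norm a) c" and "m' = max (norm a') c"
    have m: "0 < m" "m \<le> m'" "c \<le> m" "norm a \<le> m" "m' - m \<le> norm (a - a')"
      using assms le norm_triangle_ineq2[of a' a] by (auto simp: m_def m'_def norm_minus_commute)
    \<comment> \<open>Tangent bound at 1 for the convex power \<open>z powr - b\<close> with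
      \<open>z = m' / m\<close>.\<close>
    have "ln (m' / m) \<le> m' / m - 1" using m by (intro ln_le_minus_one) auto
    then have "1 - b * (m' / m - 1) \<le> 1 + (- b * ln (m' / m))"
      using mult_left_mono[OF _ assms(1)] by fastforce
    also have "\<dots> \<le> exp (- b * ln (m' / m))" by (rule exp_ge_add_one_self)
    also have "\<dots> = m' powr - b / m powr - b"
      using m by (simp add: powr_def ln_div exp_diff[symmetric] algebra_simps)
    finally have "m powr - b * (1 - b * (m' / m - 1)) \<le> m' powr - b"
      using m by (simp add: field_simps)
    then have d: "m powr - b - m' powr - b \<le> b * m powr - b * (m' - m) / m"
      using m by (simp add: field_simps)
    have "norm a * (m powr - b - m' powr - b) \<le> m * (b * m powr - b * (m' - m) / m)"
      using m powr_mono2'[of "- b" m m'] assms by (intro mult_mono d) auto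
    also have "\<dots> = b * m powr - b * (m' - m)" using m by simp
    also have "\<dots> \<le> b * c powr - b * norm (a - a')"
      using m assms by (intro mult_mono mult_nonneg_nonneg powr_mono2') auto
    finally have 1: "norm a * (m powr - b - m' powr - b) \<le> b * c powr - b * norm (a - a')" .
    have "m' powr - b * norm (a - a') \<le> c powr - b * norm (a - a')"
      using m assms by (intro mult_right_mono powr_mono2') auto
    \<comment> \<open>The difference of powers multiplies the shorter vector \<open>a\<close>, whose
      norm is at most \<open>m\<close>; this cancels the factor \<open>1 / m\<close> of the tangent
      bound.\<close>
    moreover have "?G a - ?G a' = m' powr - b *\<^sub>R (a - a') + (m powr - b - m' powr - b) *\<^sub>R a"
      by (simp add: m_def m'_def algebra_simps)
    then have "norm (?G a - ?G a') \<le> m' powr - b * norm (a - a') + norm a * (m powr - b - m' powr - b)"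
      using norm_triangle_ineq[of "m' powr - b *\<^sub>R (a - a')" "(m powr - b - m' powr - b) *\<^sub>R a"]
        powr_mono2'[of "- b" m m'] m assms by (simp add: mult.commute)
    ultimately show ?thesis using 1 by (simp add: algebra_simps)
  qed
  show "dist (?G a) (?G a') \<le> (1 + b) * c powr - b * dist a a'" for a a' :: 'a
    using *[of a a'] *[of a' a] by (cases "norm a \<le> norm a'") (auto simp: dist_norm norm_minus_commute)
qed (use assms in auto)

section \<open>The vector field truncated near the origin\<close>

definition pos :: "state \<Rightarrow> real \<times> real" where
  "pos z = (fst z, fst (snd z))"

lemma pos_simps [simp]: "pos (x, y, p, q) = (x, y)"
  by (simp add: pos_def)

lemma phase_space_iff: "z \<in> phase_space \<longleftrightarrow> pos z \<noteq> 0"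
  by (auto simp: phase_space_def pos_def zero_prod_def)

lemma continuous_on_pos [continuous_intros]: "continuous_on S f \<Longrightarrow> continuous_on S (\<lambda>t. pos (f t))"
  unfolding pos_def by (intro continuous_intros)

text \<open>Truncating the singular factor at radius \<open>c\<close> makes the vector field globally Lipschitz
  without changing it outside that radius.\<close>

definition truncated_field :: "real \<Rightarrow> real \<Rightarrow> state \<Rightarrow> state" where
  "truncated_field \<alpha> c = (\<lambda>(x, y, p, q). (p, q,
     2 * q + (\<alpha> + 2) * x - (\<alpha> + 2) * \<alpha> * (max (norm (x, y)) c powr - (\<alpha> + 2) * x),
     - 2 * p - (\<alpha> + 2) * \<alpha> * (max (norm (x, y)) c powr - (\<alpha> + 2) * y)))"

text \<open>Powers of \<open>r^2\<close> instead of r avoid square roots when differentiating along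
  an orbit.\<close>

lemma hill_field_eq:
  assumes "(x, y) \<noteq> (0, 0)"
  shows "hill_field \<alpha> (x, y, p, q) = (p, q,
    2 * q + (\<alpha> + 2) * x - (\<alpha> + 2) * \<alpha> * x * (x\<^sup>2 + y\<^sup>2) powr (- (\<alpha> / 2) - 1),
    - 2 * p - (\<alpha> + 2) * \<alpha> * y * (x\<^sup>2 + y\<^sup>2) powr (- (\<alpha> / 2) - 1))"
proof -
  have "sqrt (x\<^sup>2 + y\<^sup>2) powr (\<alpha> + 2) = (x\<^sup>2 + y\<^sup>2) powr ((\<alpha> + 2) / 2)"
    by (simp add: powr_half_sqrt[symmetric] powr_powr)
  then have "1 / sqrt (x\<^sup>2 + y\<^sup>2) powr (\<alpha> + 2) = (x\<^sup>2 + y\<^sup>2) powr (- ((\<alpha> + 2) / 2))"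
    by (simp add: powr_minus_divide)
  also have "- ((\<alpha> + 2) / 2) = - (\<alpha> / 2) - 1" by (simp add: field_simps)
  finally have e: "b / sqrt (x\<^sup>2 + y\<^sup>2) powr (\<alpha> + 2) = b * (x\<^sup>2 + y\<^sup>2) powr (- (\<alpha> / 2) - 1)" for b
    by (metis mult.right_neutral times_divide_eq_right)
  show ?thesis
    unfolding hill_field_def by (simp add: V_x_eq[OF assms] V_y_eq[OF assms] e algebra_simps)
qed

lemma truncated_field_eq:
  assumes "0 < c" "c \<le> norm (pos z)"
  shows "truncated_field \<alpha> c z = hill_field \<alpha> z"
proof -
  obtain x y p q where z: "z = (x, y, p, q)" by (cases z) auto
  have n: "(x, y) \<noteq> (0, 0)" using assms z by auto
  have "sqrt (x\<^sup>2 + y\<^sup>2) powr - (\<alpha> + 2) = (x\<^sup>2 + y\<^sup>2) powr (- (\<alpha> / 2) - 1)"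
    by (simp add: powr_half_sqrt[symmetric] powr_powr field_simps)
  then show ?thesis
    using assms hill_field_eq[OF n, of \<alpha> p q] by (simp add: z truncated_field_def max_def norm_Pair)
qed

lemma truncated_field_lipschitz:
  assumes "0 \<le> \<alpha> + 2" "0 < c"
  obtains L where "L-lipschitz_on UNIV (truncated_field \<alpha> c)"
proof -
  \<comment> \<open>\<open>A\<close> is the linear part including the Coriolis force,
    \<open>G\<close> the truncated central force, and \<open>B\<close> its scaled embedding into the
    velocity components.\<close>
  define A :: "state \<Rightarrow> state" where "A = (\<lambda>(x, y, p, q). (p, q, 2 * q + (\<alpha> + 2) * x, - 2 * p))"
  define B :: "real \<times> real \<Rightarrow> state" where "B = (\<lambda>(x, y). (0, 0, - ((\<alpha> + 2) * \<alpha> * x), - ((\<alpha> + 2) * \<alpha> * y)))"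
  define G :: "real \<times> real \<Rightarrow> real \<times> real" where "G a = max (norm a) c powr - (\<alpha> + 2) *\<^sub>R a" for a
  have "linear A" "linear B" "linear pos"
    by (auto intro!: linearI simp: A_def B_def pos_def algebra_simps)
  then have "bounded_linear A" "bounded_linear B" "bounded_linear pos"
    by (simp_all add: linear_conv_bounded_linear)
  then obtain a b d where "a-lipschitz_on UNIV A" and b: "b-lipschitz_on UNIV B" and d: "d-lipschitz_on UNIV pos"
    by (meson bounded_linear.lipschitz_boundE)
  moreover obtain e where e: "e-lipschitz_on UNIV G"
    unfolding G_def using lipschitz_on_truncated_powr[OF assms] by blast
  then have "(b * (e * d))-lipschitz_on UNIV (\<lambda>z. B (G (pos z)))"
    using lipschitz_on_compose2[OF lipschitz_on_compose2[OF d lipschitz_on_subset[OF e]] lipschitz_on_subset[OF b]]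
    by simp
  ultimately have "(a + b * (e * d))-lipschitz_on UNIV (\<lambda>z. A z + B (G (pos z)))"
    by (intro lipschitz_on_add)
  moreover have "(\<lambda>z. A z + B (G (pos z))) = truncated_field \<alpha> c"
    by (simp add: fun_eq_iff A_def B_def G_def truncated_field_def)
  ultimately have "(a + b * (e * d))-lipschitz_on UNIV (truncated_field \<alpha> c)" by metis
  then show thesis by (rule that)
qed

section \<open>Time intervals, uniqueness at equilibria, and continuation away from
  collision\<close>

lemma time_interval_ereal [simp]: "time_interval (ereal \<tau>) = {0..<\<tau>}"
  by (auto simp: time_interval_def)

lemma time_interval_infinity [simp]: "time_interval \<infinity> = {0..}"
  by (auto simp: time_interval_def)

lemma zero_in_time_interval: "0 < T \<Longrightarrow> 0 \<in> time_interval T"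
  by (simp add: time_interval_def zero_ereal_def)

lemma Icc_subset_time_interval: "t \<in> time_interval T \<Longrightarrow> 0 \<le> r \<Longrightarrow> {r..t} \<subseteq> time_interval T"
  by (auto simp: time_interval_def) (meson ereal_less_eq(3) le_less_trans)

lemma solution_continuous_on:
  "solution \<alpha> T \<Gamma> \<Longrightarrow> continuous_on (time_interval T) \<Gamma>"
  unfolding solution_def continuous_on_eq_continuous_within
  using has_vector_derivative_continuous by blast

lemma solution_at_equilibrium:
  assumes "0 \<le> \<alpha>" and sol: "solution \<alpha> T \<Gamma>" and P: "P \<in> phase_space" "hill_field \<alpha> P = 0"
    and t: "t\<^sub>0 \<in> time_interval T" "\<Gamma> t\<^sub>0 = P" "t \<in> time_interval T"
  shows "\<Gamma> t = P"
proof -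
  define S where "S = {0..max t t\<^sub>0}"
  have S: "S \<subseteq> time_interval T" "t \<in> S" "t\<^sub>0 \<in> S"
    using t Icc_subset_time_interval[of t T 0] Icc_subset_time_interval[of t\<^sub>0 T 0]
    by (auto simp: S_def max_def time_interval_def)
  have "continuous_on S (\<lambda>t. norm (pos (\<Gamma> t)))"
    by (intro continuous_intros continuous_on_subset[OF solution_continuous_on[OF sol] S(1)])
  then obtain m where m: "m \<in> S" "\<And>t. t \<in> S \<Longrightarrow> norm (pos (\<Gamma> m)) \<le> norm (pos (\<Gamma> t))"
    using continuous_attains_inf[of S "\<lambda>t. norm (pos (\<Gamma> t))"] S by (metis S_def compact_Icc empty_iff)
  \<comment> \<open>Both the orbit on \<open>S\<close> and the constant solution \<open>P\<close>
    stay outside radius \<open>c\<close>, so both solve the truncated equation.\<close>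
  define c where "c = min (norm (pos (\<Gamma> m))) (norm (pos P))"
  have "0 < c" using m(1) S sol P by (auto simp: c_def solution_def phase_space_iff)
  then obtain L where L: "L-lipschitz_on UNIV (truncated_field \<alpha> c)"
    using truncated_field_lipschitz[of \<alpha> c] assms(1) by auto
  show ?thesis
  proof (rule lipschitz_ode_unique[where u = \<Gamma> and v = "\<lambda>_. P", OF L _ _ _ S(3) t(2) S(2)])
    show "is_interval S" by (simp add: S_def is_interval_cc)
    show "(\<Gamma> has_vector_derivative truncated_field \<alpha> c (\<Gamma> r)) (at r within S)" if "r \<in> S" for r
    proof -
      have "c \<le> norm (pos (\<Gamma> r))" using m(2)[OF that] by (simp add: c_def)
      then show ?thesis
        using sol S(1) that has_vector_derivative_within_subset[OF _ S(1)]
        unfolding solution_def truncated_field_eq[OF \<open>0 < c\<close> \<open>c \<le> norm (pos (\<Gamma> r))\<close>] by blast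
    qed
    show "((\<lambda>_. P) has_vector_derivative truncated_field \<alpha> c P) (at r within S)" for r
      using \<open>0 < c\<close> P by (simp add: truncated_field_eq c_def)
  qed
qed

lemma bounded_away_from_collision_imp_global:
  assumes "0 \<le> \<alpha>" and max: "maximal_solution \<alpha> T \<Gamma>"
    and c: "0 < c" "\<And>t. t \<in> time_interval T \<Longrightarrow> c \<le> norm (pos (\<Gamma> t))"
  shows "T = \<infinity>"
proof (rule ccontr)
  assume "T \<noteq> \<infinity>"
  moreover have T0: "0 < T" using max by (simp add: maximal_solution_def solution_def)
  ultimately obtain \<tau> where T: "T = ereal \<tau>" "0 < \<tau>" by (cases T) auto
  have sol: "(\<Gamma> has_vector_derivative hill_field \<alpha> (\<Gamma> t)) (at t within {0..<\<tau>})" "\<Gamma> t \<in> phase_space"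
    if "t \<in> {0..<\<tau>}" for t
    using max that by (auto simp: maximal_solution_def solution_def T)
  have c_le: "c \<le> norm (pos (\<Gamma> t))" if "t \<in> {0..<\<tau>}" for t using c(2) that T by simp
  \<comment> \<open>Truncation at \<open>c / 2\<close> leaves a margin: the orbit has radius at
    least \<open>c\<close> before \<tau>, and its extension past \<tau> is controlled only by
    continuity.\<close>
  obtain L where L: "L-lipschitz_on UNIV (truncated_field \<alpha> (c / 2))"
    using truncated_field_lipschitz[of \<alpha> "c / 2"] assms(1) c by auto
  define h where "h = 1 / (2 * (L + 1))"
  have "0 \<le> L" using L by (rule lipschitz_on_nonneg)
  then have h: "0 < h" "L * h < 1" by (auto simp: h_def field_simps)
  define t\<^sub>0 where "t\<^sub>0 = max 0 (\<tau> - h / 2)"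
  have t\<^sub>0: "0 \<le> t\<^sub>0" "t\<^sub>0 < \<tau>" "\<tau> < t\<^sub>0 + h" using h T by (auto simp: t\<^sub>0_def)
  obtain u where u: "u t\<^sub>0 = \<Gamma> t\<^sub>0" and u': "\<And>t. t \<in> {t\<^sub>0..t\<^sub>0 + h} \<Longrightarrow>
      (u has_vector_derivative truncated_field \<alpha> (c / 2) (u t)) (at t within {t\<^sub>0..t\<^sub>0 + h})"
    using lipschitz_ode_exists[OF L, of h t\<^sub>0 "\<Gamma> t\<^sub>0"] h by auto
  have eq: "\<Gamma> t = u t" if t: "t \<in> {t\<^sub>0..<\<tau>}" for t
  proof (rule lipschitz_ode_unique[where u = \<Gamma> and v = u, OF L _ _ _ _ u[symmetric] t])
    show "(\<Gamma> has_vector_derivative truncated_field \<alpha> (c / 2) (\<Gamma> r)) (at r within {t\<^sub>0..<\<tau>})"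
      if "r \<in> {t\<^sub>0..<\<tau>}" for r
      using has_vector_derivative_within_subset[OF sol(1), of r "{t\<^sub>0..<\<tau>}"] that t\<^sub>0 c c_le[of r]
      by (auto simp: truncated_field_eq)
    show "(u has_vector_derivative truncated_field \<alpha> (c / 2) (u r)) (at r within {t\<^sub>0..<\<tau>})"
      if "r \<in> {t\<^sub>0..<\<tau>}" for r
      using has_vector_derivative_within_subset[OF u', of r "{t\<^sub>0..<\<tau>}"] that t\<^sub>0
      by (auto simp: subset_iff)
  qed (use t\<^sub>0 in \<open>auto simp: is_interval_co\<close>)
  have "continuous_on {t\<^sub>0..t\<^sub>0 + h} u"
    unfolding continuous_on_eq_continuous_within using has_vector_derivative_continuous u' by blast
  then have cont: "continuous_on {t\<^sub>0..t\<^sub>0 + h} (\<lambda>t. norm (pos (u t)))" by (intro continuous_intros)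
  have "\<tau> \<in> {t\<^sub>0..t\<^sub>0 + h}" "0 < c / 4" using t\<^sub>0 c by auto
  with cont obtain d where d: "0 < d" "\<And>t. t \<in> {t\<^sub>0..t\<^sub>0 + h} \<Longrightarrow> dist t \<tau> < d \<Longrightarrow>
      dist (norm (pos (u t))) (norm (pos (u \<tau>))) < c / 4"
    unfolding continuous_on_iff by metis
  define t\<^sub>1 where "t\<^sub>1 = max t\<^sub>0 (\<tau> - d / 2)"
  have t\<^sub>1: "t\<^sub>1 \<in> {t\<^sub>0..<\<tau>}" "dist t\<^sub>1 \<tau> < d" using d t\<^sub>0 by (auto simp: t\<^sub>1_def dist_real_def)
  \<comment> \<open>The lower bound passes to \<open>u\<close> just before \<tau>, where it agrees
    with the orbit; continuity carries it to \<tau> and a little beyond, at a loss of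
    \<open>c / 4\<close> each time.\<close>
  have "c \<le> norm (pos (u t\<^sub>1))" using c_le[of t\<^sub>1] eq[OF t\<^sub>1(1)] t\<^sub>1 t\<^sub>0 by auto
  moreover have "dist (norm (pos (u t\<^sub>1))) (norm (pos (u \<tau>))) < c / 4" using d(2)[of t\<^sub>1] t\<^sub>1 t\<^sub>0 by auto
  ultimately have c\<^sub>\<tau>: "3 * c / 4 < norm (pos (u \<tau>))" unfolding dist_real_def by linarith
  define T' where "T' = min (\<tau> + d) (t\<^sub>0 + h)"
  have T': "\<tau> < T'" "T' \<le> t\<^sub>0 + h" using d t\<^sub>0 by (auto simp: T'_def)
  have u_ge: "c / 2 \<le> norm (pos (u t))" if "t \<in> {\<tau>..<T'}" for t
  proof -
    have "dist (norm (pos (u t))) (norm (pos (u \<tau>))) < c / 4"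
      using that t\<^sub>0 by (intro d(2)) (auto simp: dist_real_def T'_def)
    with c\<^sub>\<tau> show ?thesis unfolding dist_real_def by linarith
  qed
  define \<Gamma>' where "\<Gamma>' t = (if t < \<tau> then \<Gamma> t else u t)" for t
  have "solution \<alpha> (ereal T') \<Gamma>'"
    unfolding solution_def
  proof (intro conjI ballI)
    show "0 < ereal T'" using T T' by simp
    fix t assume "t \<in> time_interval (ereal T')"
    then have t: "0 \<le> t" "t < T'" by auto
    have "\<Gamma>' t \<in> phase_space \<and> (\<Gamma>' has_vector_derivative hill_field \<alpha> (\<Gamma>' t)) (at t within {0..<T'})"
    proof (cases "t < \<tau>")
      case True
      have "at t within {0..<T'} = at t within {0..<\<tau>}"
        using True T' by (intro at_within_nhd[of _ "{..<\<tau>}"]) auto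
      moreover have "(\<Gamma>' has_vector_derivative hill_field \<alpha> (\<Gamma> t)) (at t within {0..<\<tau>})"
        by (rule has_vector_derivative_transform[OF _ _ sol(1)]) (use t True in \<open>auto simp: \<Gamma>'_def\<close>)
      ultimately show ?thesis using True t sol(2)[of t] by (simp add: \<Gamma>'_def)
    next
      case False
      then have ge: "c / 2 \<le> norm (pos (u t))" using t u_ge by auto
      \<comment> \<open>For \<open>t \<ge> \<tau>\<close> the filter is restricted to the open
        interval from \<open>t\<^sub>0\<close> to \<open>T'\<close>, on which the glued curve
        coincides with \<open>u\<close> on both sides of \<tau>.\<close>
      have e: "at t within {0..<T'} = at t within {t\<^sub>0<..<T'}"
        using False t T' t\<^sub>0 by (intro at_within_nhd[of _ "{t\<^sub>0<..<T'}"]) auto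
      have "(u has_vector_derivative hill_field \<alpha> (u t)) (at t within {t\<^sub>0<..<T'})"
        using has_vector_derivative_within_subset[OF u', of t "{t\<^sub>0<..<T'}"] False t T' t\<^sub>0
          truncated_field_eq[OF _ ge] c
        by (simp add: subset_iff)
      then have "(\<Gamma>' has_vector_derivative hill_field \<alpha> (u t)) (at t within {t\<^sub>0<..<T'})"
        by (rule has_vector_derivative_transform[rotated -1]) (use t False t\<^sub>0 eq in \<open>auto simp: \<Gamma>'_def\<close>)
      moreover have "u t \<in> phase_space" using ge c by (auto simp: phase_space_iff)
      ultimately show ?thesis using False by (simp add: \<Gamma>'_def e)
    qed
    then show "\<Gamma>' t \<in> phase_space"
      "(\<Gamma>' has_vector_derivative hill_field \<alpha> (\<Gamma>' t)) (at t within time_interval (ereal T'))"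
      by auto
  qed
  moreover have "T \<le> ereal T'" "\<forall>t\<in>time_interval T. \<Gamma>' t = \<Gamma> t"
    using T' by (auto simp: T \<Gamma>'_def)
  ultimately have "ereal T' = T" using max unfolding maximal_solution_def by blast
  with T T' show False by simp
qed

section \<open>Energy, the function \<open>W\<close> and invariance\<close>

text \<open>The square of the distance of the ground states from the origin.\<close>

definition ground_radius2 :: "real \<Rightarrow> real" where
  "ground_radius2 \<alpha> = \<alpha> powr (2 / (\<alpha> + 2))"

lemma ground_radius2_pos: "0 < \<alpha> \<Longrightarrow> 0 < ground_radius2 \<alpha>"
  by (simp add: ground_radius2_def)

text \<open>The exponent \<open>2 / (\<alpha> + 2)\<close> is chosen to solve the second equation,
  which is the balance of the linear and the central force on the x-axis.\<close>

lemma ground_radius2_powr: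
  assumes "0 < \<alpha>"
  shows "ground_radius2 \<alpha> powr (- (\<alpha> / 2)) = ground_radius2 \<alpha> / \<alpha>"
    and "ground_radius2 \<alpha> powr (- (\<alpha> / 2) - 1) = 1 / \<alpha>"
proof -
  have "2 / (\<alpha> + 2) * (- (\<alpha> / 2)) = 2 / (\<alpha> + 2) - 1" "2 / (\<alpha> + 2) * (- (\<alpha> / 2) - 1) = - 1"
    using assms by (simp_all add: field_simps)
  then show "ground_radius2 \<alpha> powr (- (\<alpha> / 2)) = ground_radius2 \<alpha> / \<alpha>"
    "ground_radius2 \<alpha> powr (- (\<alpha> / 2) - 1) = 1 / \<alpha>"
    unfolding ground_radius2_def powr_powr using assms
    by (simp_all only: powr_diff powr_minus_divide powr_one)
qed

lemma powr_ge_iff_le_ground_radius2: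
  assumes "0 < \<alpha>" "0 < s"
  shows "ground_radius2 \<alpha> / \<alpha> \<le> s powr (- (\<alpha> / 2)) \<longleftrightarrow> s \<le> ground_radius2 \<alpha>"
  using powr_less_mono2_neg[of "- (\<alpha> / 2)" s "ground_radius2 \<alpha>"]
    powr_less_mono2_neg[of "- (\<alpha> / 2)" "ground_radius2 \<alpha>" s] assms ground_radius2_pos[of \<alpha>]
  unfolding ground_radius2_powr(1)[OF assms(1), symmetric]
  by (cases s "ground_radius2 \<alpha>" rule: linorder_cases) auto

lemma ground_state_eq:
  assumes "0 < \<alpha>"
  shows "ground_state \<alpha> = (sqrt (ground_radius2 \<alpha>), 0, 0, 0)"
proof -
  have "2 / (\<alpha> + 2) * (1 / 2) = 1 / (\<alpha> + 2)" using assms by (simp add: field_simps)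
  then have "sqrt (ground_radius2 \<alpha>) = \<alpha> powr (1 / (\<alpha> + 2))"
    unfolding ground_radius2_def by (subst powr_half_sqrt[symmetric]) (simp_all only: powr_powr powr_ge_zero)
  then show ?thesis by (simp add: ground_state_def)
qed

lemma eq_ground_stateI:
  assumes "0 < \<alpha>" "x\<^sup>2 = ground_radius2 \<alpha>"
  shows "(x, 0, 0, 0) \<in> {ground_state \<alpha>, - ground_state \<alpha>}"
proof -
  have "\<bar>x\<bar> = sqrt (ground_radius2 \<alpha>)" using assms(2) by (metis real_sqrt_abs)
  then show ?thesis unfolding ground_state_eq[OF assms(1)] by (auto simp: abs_if split: if_splits)
qed

lemma ground_stateE:
  assumes "0 < \<alpha>" "P \<in> {ground_state \<alpha>, - ground_state \<alpha>}"
  obtains X where "P = (X, 0, 0, 0)" "X\<^sup>2 = ground_radius2 \<alpha>" "X \<noteq> 0"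
  using assms ground_radius2_pos[of \<alpha>] by (auto simp: ground_state_eq)

lemma ground_state_equilibrium:
  assumes "0 < \<alpha>" "P \<in> {ground_state \<alpha>, - ground_state \<alpha>}"
  shows "P \<in> phase_space" "hill_field \<alpha> P = 0" "W \<alpha> P = 0"
proof -
  obtain X where X: "P = (X, 0, 0, 0)" "X\<^sup>2 = ground_radius2 \<alpha>" "X \<noteq> 0"
    using ground_stateE[OF assms] .
  show "P \<in> phase_space" using X by (simp add: phase_space_def)
  have n: "(X, 0) \<noteq> (0 :: real, 0 :: real)" using X by simp
  show f: "hill_field \<alpha> P = 0"
    using assms(1) by (simp add: X(1) hill_field_eq[OF n] X(2) ground_radius2_powr zero_prod_def)
  then show "W \<alpha> P = 0"
    by (simp add: hill_field_def W_def X(1) zero_prod_def)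
qed

section \<open>Energy and \<open>W\<close> in terms of \<open>r^2\<close>, and the ground state
  energy\<close>

lemma sqrt_powr_eq: "0 \<le> s \<Longrightarrow> sqrt s powr \<alpha> = s powr (\<alpha> / 2)"
  by (simp add: powr_half_sqrt[symmetric] powr_powr)

lemma energy_eq: "energy \<alpha> (x, y, p, q) =
    (p\<^sup>2 + q\<^sup>2) / 2 - (\<alpha> + 2) / 2 * x\<^sup>2 - (\<alpha> + 2) * (x\<^sup>2 + y\<^sup>2) powr (- (\<alpha> / 2))"
proof -
  have "(x\<^sup>2 + y\<^sup>2) powr (- (\<alpha> / 2)) = 1 / sqrt (x\<^sup>2 + y\<^sup>2) powr \<alpha>"
    by (simp add: sqrt_powr_eq powr_minus_divide)
  then show ?thesis by (simp add: energy_def V_def field_simps)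
qed

lemma W_eq':
  assumes "(x, y) \<noteq> (0, 0)"
  shows "W \<alpha> (x, y, p, q) = (\<alpha> + 2) * (x\<^sup>2 - \<alpha> * (x\<^sup>2 + y\<^sup>2) powr (- (\<alpha> / 2)))"
proof -
  have "(x\<^sup>2 + y\<^sup>2) powr (- (\<alpha> / 2)) = 1 / sqrt (x\<^sup>2 + y\<^sup>2) powr \<alpha>"
    by (simp add: sqrt_powr_eq powr_minus_divide)
  then show ?thesis by (simp add: W_eq[OF assms])
qed

text \<open>\<open>W \<ge> 0\<close> gives
  \<open>\<alpha> r^(-\<alpha>) \<le> x^2 \<le> r^2\<close>; the left-hand side decreases in r, the
  right-hand side increases, and they meet at r_*.\<close>

lemma W_nonneg_imp_ge:
  assumes "0 < \<alpha>" "(x, y) \<noteq> (0, 0)" "0 \<le> W \<alpha> (x, y, p, q)"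
  shows "ground_radius2 \<alpha> \<le> x\<^sup>2 + y\<^sup>2"
proof (rule ccontr)
  assume c: "\<not> ?thesis"
  have s: "0 < x\<^sup>2 + y\<^sup>2" using assms(2) by (simp add: sum_power2_gt_zero_iff)
  with c have "ground_radius2 \<alpha> / \<alpha> \<le> (x\<^sup>2 + y\<^sup>2) powr (- (\<alpha> / 2))"
    by (subst powr_ge_iff_le_ground_radius2) (use assms in auto)
  moreover have "\<alpha> * (x\<^sup>2 + y\<^sup>2) powr (- (\<alpha> / 2)) \<le> x\<^sup>2"
    using assms by (simp add: W_eq' zero_le_mult_iff)
  ultimately have "ground_radius2 \<alpha> \<le> x\<^sup>2" using assms(1) by (simp add: field_simps)
  with c show False by (smt (verit) zero_le_power2)
qed

text \<open>Eliminating \<open>x^2\<close> by \<open>W = 0\<close> leaves the kinetic energy minus a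
  positive multiple of \<open>w\<close>, and \<open>w\<close> is largest at the smallest admissible
  radius r_*. The two gaps are nonnegative, so equality in the energy closes both.\<close>

lemma energy_on_W_zero:
  assumes "0 < \<alpha>" "(x, y) \<noteq> (0, 0)" "W \<alpha> (x, y, p, q) = 0"
  shows "- (\<alpha> + 2)\<^sup>2 * ground_radius2 \<alpha> / (2 * \<alpha>) \<le> energy \<alpha> (x, y, p, q)"
    and "energy \<alpha> (x, y, p, q) = - (\<alpha> + 2)\<^sup>2 * ground_radius2 \<alpha> / (2 * \<alpha>) \<Longrightarrow>
      (x, y, p, q) \<in> {ground_state \<alpha>, - ground_state \<alpha>}"
proof -
  define w where "w = (x\<^sup>2 + y\<^sup>2) powr (- (\<alpha> / 2))"
  define R where "R = ground_radius2 \<alpha>"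
  have s: "0 < x\<^sup>2 + y\<^sup>2" using assms(2) by (simp add: sum_power2_gt_zero_iff)
  have R: "R \<le> x\<^sup>2 + y\<^sup>2" using W_nonneg_imp_ge[OF assms(1,2), of p q] assms(3) by (simp add: R_def)
  have x: "x\<^sup>2 = \<alpha> * w" using assms by (simp add: W_eq' w_def)
  have w: "w \<le> R / \<alpha>"
    using powr_mono2'[of "- (\<alpha> / 2)" R "x\<^sup>2 + y\<^sup>2"] R assms(1) ground_radius2_pos[of \<alpha>]
    by (simp add: w_def R_def ground_radius2_powr)
  have E: "energy \<alpha> (x, y, p, q) = (p\<^sup>2 + q\<^sup>2) / 2 - (\<alpha> + 2)\<^sup>2 / 2 * w"
    using energy_eq[of \<alpha> x y p q, folded w_def] unfolding x
    by (simp add: power2_eq_square field_simps)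
  define B where "B = (\<alpha> + 2)\<^sup>2 / 2"
  have B: "0 < B" using assms(1) by (simp add: B_def)
  have E\<^sub>0: "- (\<alpha> + 2)\<^sup>2 * ground_radius2 \<alpha> / (2 * \<alpha>) = - (B * (R / \<alpha>))"
    by (simp add: B_def R_def)
  have w': "0 \<le> B * (R / \<alpha> - w)" using w B by simp
  have pq': "0 \<le> (p\<^sup>2 + q\<^sup>2) / 2" by simp
  have E': "energy \<alpha> (x, y, p, q) - - (B * (R / \<alpha>)) = (p\<^sup>2 + q\<^sup>2) / 2 + B * (R / \<alpha> - w)"
    unfolding E B_def[symmetric] by (simp add: right_diff_distrib)
  show "- (\<alpha> + 2)\<^sup>2 * ground_radius2 \<alpha> / (2 * \<alpha>) \<le> energy \<alpha> (x, y, p, q)"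
    unfolding E\<^sub>0 using E' w' pq' by linarith
  assume "energy \<alpha> (x, y, p, q) = - (\<alpha> + 2)\<^sup>2 * ground_radius2 \<alpha> / (2 * \<alpha>)"
  then have "(p\<^sup>2 + q\<^sup>2) / 2 = 0" "B * (R / \<alpha> - w) = 0"
    unfolding E\<^sub>0 using E' w' pq' by linarith+
  then have pq: "p = 0" "q = 0" and w: "w = R / \<alpha>" using B by auto
  have "x\<^sup>2 + y\<^sup>2 \<le> R"
    using powr_ge_iff_le_ground_radius2[OF assms(1) s] w by (simp add: w_def R_def)
  moreover have xR: "x\<^sup>2 = R" using x w assms(1) by simp
  ultimately have "y = 0" by simp
  then show "(x, y, p, q) \<in> {ground_state \<alpha>, - ground_state \<alpha>}"
    using eq_ground_stateI[OF assms(1)] xR pq by (simp add: R_def)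
qed

text \<open>The infimum is a minimum, attained at \<open>ground_state \<alpha>\<close>. Since
  \<open>ground_radius2 \<alpha> / \<alpha> = \<alpha> powr (- \<alpha> / (\<alpha> + 2))\<close>,
  the value is the familiar closed form.\<close>

lemma ground_energy_eq:
  assumes "0 < \<alpha>"
  shows "ground_energy \<alpha> = - (\<alpha> + 2)\<^sup>2 * ground_radius2 \<alpha> / (2 * \<alpha>)"
  unfolding ground_energy_def
proof (rule cInf_eq_minimum)
  have e: "ground_state \<alpha> \<in> {\<Gamma> \<in> phase_space. W \<alpha> \<Gamma> = 0}"
    using ground_state_equilibrium[OF assms, of "ground_state \<alpha>"] by simp
  have "energy \<alpha> (ground_state \<alpha>) = - (\<alpha> + 2)\<^sup>2 * ground_radius2 \<alpha> / (2 * \<alpha>)"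
    unfolding ground_state_eq[OF assms] energy_eq using assms ground_radius2_pos[OF assms]
    by (simp add: ground_radius2_powr field_simps power2_eq_square)
  with e show "- (\<alpha> + 2)\<^sup>2 * ground_radius2 \<alpha> / (2 * \<alpha>) \<in> energy \<alpha> ` {\<Gamma> \<in> phase_space. W \<alpha> \<Gamma> = 0}"
    by (intro image_eqI[of _ _ "ground_state \<alpha>"]) simp_all
  fix e assume "e \<in> energy \<alpha> ` {\<Gamma> \<in> phase_space. W \<alpha> \<Gamma> = 0}"
  then show "- (\<alpha> + 2)\<^sup>2 * ground_radius2 \<alpha> / (2 * \<alpha>) \<le> e"
    using energy_on_W_zero(1)[OF assms] by (auto simp: phase_space_def)
qed

section \<open>Quantities along an orbit and the sign of \<open>W\<close>\<close>

locale hill_orbit =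
  fixes \<alpha> :: real and T :: ereal and \<Gamma> :: "real \<Rightarrow> state"
  assumes alpha: "2 \<le> \<alpha>" and sol: "solution \<alpha> T \<Gamma>"
begin

abbreviation "I \<equiv> time_interval T"
definition "x t = fst (\<Gamma> t)"
definition "y t = fst (snd (\<Gamma> t))"
definition "p t = fst (snd (snd (\<Gamma> t)))"
definition "q t = snd (snd (snd (\<Gamma> t)))"
definition "s t = (x t)\<^sup>2 + (y t)\<^sup>2"
definition "w t = s t powr (- (\<alpha> / 2))"
definition "\<phi> t = s t powr (- (\<alpha> / 2) - 1)"
text \<open>Half of the derivative of \<open>r^2\<close>.\<close>

definition "j t = x t * p t + y t * q t"
definition "v2 t = (p t)\<^sup>2 + (q t)\<^sup>2"
text \<open>The derivative of \<open>j\<close>: the Coriolis force contributes the cross term, and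
  the potential force contributes \<open>W\<close>, which is minus the inner product of the position
  with the gradient of V.\<close>

definition "dj t = v2 t + 2 * (x t * q t - y t * p t) + W \<alpha> (\<Gamma> t)"
definition "R = ground_radius2 \<alpha>"

lemma \<Gamma>_eq: "\<Gamma> t = (x t, y t, p t, q t)"
  by (simp add: x_def y_def p_def q_def)

lemma alpha_pos: "0 < \<alpha>"
  using alpha by simp

lemma R_pos: "0 < R"
  using alpha by (simp add: R_def ground_radius2_pos)

lemma norm_pos: "norm (pos (\<Gamma> t)) = sqrt (s t)"
  by (simp add: \<Gamma>_eq norm_Pair s_def)

lemma zero_in_I: "0 \<in> I"
  using sol by (simp add: solution_def zero_in_time_interval)

lemma not_collision: "t \<in> I \<Longrightarrow> (x t, y t) \<noteq> (0, 0)"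
  using sol by (auto simp: solution_def phase_space_iff \<Gamma>_eq zero_prod_def)

lemma s_pos: "t \<in> I \<Longrightarrow> 0 < s t"
  using not_collision[of t] by (simp add: s_def sum_power2_gt_zero_iff)

lemma s_nonneg: "0 \<le> s t"
  by (simp add: s_def)

lemma w_eq: "t \<in> I \<Longrightarrow> w t = s t * \<phi> t"
  using s_pos[of t] by (simp add: w_def \<phi>_def powr_diff)

lemma has_vector_derivative_\<Gamma>:
  assumes "t \<in> I"
  shows "(\<Gamma> has_vector_derivative (p t, q t,
    2 * q t + (\<alpha> + 2) * x t - (\<alpha> + 2) * \<alpha> * x t * \<phi> t,
    - 2 * p t - (\<alpha> + 2) * \<alpha> * y t * \<phi> t)) (at t within I)"
  using sol assms hill_field_eq[OF not_collision[OF assms], of \<alpha> "p t" "q t"]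
  unfolding s_def[symmetric] \<phi>_def[symmetric] \<Gamma>_eq[symmetric]
  unfolding solution_def by metis

lemma
  assumes "t \<in> I"
  shows deriv_x: "(x has_real_derivative p t) (at t within I)"
    and deriv_y: "(y has_real_derivative q t) (at t within I)"
    and deriv_p: "(p has_real_derivative 2 * q t + (\<alpha> + 2) * x t - (\<alpha> + 2) * \<alpha> * x t * \<phi> t) (at t within I)"
    and deriv_q: "(q has_real_derivative - 2 * p t - (\<alpha> + 2) * \<alpha> * y t * \<phi> t) (at t within I)"
proof -
  note d = has_vector_derivative_\<Gamma>[OF assms]
  note f = bounded_linear.has_vector_derivative[OF bounded_linear_fst]
  note g = bounded_linear.has_vector_derivative[OF bounded_linear_snd]
  show "(x has_real_derivative p t) (at t within I)"
    using f[OF d] by (simp add: x_def[abs_def] has_real_derivative_iff_has_vector_derivative)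
  show "(y has_real_derivative q t) (at t within I)"
    using f[OF g[OF d]] by (simp add: y_def[abs_def] has_real_derivative_iff_has_vector_derivative)
  show "(p has_real_derivative 2 * q t + (\<alpha> + 2) * x t - (\<alpha> + 2) * \<alpha> * x t * \<phi> t) (at t within I)"
    using f[OF g[OF g[OF d]]] by (simp add: p_def[abs_def] has_real_derivative_iff_has_vector_derivative)
  show "(q has_real_derivative - 2 * p t - (\<alpha> + 2) * \<alpha> * y t * \<phi> t) (at t within I)"
    using g[OF g[OF g[OF d]]] by (simp add: q_def[abs_def] has_real_derivative_iff_has_vector_derivative)
qed

lemma deriv_s:
  assumes "t \<in> I"
  shows "(s has_real_derivative 2 * j t) (at t within I)"
  unfolding s_def[abs_def]
  by (rule derivative_eq_intros deriv_x deriv_y assms refl)+ (simp add: j_def)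

lemma W_\<Gamma>: "t \<in> I \<Longrightarrow> W \<alpha> (\<Gamma> t) = (\<alpha> + 2) * ((x t)\<^sup>2 - \<alpha> * w t)"
  using W_eq'[OF not_collision] by (simp add: \<Gamma>_eq w_def s_def)

lemma deriv_j:
  assumes "t \<in> I"
  shows "(j has_real_derivative dj t) (at t within I)"
proof -
  have e: "W \<alpha> (\<Gamma> t) = (\<alpha> + 2) * ((x t)\<^sup>2 - \<alpha> * (((x t)\<^sup>2 + (y t)\<^sup>2) * \<phi> t))"
    using W_\<Gamma>[OF assms] w_eq[OF assms] by (simp add: s_def)
  show ?thesis
    unfolding j_def[abs_def] dj_def e
    by (rule derivative_eq_intros deriv_x deriv_y deriv_p deriv_q assms refl)+
      (simp add: v2_def algebra_simps power2_eq_square)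
qed

lemma deriv_w:
  assumes "t \<in> I"
  shows "(w has_real_derivative - \<alpha> * \<phi> t * j t) (at t within I)"
proof -
  have "((\<lambda>z. z powr (- (\<alpha> / 2))) has_real_derivative (- (\<alpha> / 2)) * s t powr (- (\<alpha> / 2) - 1)) (at (s t))"
    by (rule has_real_derivative_powr[OF s_pos[OF assms]])
  from DERIV_chain2[OF this deriv_s[OF assms]] show ?thesis
    unfolding \<phi>_def w_def[abs_def] by (simp add: mult.assoc)
qed

lemma energy_\<Gamma>: "energy \<alpha> (\<Gamma> t) = v2 t / 2 - (\<alpha> + 2) / 2 * (x t)\<^sup>2 - (\<alpha> + 2) * w t"
  by (simp add: \<Gamma>_eq energy_eq v2_def w_def s_def)

lemma energy_conserved:
  assumes "t \<in> I"
  shows "energy \<alpha> (\<Gamma> t) = energy \<alpha> (\<Gamma> 0)"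
proof -
  have d: "((\<lambda>t. energy \<alpha> (\<Gamma> t)) has_real_derivative 0) (at r within I)" if "r \<in> I" for r
  proof -
    have "((\<lambda>t. (1 / 2) * (p t)\<^sup>2 + (1 / 2) * (q t)\<^sup>2 - (\<alpha> + 2) * ((1 / 2) * (x t)\<^sup>2) - (\<alpha> + 2) * w t)
      has_real_derivative 0) (at r within I)"
      by (rule derivative_eq_intros deriv_x deriv_p deriv_q deriv_w that refl)+
        (simp add: j_def algebra_simps power2_eq_square)
    then show ?thesis by (simp add: energy_\<Gamma> v2_def add_divide_distrib[of "(p _)\<^sup>2"])
  qed
  have sub: "{0..t} \<subseteq> I" using Icc_subset_time_interval[OF assms] by simp
  have t: "0 \<le> t" using assms by (simp add: time_interval_def)
  show ?thesis
  proof (rule antisym)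
    show "energy \<alpha> (\<Gamma> 0) \<le> energy \<alpha> (\<Gamma> t)"
      by (rule deriv_nonneg_imp_le[OF t sub, where f' = "\<lambda>_. 0"]) (use d sub in auto)
    have "- energy \<alpha> (\<Gamma> 0) \<le> - energy \<alpha> (\<Gamma> t)"
      by (rule deriv_nonneg_imp_le[OF t sub, where f' = "\<lambda>_. 0"])
        (use DERIV_minus[OF d] sub in auto)
    then show "energy \<alpha> (\<Gamma> t) \<le> energy \<alpha> (\<Gamma> 0)" by simp
  qed
qed

lemma continuous_on_components:
  "continuous_on I x" "continuous_on I y" "continuous_on I p" "continuous_on I q"
  "continuous_on I s" "continuous_on I w"
  by (rule DERIV_continuous_on, erule deriv_x deriv_y deriv_p deriv_q deriv_s deriv_w)+

lemma continuous_on_W: "continuous_on I (\<lambda>t. W \<alpha> (\<Gamma> t))"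
proof -
  have "continuous_on I (\<lambda>t. (\<alpha> + 2) * ((x t)\<^sup>2 - \<alpha> * w t))"
    by (intro continuous_intros continuous_on_components)
  then show ?thesis by (rule continuous_on_eq) (simp add: W_\<Gamma>)
qed

lemma W_zero_imp_constant:
  assumes E: "energy \<alpha> (\<Gamma> 0) = ground_energy \<alpha>" and t: "t \<in> I" "W \<alpha> (\<Gamma> t) = 0" and r: "r \<in> I"
  shows "W \<alpha> (\<Gamma> r) = 0"
proof -
  have E': "energy \<alpha> (\<Gamma> t) = ground_energy \<alpha>" using E energy_conserved[OF t(1)] by simp
  have "\<Gamma> t \<in> {ground_state \<alpha>, - ground_state \<alpha>}"
    using energy_on_W_zero(2)[OF alpha_pos not_collision[OF t(1)], of "p t" "q t"] t(2) E'
      ground_energy_eq[OF alpha_pos] by (simp add: \<Gamma>_eq)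
  note P = ground_state_equilibrium[OF alpha_pos this]
  have "\<Gamma> r = \<Gamma> t"
    using alpha by (intro solution_at_equilibrium[OF _ sol P(1,2) t(1) refl r]) simp
  with P(3) show ?thesis by simp
qed

lemma W_sign_constant:
  assumes E: "energy \<alpha> (\<Gamma> 0) = ground_energy \<alpha>" and t: "t \<in> I"
  shows "0 < W \<alpha> (\<Gamma> t) \<longleftrightarrow> 0 < W \<alpha> (\<Gamma> 0)"
proof (rule ccontr)
  assume c: "\<not> ?thesis"
  have sub: "{0..t} \<subseteq> I" and t0: "0 \<le> t"
    using Icc_subset_time_interval[OF t] t by (auto simp: time_interval_def)
  \<comment> \<open>A change between \<open>W > 0\<close> and \<open>W \<le> 0\<close> forces a zero
    of \<open>W\<close> in between, hence \<open>W = 0\<close> at all times, against the positive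
    value.\<close>
  have "connected ((\<lambda>t. W \<alpha> (\<Gamma> t)) ` {0..t})"
    by (intro connected_continuous_image continuous_on_subset[OF continuous_on_W sub]) simp
  then have "0 \<in> (\<lambda>t. W \<alpha> (\<Gamma> t)) ` {0..t}"
    using c t0 connectedD_interval[of _ "W \<alpha> (\<Gamma> 0)" "W \<alpha> (\<Gamma> t)" 0]
      connectedD_interval[of _ "W \<alpha> (\<Gamma> t)" "W \<alpha> (\<Gamma> 0)" 0] by (auto simp: not_less)
  then obtain r where "r \<in> I" "W \<alpha> (\<Gamma> r) = 0" using sub by auto
  with c show False
    using W_zero_imp_constant[OF E, of r] t zero_in_I by auto
qed

end

section \<open>Invariance of both sets, and global existence for \<open>W > 0\<close>\<close>

lemma maximal_solution_imp_hill_orbit: "2 \<le> \<alpha> \<Longrightarrow> maximal_solution \<alpha> T \<Gamma> \<Longrightarrow> hill_orbit \<alpha> T \<Gamma>"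
  unfolding maximal_solution_def hill_orbit_def by blast

lemma invariant_W_plus:
  assumes "2 \<le> \<alpha>"
  shows "invariant_set \<alpha> (W_plus \<alpha>)"
  unfolding invariant_set_def
proof (intro allI impI ballI)
  fix T \<Gamma> t
  assume a: "maximal_solution \<alpha> T \<Gamma> \<and> \<Gamma> 0 \<in> W_plus \<alpha>" and t: "t \<in> time_interval T"
  interpret hill_orbit \<alpha> T \<Gamma> by (rule maximal_solution_imp_hill_orbit) (use assms a in simp_all)
  show "\<Gamma> t \<in> W_plus \<alpha>"
    using a W_sign_constant[OF _ t] energy_conserved[OF t] sol t by (auto simp: W_plus_def solution_def)
qed

lemma invariant_W_minus:
  assumes "2 \<le> \<alpha>"
  shows "invariant_set \<alpha> (W_minus \<alpha>)"
  unfolding invariant_set_def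
proof (intro allI impI ballI)
  fix T \<Gamma> t
  assume a: "maximal_solution \<alpha> T \<Gamma> \<and> \<Gamma> 0 \<in> W_minus \<alpha>" and t: "t \<in> time_interval T"
  interpret hill_orbit \<alpha> T \<Gamma> by (rule maximal_solution_imp_hill_orbit) (use assms a in simp_all)
  show "\<Gamma> t \<in> W_minus \<alpha>"
    using a W_sign_constant[OF _ t] energy_conserved[OF t] sol t
    by (auto simp: W_minus_def solution_def not_less[symmetric])
qed

lemma W_plus_global:
  assumes "2 \<le> \<alpha>" and max: "maximal_solution \<alpha> T \<Gamma>" and init: "\<Gamma> 0 \<in> W_plus \<alpha>"
  shows "T = \<infinity>"
proof -
  interpret hill_orbit \<alpha> T \<Gamma> by (rule maximal_solution_imp_hill_orbit) (fact assms)+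
  show ?thesis
  proof (rule bounded_away_from_collision_imp_global[OF _ max])
    show "0 < sqrt R" using R_pos by simp
    fix t assume t: "t \<in> I"
    have "0 < W \<alpha> (\<Gamma> t)" using init W_sign_constant[OF _ t] by (simp add: W_plus_def)
    then have "R \<le> s t"
      using W_nonneg_imp_ge[OF alpha_pos not_collision[OF t], of "p t" "q t"]
      by (simp add: \<Gamma>_eq R_def s_def)
    then show "sqrt R \<le> norm (pos (\<Gamma> t))" by (simp add: norm_pos)
  qed (use alpha in simp)
qed

section \<open>Concavity of the squared radius\<close>

text \<open>Bernoulli's inequality: a convex power lies above its tangent at 1.\<close>

lemma powr_ge_tangent:
  fixes a \<sigma> :: real
  assumes "1 \<le> a" "0 < \<sigma>" "\<sigma> \<le> 1"
  shows "1 - a * (1 - \<sigma>) \<le> \<sigma> powr a"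
proof -
  have "a * \<sigma> - \<sigma> powr a \<le> a * 1 - 1 powr a"
  proof (rule deriv_nonneg_imp_le[OF assms(3) order_refl])
    fix t assume t: "t \<in> {\<sigma>..1}"
    then have t0: "0 < t" using assms by simp
    show "((\<lambda>t. a * t - t powr a) has_real_derivative a * 1 - a * t powr (a - 1)) (at t within {\<sigma>..1})"
      by (intro DERIV_diff DERIV_cmult DERIV_ident has_field_derivative_at_within[OF has_real_derivative_powr[OF t0]])
    have "t powr (a - 1) \<le> 1 powr (a - 1)" using t t0 assms by (intro powr_mono2) auto
    then show "0 \<le> a * 1 - a * t powr (a - 1)" using assms by simp
  qed
  then show ?thesis by (simp add: algebra_simps)
qed

text \<open>The inequality behind the concavity of \<open>r\<^sup>2\<close>, in the variables \<open>\<sigma> = (r / r\<^sub>*)\<^sup>2\<close> and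
  \<open>\<omega> = (r / r\<^sub>*)\<^sup>-\<^sup>\<alpha>\<close> with \<open>a = \<alpha> / 2\<close> and \<open>r\<^sub>*\<close> the distance of the ground states from the origin;
  here the hypothesis \<open>\<alpha> \<ge> 2\<close> enters.\<close>

lemma virial_inequality:
  fixes a \<sigma> \<omega> :: real
  assumes a: "1 \<le> a" and \<sigma>: "0 < \<sigma>" "\<sigma> \<le> 1" and \<omega>: "\<omega> = \<sigma> powr - a"
  shows "2 * a / (a + 1) * \<sigma> * (\<omega> - 1 - a * (1 - \<sigma>)) \<le> ((a - 1) * (\<omega> - 1) + (2 * a - 1) * (1 - \<sigma>))\<^sup>2"
    and "1 \<le> \<omega>"
proof -
  define n d where "n = \<omega> - 1" and "d = 1 - \<sigma>"
  have d: "0 \<le> d" using \<sigma> by (simp add: d_def)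
  show "1 \<le> \<omega>" using powr_mono2'[of "- a" \<sigma> 1] a \<sigma> by (simp add: \<omega>)
  then have n: "0 \<le> n" by (simp add: n_def)
  \<comment> \<open>Multiplied by \<omega>, Bernoulli's inequality becomes
    \<open>(1 + n) (1 - a d) \<le> 1\<close>, so \<open>n - a d\<close> is bounded by the
    second-order term \<open>a d n\<close>.\<close>
  have "\<omega> * (1 - a * d) \<le> \<omega> * \<sigma> powr a"
    using powr_ge_tangent[OF a \<sigma>] by (intro mult_left_mono) (auto simp: d_def \<omega>)
  also have "\<dots> = 1" using \<sigma> by (simp add: \<omega> powr_add[symmetric])
  finally have "\<sigma> * (n - a * d) \<le> (a - 1) * d * n + a * d\<^sup>2"
    by (simp add: n_def d_def algebra_simps power2_eq_square)
  then have "2 * a / (a + 1) * (\<sigma> * (n - a * d)) \<le> 2 * a / (a + 1) * ((a - 1) * d * n + a * d\<^sup>2)"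
    using a by (intro mult_left_mono) auto
  also have "\<dots> = 2 * a / (a + 1) * ((a - 1) * d * n) + 2 / (a + 1) * (a\<^sup>2 * d\<^sup>2)"
    unfolding distrib_left by (simp add: power2_eq_square)
  also have "\<dots> \<le> 2 * (2 * a - 1) * ((a - 1) * d * n) + 1 * ((2 * a - 1)\<^sup>2 * d\<^sup>2)"
  proof (intro add_mono mult_mono)
    have "2 * a \<le> 2 * (a + 1)" "0 \<le> a * (a - 1)" using a by simp_all
    then have "2 * a / (a + 1) \<le> 2" using a by (simp add: divide_le_eq)
    then show "2 * a / (a + 1) \<le> 2 * (2 * a - 1)" by (rule order_trans) (use a in simp)
    show "a\<^sup>2 \<le> (2 * a - 1)\<^sup>2" using a by (intro power_mono) auto
  qed (use a d n in auto)
  also have "\<dots> \<le> ((a - 1) * n + (2 * a - 1) * d)\<^sup>2"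
    using zero_le_power2[of "(a - 1) * n"] by (simp add: power2_eq_square algebra_simps)
  finally show "2 * a / (a + 1) * \<sigma> * (\<omega> - 1 - a * (1 - \<sigma>)) \<le> ((a - 1) * (\<omega> - 1) + (2 * a - 1) * (1 - \<sigma>))\<^sup>2"
    by (simp add: n_def d_def mult.assoc)
qed

lemma cross_power2_le:
  fixes x y p q :: real
  shows "(x * q - y * p)\<^sup>2 \<le> (x\<^sup>2 + y\<^sup>2) * (p\<^sup>2 + q\<^sup>2)"
proof -
  have "(x\<^sup>2 + y\<^sup>2) * (p\<^sup>2 + q\<^sup>2) = (x * q - y * p)\<^sup>2 + (x * p + y * q)\<^sup>2"
    by (simp add: power2_eq_square algebra_simps)
  then show ?thesis by simp
qed

locale W_minus_orbit = hill_orbit +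
  assumes initial: "\<Gamma> 0 \<in> W_minus \<alpha>"
begin

text \<open>Half of the constant in the inequality for \<open>\<delta>''\<close>, because
  \<open>j\<close> is half of the derivative of \<open>r^2\<close>.\<close>

definition "\<kappa> = 2 * ((\<alpha> + 2) / \<alpha>)"

lemma \<kappa>_pos: "0 < \<kappa>"
  using alpha_pos by (simp add: \<kappa>_def)

lemma W_nonpos: "t \<in> I \<Longrightarrow> W \<alpha> (\<Gamma> t) \<le> 0"
  using W_sign_constant[of t] initial by (auto simp: W_minus_def not_less[symmetric])

lemma kinetic_eq:
  assumes "t \<in> I"
  shows "v2 t = (\<alpha> + 2) * (x t)\<^sup>2 + 2 * (\<alpha> + 2) * w t - (\<alpha> + 2)\<^sup>2 * R / \<alpha>"
proof -
  have "energy \<alpha> (\<Gamma> t) = - (\<alpha> + 2)\<^sup>2 * R / (2 * \<alpha>)"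
    using initial energy_conserved[OF assms] ground_energy_eq[OF alpha_pos] by (simp add: W_minus_def R_def)
  then show ?thesis unfolding energy_\<Gamma> by (simp add: field_simps)
qed

text \<open>Inserting \<open>x^2 \<le> \<alpha> w\<close>, which is \<open>W \<le> 0\<close>, into
  the energy equation gives \<open>0 \<le> v2 \<le> (\<alpha> + 2)^2 (w - R / \<alpha>)\<close>:
  nonnegative kinetic energy bounds \<open>w\<close> from below and hence the radius from
  above.\<close>

lemma s_le_R:
  assumes "t \<in> I"
  shows "s t \<le> R"
proof -
  have "(x t)\<^sup>2 \<le> \<alpha> * w t"
    using W_nonpos[OF assms] alpha_pos by (simp add: W_\<Gamma>[OF assms] mult_le_0_iff)
  then have "(\<alpha> + 2) * (x t)\<^sup>2 \<le> (\<alpha> + 2) * (\<alpha> * w t)" using alpha_pos by (intro mult_left_mono) auto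
  also have "\<dots> = (\<alpha> + 2)\<^sup>2 * w t - 2 * (\<alpha> + 2) * w t"
    by (simp add: power2_eq_square algebra_simps)
  finally have x: "(\<alpha> + 2) * (x t)\<^sup>2 \<le> (\<alpha> + 2)\<^sup>2 * w t - 2 * (\<alpha> + 2) * w t" .
  have "0 \<le> v2 t" by (simp add: v2_def)
  then have "(\<alpha> + 2)\<^sup>2 * R / \<alpha> \<le> (\<alpha> + 2)\<^sup>2 * w t"
    unfolding kinetic_eq[OF assms] using x by (simp only: diff_ge_0_iff_ge le_diff_eq)
  then have "(\<alpha> + 2)\<^sup>2 * (R / \<alpha>) \<le> (\<alpha> + 2)\<^sup>2 * w t" by simp
  then have "R / \<alpha> \<le> w t" using alpha_pos by (subst (asm) mult_le_cancel_left_pos) simp_all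
  then show ?thesis
    using powr_ge_iff_le_ground_radius2[OF alpha_pos s_pos[OF assms]] by (simp add: w_def R_def)
qed

lemma w_scaled:
  assumes "t \<in> I"
  shows "w t = R / \<alpha> * (s t / R) powr - (\<alpha> / 2)"
proof -
  have "(s t / R) powr - (\<alpha> / 2) = w t / R powr - (\<alpha> / 2)"
    using s_pos[OF assms] R_pos by (simp add: w_def powr_divide)
  then show ?thesis
    using R_pos alpha_pos by (simp add: R_def ground_radius2_powr)
qed

lemma virial_bound:
  assumes "t \<in> I"
  shows "dj t \<le> - (\<kappa> * (R - s t))"
proof -
  \<comment> \<open>\<open>K\<close> makes \<open>(\<alpha> + 2) w = K \<omega>\<close> and
    \<open>(\<alpha> + 2) r^2 = 2 a K \<sigma>\<close>, so the bounds below all take the form of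
    \<open>K\<close> times a function of \<sigma> and \<omega>.\<close>
  define a \<sigma> K where "a = \<alpha> / 2" and "\<sigma> = s t / R" and "K = (a + 1) * R / a"
  define \<omega> where "\<omega> = \<sigma> powr - a"
  have \<alpha>: "\<alpha> = 2 * a" and a: "1 \<le> a" using alpha by (auto simp: a_def)
  have \<sigma>: "0 < \<sigma>" "\<sigma> \<le> 1" using s_pos[OF assms] s_le_R[OF assms] R_pos by (auto simp: \<sigma>_def)
  have K: "0 < K" using a R_pos by (simp add: K_def)
  have w: "(\<alpha> + 2) * w t = K * \<omega>" and s: "(\<alpha> + 2) * s t = 2 * a * (K * \<sigma>)"
    and R: "(\<alpha> + 2)\<^sup>2 * R / \<alpha> = 2 * (a + 1) * K"
    using w_scaled[OF assms] a R_pos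
    by (auto simp: \<alpha> \<omega>_def \<sigma>_def K_def field_simps power2_eq_square)
  have x: "(\<alpha> + 2) * (x t)\<^sup>2 \<le> 2 * a * (K * \<sigma>)"
    unfolding s[symmetric] using alpha_pos by (intro mult_left_mono) (auto simp: s_def)
  have v2: "v2 t \<le> 2 * K * (\<omega> - 1 - a * (1 - \<sigma>))"
    using kinetic_eq[OF assms] w x R by (simp add: algebra_simps)
  \<comment> \<open>\<open>K Y\<close> will bound the cross term. Its coefficient
    \<open>2 a - 1\<close> is one less than the \<open>2 a\<close> available in
    \<open>v2 + W\<close>; the difference, \<open>K (1 - \<sigma>)\<close>, is the margin of
    concavity.\<close>
  define Y where "Y = (a - 1) * (\<omega> - 1) + (2 * a - 1) * (1 - \<sigma>)"
  have Y: "0 \<le> Y"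
    using virial_inequality(2)[OF a \<sigma> \<omega>_def] a \<sigma> by (simp add: Y_def)
  have "(x t * q t - y t * p t)\<^sup>2 \<le> s t * v2 t"
    unfolding s_def v2_def by (rule cross_power2_le)
  also have "\<dots> \<le> s t * (2 * K * (\<omega> - 1 - a * (1 - \<sigma>)))"
    using v2 s_nonneg by (rule mult_left_mono)
  also have "\<dots> = K\<^sup>2 * (2 * a / (a + 1) * \<sigma> * (\<omega> - 1 - a * (1 - \<sigma>)))"
  proof -
    have "s t = K * (a / (a + 1) * \<sigma>)" using a R_pos by (simp add: K_def \<sigma>_def)
    then show ?thesis by (simp add: power2_eq_square)
  qed
  also have "\<dots> \<le> K\<^sup>2 * Y\<^sup>2"
    unfolding Y_def by (intro mult_left_mono virial_inequality(1)[OF a \<sigma> \<omega>_def]) simp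
  finally have "\<bar>x t * q t - y t * p t\<bar> \<le> K * Y"
    using K Y by (simp add: power_mult_distrib[symmetric] abs_le_square_iff[symmetric])
  then have cross: "x t * q t - y t * p t \<le> K * Y" by simp
  have "v2 t + W \<alpha> (\<Gamma> t) = 2 * ((\<alpha> + 2) * (x t)\<^sup>2) + 2 * (K * \<omega>) - 2 * a * (K * \<omega>) - 2 * (a + 1) * K"
    unfolding kinetic_eq[OF assms] W_\<Gamma>[OF assms] w[symmetric] R[symmetric] by (simp add: \<alpha> algebra_simps)
  also have "\<dots> \<le> - 2 * (K * ((a - 1) * (\<omega> - 1) + 2 * a * (1 - \<sigma>)))"
    using x by (simp add: algebra_simps)
  finally have "dj t \<le> - (2 * (K * (1 - \<sigma>)))"
    using cross by (simp add: dj_def Y_def algebra_simps)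
  also have "2 * (K * (1 - \<sigma>)) = \<kappa> * (R - s t)"
  proof -
    have "\<kappa> = 2 * ((a + 1) / a)" using alpha_pos by (simp add: \<kappa>_def a_def field_simps)
    then have "2 * K = \<kappa> * R" by (simp add: K_def)
    moreover have "R * (1 - \<sigma>) = R - s t" using R_pos by (simp add: \<sigma>_def field_simps)
    ultimately show ?thesis by (metis mult.assoc)
  qed
  finally show ?thesis .
qed

lemma virial_nonpos:
  assumes "t \<in> I"
  shows "dj t \<le> 0"
proof -
  have "0 \<le> \<kappa> * (R - s t)" using s_le_R[OF assms] \<kappa>_pos by simp
  with virial_bound[OF assms] show ?thesis by linarith
qed

lemma j_antimono:
  assumes "0 \<le> t" "t \<le> u" "u \<in> I"
  shows "j u \<le> j t"
proof -
  have sub: "{t..u} \<subseteq> I" using Icc_subset_time_interval[OF assms(3,1)] .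
  have "- j t \<le> - j u"
    by (rule deriv_nonneg_imp_le[OF assms(2) sub, where f' = "\<lambda>r. - dj r"])
      (use sub virial_nonpos in \<open>auto intro!: DERIV_minus deriv_j\<close>)
  then show ?thesis by simp
qed

text \<open>Since \<open>j\<close> decreases, its sign at the final time \<open>u\<close> controls
  its sign on the whole interval.\<close>

lemma s_mono:
  assumes "0 \<le> t" "t \<le> u" "u \<in> I" "0 \<le> j u"
  shows "s t \<le> s u"
proof (rule deriv_nonneg_imp_le[OF assms(2) Icc_subset_time_interval[OF assms(3,1)]])
  fix r assume "r \<in> {t..u}"
  then have "r \<in> I" "0 \<le> r" "r \<le> u" using Icc_subset_time_interval[OF assms(3,1)] assms(1) by auto
  then show "(s has_real_derivative 2 * j r) (at r within I)" "0 \<le> 2 * j r"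
    using deriv_s j_antimono[OF _ _ assms(3), of r] assms(4) by auto
qed

text \<open>A concave function lies below its tangent at \<open>t\<close>.\<close>

lemma s_decrease:
  assumes "0 \<le> t" "t \<le> u" "u \<in> I"
  shows "s u \<le> s t + 2 * j t * (u - t)"
proof -
  have sub: "{t..u} \<subseteq> I" using Icc_subset_time_interval[OF assms(3,1)] .
  have "2 * j t * t - s t \<le> 2 * j t * u - s u"
  proof (rule deriv_nonneg_imp_le[OF assms(2) sub])
    fix r assume "r \<in> {t..u}"
    then have "r \<in> I" "t \<le> r" using sub by auto
    then show "((\<lambda>r. 2 * j t * r - s r) has_real_derivative 2 * j t * 1 - 2 * j r) (at r within I)"
      "0 \<le> 2 * j t * 1 - 2 * j r"
      using j_antimono[OF assms(1)] by (auto intro!: DERIV_diff DERIV_cmult DERIV_ident deriv_s)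
  qed
  then show ?thesis by (simp add: algebra_simps)
qed

section \<open>Collision in finite time or convergence to a ground state\<close>

lemma collision_if_finite:
  assumes max: "maximal_solution \<alpha> T \<Gamma>" and T: "T = ereal \<tau>"
  shows "finite_time_collision T \<Gamma>"
proof -
  have I: "I = {0..<\<tau>}" by (simp add: T)
  have small: "\<exists>t \<in> I. s t < c" if "0 < c" for c
  proof (rule ccontr)
    assume "\<not> ?thesis"
    then have "sqrt c \<le> norm (pos (\<Gamma> t))" if "t \<in> I" for t
      using that by (auto simp: norm_pos not_less)
    then show False
      using bounded_away_from_collision_imp_global[OF _ max, of "sqrt c"] \<open>0 < c\<close> alpha T by auto
  qed
  obtain t\<^sub>1 where t\<^sub>1: "t\<^sub>1 \<in> I" "j t\<^sub>1 < 0"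
  proof (rule ccontr)
    assume "\<not> thesis"
    with that have "0 \<le> j t" if "t \<in> I" for t using \<open>t \<in> I\<close> by (meson not_le)
    \<comment> \<open>If \<open>j\<close> never became negative, \<open>r^2\<close> would never fall
      below its initial value.\<close>
    then have "s 0 \<le> s t" if "t \<in> I" for t using s_mono[of 0 t] that by (simp add: I)
    then show False using small[OF s_pos[OF zero_in_I]] by (meson not_le)
  qed
  \<comment> \<open>\<open>r^2\<close> has a positive minimum on \<open>[0, t\<^sub>1]\<close>, so
    values below it occur only after \<open>t\<^sub>1\<close>, where \<open>j < 0\<close> keeps all
    later values small.\<close>
  have late: "\<exists>u \<in> I. t\<^sub>1 \<le> u \<and> s u < c" if c: "0 < c" for c
  proof -
    have sub: "{0..t\<^sub>1} \<subseteq> I" using t\<^sub>1 by (auto simp: I)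
    obtain m where m: "m \<in> {0..t\<^sub>1}" "\<And>t. t \<in> {0..t\<^sub>1} \<Longrightarrow> s m \<le> s t"
      using continuous_attains_inf[of "{0..t\<^sub>1}" s] continuous_on_subset[OF continuous_on_components(5) sub] t\<^sub>1
      by (auto simp: I)
    have "0 < min c (s m)" using c s_pos[of m] m(1) sub by auto
    from small[OF this] obtain u where "u \<in> I" "s u < c" "s u < s m" by auto
    moreover have "t\<^sub>1 \<le> u"
    proof (rule ccontr)
      assume "\<not> t\<^sub>1 \<le> u"
      then show False using m(2)[of u] \<open>u \<in> I\<close> \<open>s u < s m\<close> by (simp add: I)
    qed
    ultimately show ?thesis by blast
  qed
  have "(s \<longlongrightarrow> 0) (at_left \<tau>)"
  proof (rule order_tendstoI)
    fix c :: real assume "c < 0"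
    then show "eventually (\<lambda>t. c < s t) (at_left \<tau>)"
      using s_nonneg by (intro always_eventually) (meson less_le_trans)
  next
    fix c :: real assume "0 < c"
    from late[OF this] obtain u where u: "u \<in> I" "t\<^sub>1 \<le> u" "s u < c" by auto
    have "s t < c" if "t \<in> {u<..<\<tau>}" for t
    proof -
      have t: "t \<in> I" "0 \<le> u" "u \<le> t" using that u by (auto simp: I)
      have "j u < 0" using j_antimono[of t\<^sub>1 u] u t\<^sub>1 by (auto simp: I)
      then have "2 * j u * (t - u) \<le> 0" using t by (simp add: mult_le_0_iff)
      then show ?thesis using s_decrease[OF t(2,3,1)] u(3) by linarith
    qed
    moreover have "u < \<tau>" using u by (simp add: I)
    ultimately show "eventually (\<lambda>t. s t < c) (at_left \<tau>)"
      using eventually_at_left_real by (metis (mono_tags, lifting) eventually_mono)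
  qed
  then have "((\<lambda>t. norm (pos (\<Gamma> t))) \<longlongrightarrow> 0) (at_left \<tau>)"
    unfolding norm_pos using tendsto_real_sqrt by fastforce
  then have "((\<lambda>t. pos (\<Gamma> t)) \<longlongrightarrow> (0, 0)) (at_left \<tau>)"
    by (simp add: tendsto_norm_zero_iff zero_prod_def)
  then show ?thesis using T by (auto simp: finite_time_collision_def pos_def)
qed

text \<open>Trading \<open>x^2\<close> for \<open>r^2 - y^2\<close> in the energy equation collects
  the non-radial unknowns on the left with positive coefficients, so that control of r alone
  controls \<open>p\<close>, \<open>q\<close> and \<open>y\<close>.\<close>

lemma v2_y_eq:
  assumes "t \<in> I"
  shows "v2 t + (\<alpha> + 2) * (y t)\<^sup>2 = (\<alpha> + 2) * s t + 2 * (\<alpha> + 2) * w t - (\<alpha> + 2)\<^sup>2 * R / \<alpha>"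
  using kinetic_eq[OF assms] by (simp add: s_def algebra_simps)

lemma j_nonneg_if_global:
  assumes T: "T = \<infinity>" and t: "0 \<le> t"
  shows "0 \<le> j t"
proof (rule ccontr)
  assume "\<not> ?thesis"
  then have j: "j t < 0" by simp
  \<comment> \<open>The time at which the tangent at \<open>t\<close> has descended to height -1,
    which \<open>r^2\<close> cannot reach.\<close>
  define u where "u = t + (s t + 1) / (- 2 * j t)"
  have "0 \<le> (s t + 1) / (- 2 * j t)" using j s_nonneg[of t] by (intro divide_nonneg_nonneg) auto
  then have u: "t \<le> u" "0 \<le> u" using t by (auto simp: u_def)
  then have "s u \<le> s t + 2 * j t * (u - t)" using t T by (intro s_decrease) auto
  also have "\<dots> = - 1" using j by (simp add: u_def field_simps)
  finally show False using s_nonneg[of u] by simp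
qed

lemma s_tendsto_R:
  assumes T: "T = \<infinity>"
  shows "(s \<longlongrightarrow> R) at_top"
proof (rule order_tendstoI)
  have I: "I = {0..}" by (simp add: T)
  fix c assume c: "c < R"
  have "\<exists>t\<ge>0. c < s t"
  proof (rule ccontr)
    assume "\<not> ?thesis"
    then have le: "s t \<le> c" if "0 \<le> t" for t using that by auto
    define d where "d = \<kappa> * (R - c)"
    have d: "0 < d" using c \<kappa>_pos by (simp add: d_def)
    \<comment> \<open>By this time a decrease of \<open>j\<close> at rate at least \<open>d\<close>
      has brought it down to -1.\<close>
    define u where "u = (j 0 + 1) / d"
    have u: "0 \<le> u" using d j_nonneg_if_global[OF T, of 0] by (simp add: u_def)
    have "- d * 0 - j 0 \<le> - d * u - j u"
    proof (rule deriv_nonneg_imp_le[OF u, of I])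
      fix t assume "t \<in> {0..u}"
      then have t: "0 \<le> t" "t \<in> I" by (auto simp: I)
      show "((\<lambda>t. - d * t - j t) has_real_derivative
        - d * 1 - (dj t)) (at t within I)"
        by (intro DERIV_diff DERIV_cmult DERIV_ident deriv_j t)
      have "d \<le> \<kappa> * (R - s t)"
        unfolding d_def using \<kappa>_pos le[OF t(1)] by (intro mult_left_mono) auto
      then show "0 \<le> - d * 1 - (dj t)"
        using virial_bound[OF t(2)] by linarith
    qed (auto simp: I)
    then have "j u \<le> j 0 - d * u" by simp
    also have "\<dots> = - 1" using d by (simp add: u_def)
    finally show False using j_nonneg_if_global[OF T u] by simp
  qed
  then obtain t where t: "0 \<le> t" "c < s t" by auto
  have "c < s u" if "t \<le> u" for u
    using s_mono[OF t(1) that] t that j_nonneg_if_global[OF T, of u] by (auto simp: I)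
  then show "eventually (\<lambda>u. c < s u) at_top" unfolding eventually_at_top_linorder by blast
next
  fix c assume "R < c"
  then have "s t < c" if "0 \<le> t" for t using s_le_R[of t] that T by auto
  then show "eventually (\<lambda>t. s t < c) at_top" unfolding eventually_at_top_linorder by blast
qed

lemma approaches_if_global:
  assumes T: "T = \<infinity>"
  shows "approaches T \<Gamma> (ground_state \<alpha>) \<or> approaches T \<Gamma> (- ground_state \<alpha>)"
proof -
  have I: "I = {0..}" by (simp add: T)
  have ev: "eventually (\<lambda>t. t \<in> I) at_top" by (simp add: I eventually_ge_at_top)
  have s: "(s \<longlongrightarrow> R) at_top" by (rule s_tendsto_R[OF T])
  then have "(w \<longlongrightarrow> R powr - (\<alpha> / 2)) at_top"
    unfolding w_def[abs_def] using R_pos by (intro tendsto_intros) auto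
  then have "((\<lambda>t. (\<alpha> + 2) * s t + 2 * (\<alpha> + 2) * w t - (\<alpha> + 2)\<^sup>2 * R / \<alpha>) \<longlongrightarrow>
      (\<alpha> + 2) * R + 2 * (\<alpha> + 2) * (R / \<alpha>) - (\<alpha> + 2)\<^sup>2 * R / \<alpha>) at_top"
    using s alpha_pos by (intro tendsto_intros) (auto simp: R_def ground_radius2_powr)
  moreover have "(\<alpha> + 2) * R + 2 * (\<alpha> + 2) * (R / \<alpha>) - (\<alpha> + 2)\<^sup>2 * R / \<alpha> = 0"
    using alpha_pos by (simp add: field_simps power2_eq_square)
  ultimately have k: "((\<lambda>t. (\<alpha> + 2) * s t + 2 * (\<alpha> + 2) * w t - (\<alpha> + 2)\<^sup>2 * R / \<alpha>) \<longlongrightarrow> 0) at_top"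
    by simp
  have sq: "(f \<longlongrightarrow> 0) at_top" if "\<And>t. t \<in> I \<Longrightarrow> (f t)\<^sup>2 \<le> v2 t + (\<alpha> + 2) * (y t)\<^sup>2" for f
  proof -
    have "((\<lambda>t. (f t)\<^sup>2) \<longlongrightarrow> 0) at_top"
      by (rule tendsto_sandwich[OF _ _ tendsto_const k])
        (use ev that in \<open>auto elim!: eventually_mono simp: v2_y_eq\<close>)
    then show ?thesis by simp
  qed
  have yb: "(y t)\<^sup>2 \<le> (\<alpha> + 2) * (y t)\<^sup>2" for t using mult_right_mono[of 1 "\<alpha> + 2" "(y t)\<^sup>2"] alpha by simp
  have p: "(p \<longlongrightarrow> 0) at_top" and q: "(q \<longlongrightarrow> 0) at_top" and y: "(y \<longlongrightarrow> 0) at_top"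
    using yb alpha by (auto intro!: sq simp: v2_def intro: order_trans[OF yb])
  have "((\<lambda>t. s t - (y t)\<^sup>2) \<longlongrightarrow> R - 0\<^sup>2) at_top" by (intro tendsto_intros s y)
  then have x2: "((\<lambda>t. (x t)\<^sup>2) \<longlongrightarrow> R) at_top" by (simp add: s_def)
  then have x_abs: "((\<lambda>t. \<bar>x t\<bar>) \<longlongrightarrow> sqrt R) at_top"
    using tendsto_real_sqrt[OF x2] by simp
  have "eventually (\<lambda>t. 0 < (x t)\<^sup>2 \<and> t \<in> I) at_top"
    using order_tendstoD(1)[OF x2 R_pos] ev by (rule eventually_conj)
  then obtain t\<^sub>0 where t\<^sub>0: "\<And>t. t\<^sub>0 \<le> t \<Longrightarrow> x t \<noteq> 0 \<and> t \<in> I"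
    unfolding eventually_at_top_linorder by auto
  \<comment> \<open>Once \<open>x\<close> no longer vanishes, connectedness fixes its sign and
    thereby decides between the two ground states.\<close>
  have "connected (x ` {t\<^sub>0..})"
    by (intro connected_continuous_image continuous_on_subset[OF continuous_on_components(1)]) (use t\<^sub>0 in auto)
  then have sign: "(\<forall>t\<ge>t\<^sub>0. x t < 0) \<or> (\<forall>t\<ge>t\<^sub>0. 0 < x t)"
    using t\<^sub>0 connectedD_interval[of "x ` {t\<^sub>0..}" _ _ 0]
    by (metis atLeast_iff image_eqI imageE less_eq_real_def linorder_not_le)
  have "(x \<longlongrightarrow> sqrt R) at_top \<or> (x \<longlongrightarrow> - sqrt R) at_top"
    using sign
  proof
    assume "\<forall>t\<ge>t\<^sub>0. x t < 0"
    then have "eventually (\<lambda>t. - \<bar>x t\<bar> = x t) at_top"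
      unfolding eventually_at_top_linorder by (intro exI[of _ t\<^sub>0]) auto
    then show ?thesis using tendsto_minus[OF x_abs] by (blast intro: Lim_transform_eventually)
  next
    assume "\<forall>t\<ge>t\<^sub>0. 0 < x t"
    then have "eventually (\<lambda>t. \<bar>x t\<bar> = x t) at_top"
      unfolding eventually_at_top_linorder by (intro exI[of _ t\<^sub>0]) auto
    then show ?thesis using x_abs by (blast intro: Lim_transform_eventually)
  qed
  moreover have "(\<Gamma> \<longlongrightarrow> (X, 0, 0, 0)) at_top" if "(x \<longlongrightarrow> X) at_top" for X
    using tendsto_Pair[OF that tendsto_Pair[OF y tendsto_Pair[OF p q]]] by (simp flip: \<Gamma>_eq)
  ultimately show ?thesis
    using T by (auto simp: approaches_def ground_state_eq[OF alpha_pos] R_def)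
qed

end

section \<open>Linearization at the ground states\<close>

text \<open>Taylor's formula on the fixed interval \<open>[R / 2, 3 R / 2]\<close>, which avoids 0,
  so that one constant bounds the second derivative.\<close>

lemma powr_taylor:
  fixes c R :: real
  assumes "0 < R"
  obtains C where "0 \<le> C" and "\<And>s. \<bar>s - R\<bar> \<le> R / 2 \<Longrightarrow>
    \<bar>s powr c - R powr c - c * R powr (c - 1) * (s - R)\<bar> \<le> C * (s - R)\<^sup>2"
proof -
  define S where "S = {R / 2..3 * R / 2}"
  define f where "f i s = (if i = 0 then s powr c else if i = 1 then c * s powr (c - 1)
    else c * (c - 1) * s powr (c - 2))" for i :: nat and s
  have pos: "0 < s" if "s \<in> S" for s using that assms by (simp add: S_def)
  have "continuous_on S (f 2)"
    unfolding f_def using pos by (auto intro!: continuous_intros)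
  then have "compact (f 2 ` S)" by (intro compact_continuous_image) (auto simp: S_def)
  then obtain B where B: "\<And>s. s \<in> S \<Longrightarrow> norm (f 2 s) \<le> B"
    by (meson bounded_iff compact_imp_bounded image_eqI)
  show thesis
  proof (rule that)
    have "R \<in> S" using assms by (simp add: S_def)
    with B[of R] show "0 \<le> B" by (meson norm_ge_zero order_trans)
    fix s assume "\<bar>s - R\<bar> \<le> R / 2"
    then have "R / 2 \<le> s" "s \<le> 3 * R / 2" by linarith+
    then have s: "s \<in> S" by (simp add: S_def)
    have "norm (f 0 s - (\<Sum>i\<le>1. f i R * (s - R) ^ i / fact i)) \<le> B * norm (s - R) ^ Suc 1 / fact 1"
    proof (rule field_Taylor[of S 1 f B R s])
      fix i :: nat and r assume r: "r \<in> S" and i: "i \<le> 1"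
      have "((\<lambda>z. z powr c) has_field_derivative c * r powr (c - 1)) (at r within S)"
        using has_real_derivative_powr[OF pos[OF r], of c] by (rule has_field_derivative_at_within)
      moreover have "((\<lambda>z. c * z powr (c - 1)) has_field_derivative c * ((c - 1) * r powr (c - 1 - 1))) (at r within S)"
        using has_real_derivative_powr[OF pos[OF r], of "c - 1"]
        by (intro DERIV_cmult) (rule has_field_derivative_at_within)
      ultimately show "(f i has_field_derivative f (Suc i) r) (at r within S)"
        using i by (cases i) (simp_all add: f_def[abs_def] mult.assoc)
    qed (use B s \<open>R \<in> S\<close> in \<open>auto simp: S_def numeral_2_eq_2\<close>)
    then show "\<bar>s powr c - R powr c - c * R powr (c - 1) * (s - R)\<bar> \<le> B * (s - R)\<^sup>2"
      by (simp add: f_def power2_eq_square abs_mult[symmetric] algebra_simps)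
  qed
qed

text \<open>The common linearization at both ground states, where the Hessian of V is diagonal with
  entries \<open>- (\<alpha> + 2)^2\<close> and \<open>\<alpha> + 2\<close>.\<close>

definition hill_linear :: "real \<Rightarrow> state \<Rightarrow> state" where
  "hill_linear \<alpha> = (\<lambda>(\<xi>, \<eta>, p, q). (p, q, 2 * q + (\<alpha> + 2)\<^sup>2 * \<xi>, - 2 * p - (\<alpha> + 2) * \<eta>))"

text \<open>The nonlinear part of the force; the Coriolis terms are linear and leave no
  remainder.\<close>

definition remainder_x :: "real \<Rightarrow> real \<Rightarrow> real \<Rightarrow> real \<Rightarrow> real" where
  "remainder_x \<alpha> X \<xi> \<eta> = (\<alpha> + 2) * (X + \<xi>)
     - (\<alpha> + 2) * \<alpha> * (X + \<xi>) * ((X + \<xi>)\<^sup>2 + \<eta>\<^sup>2) powr (- (\<alpha> / 2) - 1) - (\<alpha> + 2)\<^sup>2 * \<xi>"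

definition remainder_y :: "real \<Rightarrow> real \<Rightarrow> real \<Rightarrow> real \<Rightarrow> real" where
  "remainder_y \<alpha> X \<xi> \<eta> = (\<alpha> + 2) * \<eta>
     - (\<alpha> + 2) * \<alpha> * \<eta> * ((X + \<xi>)\<^sup>2 + \<eta>\<^sup>2) powr (- (\<alpha> / 2) - 1)"

lemma hill_field_expansion:
  assumes "(X + \<xi>, \<eta>) \<noteq> (0, 0)"
  shows "hill_field \<alpha> (X + \<xi>, \<eta>, p, q) =
    hill_linear \<alpha> (\<xi>, \<eta>, p, q) + (0, 0, remainder_x \<alpha> X \<xi> \<eta>, remainder_y \<alpha> X \<xi> \<eta>)"
  using hill_field_eq[OF assms] by (simp add: hill_linear_def remainder_x_def remainder_y_def)

lemma remainder_bound:
  assumes \<alpha>: "0 < \<alpha>" and X: "X\<^sup>2 = ground_radius2 \<alpha>"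
  obtains C \<rho> where "0 \<le> C" and "0 < \<rho>" and "\<And>\<xi> \<eta>. \<xi>\<^sup>2 + \<eta>\<^sup>2 \<le> \<rho>\<^sup>2 \<Longrightarrow>
    (X + \<xi>, \<eta>) \<noteq> (0, 0) \<and>
    \<bar>remainder_x \<alpha> X \<xi> \<eta>\<bar> \<le> C * (\<xi>\<^sup>2 + \<eta>\<^sup>2) \<and> \<bar>remainder_y \<alpha> X \<xi> \<eta>\<bar> \<le> C * (\<xi>\<^sup>2 + \<eta>\<^sup>2)"
proof -
  define R b M where "R = ground_radius2 \<alpha>" and "b = \<alpha> + 2" and "M = 2 * \<bar>X\<bar> + 1"
  have R: "0 < R" and b: "0 < b" and M: "0 < M"
    using \<alpha> ground_radius2_pos by (auto simp: R_def b_def M_def)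
  obtain C\<^sub>0 where C\<^sub>0: "0 \<le> C\<^sub>0" "\<And>s. \<bar>s - R\<bar> \<le> R / 2 \<Longrightarrow>
      \<bar>s powr (- (\<alpha> / 2) - 1) - R powr (- (\<alpha> / 2) - 1) - (- (\<alpha> / 2) - 1) * R powr (- (\<alpha> / 2) - 1 - 1) * (s - R)\<bar>
        \<le> C\<^sub>0 * (s - R)\<^sup>2"
    using powr_taylor[OF R] by blast
  define C\<^sub>1 where "C\<^sub>1 = b / (2 * R) + \<alpha> * C\<^sub>0 * M\<^sup>2"
  define C where "C = b\<^sup>2 * \<bar>X\<bar> / R + b * (\<bar>X\<bar> + 1) * C\<^sub>1"
  have C\<^sub>1: "0 \<le> C\<^sub>1" using b R \<alpha> C\<^sub>0 by (simp add: C\<^sub>1_def)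
  show thesis
  \<comment> \<open>The bound 1 gives \<open>N^2 \<le> N\<close>, hence
    \<open>|s - R| \<le> M N\<close>; the bound \<open>R / (2 M)\<close> then puts \<open>s\<close>
    into the range of the Taylor estimate.\<close>
  proof (rule that[of C "min 1 (R / (2 * M))"])
    show "0 \<le> C" using b R C\<^sub>1 by (simp add: C_def)
    show "0 < min 1 (R / (2 * M))" using R M by simp
    fix \<xi> \<eta> :: real assume le: "\<xi>\<^sup>2 + \<eta>\<^sup>2 \<le> (min 1 (R / (2 * M)))\<^sup>2"
    define N where "N = sqrt (\<xi>\<^sup>2 + \<eta>\<^sup>2)"
    have N2: "\<xi>\<^sup>2 + \<eta>\<^sup>2 = N\<^sup>2" and N0: "0 \<le> N" by (simp_all add: N_def)
    have N: "N \<le> 1" "N \<le> R / (2 * M)"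
      using le power2_le_imp_le[of N "min 1 (R / (2 * M))"] R M unfolding N2 by auto
    have \<xi>: "\<bar>\<xi>\<bar> \<le> N" and \<eta>: "\<bar>\<eta>\<bar> \<le> N"
      by (simp_all add: N_def real_le_rsqrt)
    have NN: "N\<^sup>2 \<le> N" using N N0 by (simp add: power2_eq_square mult_left_le)
    define s where "s = (X + \<xi>)\<^sup>2 + \<eta>\<^sup>2"
    have s: "s - R = 2 * X * \<xi> + N\<^sup>2"
      unfolding N2[symmetric] s_def R_def X[symmetric] by (simp add: power2_eq_square algebra_simps)
    have "\<bar>2 * X * \<xi>\<bar> \<le> 2 * \<bar>X\<bar> * N" using \<xi> by (simp add: abs_mult mult_left_mono)
    then have sN: "\<bar>s - R\<bar> \<le> M * N" using NN zero_le_power2[of N]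
      unfolding s M_def distrib_right by linarith
    also have "M * N \<le> R / 2" using N(2) M by (simp add: field_simps)
    finally have sR: "\<bar>s - R\<bar> \<le> R / 2" .
    define \<phi> where "\<phi> = s powr (- (\<alpha> / 2) - 1)"
    have r1: "R powr (- (\<alpha> / 2) - 1) = 1 / \<alpha>" using ground_radius2_powr(2)[OF \<alpha>] by (simp add: R_def)
    then have r2: "R powr (- (\<alpha> / 2) - 1 - 1) = 1 / (\<alpha> * R)" using R by (subst powr_diff) simp
    \<comment> \<open>The error of \<open>1 - \<alpha> \<phi>\<close> beyond its linear term
      \<open>b X \<xi> / R\<close>; it is of second order in \<open>N\<close>.\<close>
    define e where "e = 1 - \<alpha> * \<phi> - b * X / R * \<xi>"
    have e_eq: "e = b / (2 * R) * N\<^sup>2 - \<alpha> * (\<phi> - 1 / \<alpha> - (- (\<alpha> / 2) - 1) * (1 / (\<alpha> * R)) * (s - R))"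
      using \<alpha> R unfolding s by (simp add: e_def b_def field_simps)
    have "\<bar>\<phi> - 1 / \<alpha> - (- (\<alpha> / 2) - 1) * (1 / (\<alpha> * R)) * (s - R)\<bar> \<le> C\<^sub>0 * (s - R)\<^sup>2"
      using C\<^sub>0(2)[OF sR] unfolding r1 r2 \<phi>_def .
    also have "\<dots> \<le> C\<^sub>0 * (M * N)\<^sup>2"
      using sN C\<^sub>0(1) by (intro mult_left_mono) (auto intro: power2_le_iff_abs_le[THEN iffD2] simp: M N0 less_imp_le)
    finally have "\<bar>\<alpha> * (\<phi> - 1 / \<alpha> - (- (\<alpha> / 2) - 1) * (1 / (\<alpha> * R)) * (s - R))\<bar> \<le> \<alpha> * (C\<^sub>0 * (M * N)\<^sup>2)"
      unfolding abs_mult using \<alpha> by (simp add: mult_left_mono)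
    moreover have "0 \<le> b / (2 * R) * N\<^sup>2" using b R by simp
    ultimately have "\<bar>e\<bar> \<le> b / (2 * R) * N\<^sup>2 + \<alpha> * (C\<^sub>0 * (M * N)\<^sup>2)"
      unfolding e_eq by linarith
    then have e: "\<bar>e\<bar> \<le> C\<^sub>1 * N\<^sup>2" by (simp add: C\<^sub>1_def power_mult_distrib algebra_simps)
    have \<phi>_eq: "\<alpha> * \<phi> = 1 - e - b * X / R * \<xi>" by (simp add: e_def)
    have XR: "X * X = R" using X by (simp add: R_def power2_eq_square)
    then have X\<^sub>0: "X \<noteq> 0" using R by auto
    have "remainder_x \<alpha> X \<xi> \<eta> = b * (X + \<xi>) * (1 - \<alpha> * \<phi>) - b\<^sup>2 * \<xi>"
      by (simp add: remainder_x_def \<phi>_def s_def b_def algebra_simps)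
    \<comment> \<open>The identity \<open>X^2 = R\<close> cancels the linear terms.\<close>
    also have "\<dots> = b\<^sup>2 * X / R * \<xi>\<^sup>2 + b * (X + \<xi>) * e"
      unfolding \<phi>_eq using R X\<^sub>0 by (simp add: XR[symmetric] field_simps power2_eq_square)
    finally have rx: "remainder_x \<alpha> X \<xi> \<eta> = b\<^sup>2 * X / R * \<xi>\<^sup>2 + b * (X + \<xi>) * e" .
    have "remainder_y \<alpha> X \<xi> \<eta> = b * \<eta> * (1 - \<alpha> * \<phi>)"
      by (simp add: remainder_y_def \<phi>_def s_def b_def algebra_simps)
    also have "\<dots> = b\<^sup>2 * X / R * (\<xi> * \<eta>) + b * \<eta> * e"
      unfolding \<phi>_eq by (simp add: algebra_simps power2_eq_square)
    finally have ry: "remainder_y \<alpha> X \<xi> \<eta> = b\<^sup>2 * X / R * (\<xi> * \<eta>) + b * \<eta> * e" .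
    have bX: "\<bar>b\<^sup>2 * X / R\<bar> = b\<^sup>2 * \<bar>X\<bar> / R" using b R by (simp add: abs_mult)
    have 1: "\<bar>b\<^sup>2 * X / R * f\<bar> \<le> b\<^sup>2 * \<bar>X\<bar> / R * N\<^sup>2" if "\<bar>f\<bar> \<le> N\<^sup>2" for f
      unfolding abs_mult[of _ f] bX using that b R by (intro mult_left_mono) auto
    have 2: "\<bar>b * f * e\<bar> \<le> b * (\<bar>X\<bar> + 1) * (C\<^sub>1 * N\<^sup>2)" if "\<bar>f\<bar> \<le> \<bar>X\<bar> + 1" for f
      unfolding abs_mult using that b e by (intro mult_mono) auto
    have "\<xi>\<^sup>2 \<le> N\<^sup>2" unfolding N2[symmetric] by simp
    then have "\<bar>remainder_x \<alpha> X \<xi> \<eta>\<bar> \<le> b\<^sup>2 * \<bar>X\<bar> / R * N\<^sup>2 + b * (\<bar>X\<bar> + 1) * (C\<^sub>1 * N\<^sup>2)"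
      unfolding rx using \<xi> N by (intro order_trans[OF abs_triangle_ineq] add_mono 1 2) auto
    moreover have "\<bar>\<xi> * \<eta>\<bar> \<le> N\<^sup>2"
      unfolding abs_mult power2_eq_square using \<xi> \<eta> N0 by (intro mult_mono) auto
    then have "\<bar>remainder_y \<alpha> X \<xi> \<eta>\<bar> \<le> b\<^sup>2 * \<bar>X\<bar> / R * N\<^sup>2 + b * (\<bar>X\<bar> + 1) * (C\<^sub>1 * N\<^sup>2)"
      unfolding ry using \<eta> N by (intro order_trans[OF abs_triangle_ineq] add_mono 1 2) auto
    moreover have "b\<^sup>2 * \<bar>X\<bar> / R * N\<^sup>2 + b * (\<bar>X\<bar> + 1) * (C\<^sub>1 * N\<^sup>2) = C * (\<xi>\<^sup>2 + \<eta>\<^sup>2)"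
      unfolding N2 C_def by (simp add: algebra_simps)
    moreover have "(X + \<xi>, \<eta>) \<noteq> (0, 0)"
    proof
      assume "(X + \<xi>, \<eta>) = (0, 0)"
      then have "s = 0" by (simp add: s_def)
      with sR R show False by simp
    qed
    ultimately show "(X + \<xi>, \<eta>) \<noteq> (0, 0) \<and> \<bar>remainder_x \<alpha> X \<xi> \<eta>\<bar> \<le> C * (\<xi>\<^sup>2 + \<eta>\<^sup>2) \<and>
        \<bar>remainder_y \<alpha> X \<xi> \<eta>\<bar> \<le> C * (\<xi>\<^sup>2 + \<eta>\<^sup>2)"
      by simp
  qed
qed

lemma bounded_linear_hill_linear: "bounded_linear (hill_linear \<alpha>)"
  unfolding linear_conv_bounded_linear[symmetric]
  by (auto intro!: linearI simp: hill_linear_def algebra_simps)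

lemma norm_state: "(norm (\<xi>, \<eta>, p, q))\<^sup>2 = \<xi>\<^sup>2 + \<eta>\<^sup>2 + p\<^sup>2 + q\<^sup>2" for \<xi> \<eta> p q :: real
  by (simp add: norm_Pair)

lemma has_derivative_hill_field:
  assumes \<alpha>: "0 < \<alpha>" and X: "X\<^sup>2 = ground_radius2 \<alpha>"
  shows "(hill_field \<alpha> has_derivative hill_linear \<alpha>) (at (X, 0, 0, 0))"
proof -
  let ?P = "(X, 0, 0, 0) :: state"
  obtain C \<rho> where C: "0 \<le> C" and \<rho>: "0 < \<rho>" and rem: "\<And>\<xi> \<eta>. \<xi>\<^sup>2 + \<eta>\<^sup>2 \<le> \<rho>\<^sup>2 \<Longrightarrow>
    (X + \<xi>, \<eta>) \<noteq> (0, 0) \<and> \<bar>remainder_x \<alpha> X \<xi> \<eta>\<bar> \<le> C * (\<xi>\<^sup>2 + \<eta>\<^sup>2) \<and>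
    \<bar>remainder_y \<alpha> X \<xi> \<eta>\<bar> \<le> C * (\<xi>\<^sup>2 + \<eta>\<^sup>2)"
    using remainder_bound[OF \<alpha> X] by blast
  have f0: "hill_field \<alpha> ?P = 0"
    using ground_state_equilibrium(2)[OF \<alpha> eq_ground_stateI[OF \<alpha> X]] .
  show ?thesis
  proof (rule has_derivativeI_sandwich[OF \<rho> bounded_linear_hill_linear])
    show "((\<lambda>z. 2 * C * norm (z - ?P)) \<longlongrightarrow> 0) (at ?P)"
      by (rule tendsto_eq_intros refl tendsto_norm_zero LIM_zero tendsto_ident_at)+ simp
    fix z :: state assume ne: "z \<noteq> ?P" and d: "dist z ?P < \<rho>"
    obtain \<xi> \<eta> p q where z: "z = (X + \<xi>, \<eta>, p, q)"
      by (cases z) (metis add.commute diff_add_cancel)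
    let ?n = "norm (\<xi>, \<eta>, p, q)"
    have zP: "z - ?P = (\<xi>, \<eta>, p, q)" by (simp add: z)
    have le: "\<xi>\<^sup>2 + \<eta>\<^sup>2 \<le> ?n\<^sup>2" unfolding norm_state by simp
    also have "?n\<^sup>2 \<le> \<rho>\<^sup>2" using d unfolding dist_norm zP by (intro power_mono) auto
    finally have r: "(X + \<xi>, \<eta>) \<noteq> (0, 0)" "\<bar>remainder_x \<alpha> X \<xi> \<eta>\<bar> \<le> C * (\<xi>\<^sup>2 + \<eta>\<^sup>2)"
      "\<bar>remainder_y \<alpha> X \<xi> \<eta>\<bar> \<le> C * (\<xi>\<^sup>2 + \<eta>\<^sup>2)"
      using rem by blast+
    have "hill_field \<alpha> z - hill_field \<alpha> ?P - hill_linear \<alpha> (z - ?P) =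
        (0, 0, remainder_x \<alpha> X \<xi> \<eta>, remainder_y \<alpha> X \<xi> \<eta>)"
      unfolding zP f0 using hill_field_expansion[OF r(1)] by (simp add: z)
    then have "norm (hill_field \<alpha> z - hill_field \<alpha> ?P - hill_linear \<alpha> (z - ?P)) =
        norm (remainder_x \<alpha> X \<xi> \<eta>, remainder_y \<alpha> X \<xi> \<eta>)"
      by (simp add: norm_Pair)
    also have "\<dots> \<le> \<bar>remainder_x \<alpha> X \<xi> \<eta>\<bar> + \<bar>remainder_y \<alpha> X \<xi> \<eta>\<bar>"
      using norm_Pair_le[of "remainder_x \<alpha> X \<xi> \<eta>" "remainder_y \<alpha> X \<xi> \<eta>"] by simp
    also have "\<dots> \<le> 2 * C * (\<xi>\<^sup>2 + \<eta>\<^sup>2)" using r by simp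
    also have "\<dots> \<le> 2 * C * ?n\<^sup>2" using le C by (intro mult_left_mono) auto
    finally show "norm (hill_field \<alpha> z - hill_field \<alpha> ?P - hill_linear \<alpha> (z - ?P)) / norm (z - ?P)
        \<le> 2 * C * norm (z - ?P)"
      using ne unfolding zP[symmetric] by (simp add: divide_le_eq power2_eq_square mult.assoc)
  qed
qed

lemma linearization_ground_state:
  assumes "0 < \<alpha>" and "X\<^sup>2 = ground_radius2 \<alpha>"
  shows "linearization \<alpha> (X, 0, 0, 0) = hill_linear \<alpha>"
  unfolding linearization_def using frechet_derivative_at[OF has_derivative_hill_field[OF assms]] by simp

text \<open>The characteristic polynomial of the linearization at a ground state is
  \<open>(\<lambda>\<^sup>2 + \<beta>) (\<lambda>\<^sup>2 - \<beta>\<^sup>2) + 4 \<lambda>\<^sup>2\<close> with \<open>\<beta> = \<alpha> + 2\<close>.\<close>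

definition is_saddle_rate :: "real \<Rightarrow> real \<Rightarrow> bool" where
  "is_saddle_rate \<beta> k \<longleftrightarrow> 0 < k \<and> (\<beta> + k\<^sup>2) * (\<beta>\<^sup>2 - k\<^sup>2) = 4 * k\<^sup>2"

lemma is_saddle_rate_ex1:
  assumes "0 < \<beta>"
  shows "\<exists>!k. is_saddle_rate \<beta> k"
proof (rule ex_ex1I)
  \<comment> \<open>In \<open>z = k^2\<close> the equation is
    \<open>z^2 - B z - \<beta>^3 = 0\<close> with discriminant \<open>S^2\<close>; the product of
    its roots is negative, so exactly one root is positive.\<close>
  define B where "B = \<beta>\<^sup>2 - \<beta> - 4"
  define S where "S = sqrt (B\<^sup>2 + 4 * \<beta> ^ 3)"
  have "B\<^sup>2 < B\<^sup>2 + 4 * \<beta> ^ 3" using assms by simp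
  then have "\<bar>B\<bar> < S" unfolding S_def by (metis real_sqrt_abs real_sqrt_less_iff)
  then have pos: "0 < (B + S) / 2" by simp
  have S2: "S\<^sup>2 = B\<^sup>2 + 4 * \<beta> ^ 3" unfolding S_def using assms by (intro real_sqrt_pow2) simp
  have "is_saddle_rate \<beta> (sqrt ((B + S) / 2))"
    unfolding is_saddle_rate_def
  proof
    show "0 < sqrt ((B + S) / 2)" using pos by simp
    have "(sqrt ((B + S) / 2))\<^sup>2 = (B + S) / 2" using pos by (intro real_sqrt_pow2) simp
    moreover have "(\<beta> + (B + S) / 2) * (\<beta>\<^sup>2 - (B + S) / 2) = 4 * ((B + S) / 2)"
      using S2 B_def by algebra
    ultimately show "(\<beta> + (sqrt ((B + S) / 2))\<^sup>2) * (\<beta>\<^sup>2 - (sqrt ((B + S) / 2))\<^sup>2) = 4 * (sqrt ((B + S) / 2))\<^sup>2"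
      by metis
  qed
  then show "\<exists>k. is_saddle_rate \<beta> k" ..
next
  fix k l assume k: "is_saddle_rate \<beta> k" and l: "is_saddle_rate \<beta> l"
  have pos: "0 < k" "0 < l" using k l by (auto simp: is_saddle_rate_def)
  \<comment> \<open>Elimination of the middle coefficient \<open>\<beta>^2 - \<beta> - 4\<close>
    from the two quadratic equations.\<close>
  have "(k\<^sup>2 - l\<^sup>2) * (\<beta> ^ 3 + k\<^sup>2 * l\<^sup>2) = 0"
    using k l unfolding is_saddle_rate_def by algebra
  moreover have "0 < \<beta> ^ 3 + k\<^sup>2 * l\<^sup>2" using assms by (simp add: add_pos_nonneg)
  ultimately have "k\<^sup>2 = l\<^sup>2" by simp
  with pos show "k = l" by (simp add: power2_eq_iff_nonneg)
qed

text \<open>For an eigenvector to \<open>- k\<close> the velocity is \<open>- k\<close> times the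
  position. With \<open>h = 2 k / (\<beta> + k^2)\<close> as the slope of the position, the two
  remaining rows of the eigenvalue equation are these relations, in polynomial form for
  elimination.\<close>

lemma saddle_rate_relations:
  assumes "0 < \<beta>" "is_saddle_rate \<beta> k"
  shows "2 * k / (\<beta> + k\<^sup>2) * (\<beta> + k\<^sup>2) = 2 * k"
    and "2 * k * (2 * k / (\<beta> + k\<^sup>2)) = \<beta>\<^sup>2 - k\<^sup>2"
proof -
  have "\<beta> + k\<^sup>2 \<noteq> 0" using assms(1) by (smt (verit) zero_le_power2)
  then show "2 * k / (\<beta> + k\<^sup>2) * (\<beta> + k\<^sup>2) = 2 * k" by simp
  have "4 * k\<^sup>2 / (\<beta> + k\<^sup>2) = \<beta>\<^sup>2 - k\<^sup>2"
    using assms(2) \<open>\<beta> + k\<^sup>2 \<noteq> 0\<close> by (simp add: is_saddle_rate_def field_simps)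
  then show "2 * k * (2 * k / (\<beta> + k\<^sup>2)) = \<beta>\<^sup>2 - k\<^sup>2" by (simp add: power2_eq_square)
qed

lemma hill_linear_stable_vector:
  assumes "0 < \<alpha>" "is_saddle_rate (\<alpha> + 2) k" and h: "h = 2 * k / (\<alpha> + 2 + k\<^sup>2)"
  shows "hill_linear \<alpha> (\<xi>, h * \<xi>, - (k * \<xi>), - (k * h * \<xi>)) = (- k) *\<^sub>R (\<xi>, h * \<xi>, - (k * \<xi>), - (k * h * \<xi>))"
proof -
  define \<beta> where "\<beta> = \<alpha> + 2"
  have r: "h * (\<beta> + k\<^sup>2) = 2 * k" "2 * k * h = \<beta>\<^sup>2 - k\<^sup>2"
    using saddle_rate_relations[of "\<alpha> + 2" k] assms by (simp_all add: h \<beta>_def)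
  have "2 * - (k * h * \<xi>) + \<beta>\<^sup>2 * \<xi> = - k * - (k * \<xi>)" "- 2 * - (k * \<xi>) - \<beta> * (h * \<xi>) = - k * - (k * h * \<xi>)"
    using r by algebra+
  then show ?thesis by (simp add: hill_linear_def \<beta>_def)
qed

lemma hill_linear_eigenvalue_iff:
  assumes "0 < \<alpha>" "0 < k"
  shows "(\<exists>v. v \<noteq> 0 \<and> hill_linear \<alpha> v = (- k) *\<^sub>R v) \<longleftrightarrow> is_saddle_rate (\<alpha> + 2) k"
proof
  define \<beta> where "\<beta> = \<alpha> + 2"
  have \<beta>: "0 < \<beta>" using assms by (simp add: \<beta>_def)
  {
    assume "\<exists>v. v \<noteq> 0 \<and> hill_linear \<alpha> v = (- k) *\<^sub>R v"
    then obtain \<xi> \<eta> p q where v: "(\<xi>, \<eta>, p, q) \<noteq> 0" and "hill_linear \<alpha> (\<xi>, \<eta>, p, q) = (- k) *\<^sub>R (\<xi>, \<eta>, p, q)"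
      by auto
    then have e: "p = - k * \<xi>" "q = - k * \<eta>" "2 * q + \<beta>\<^sup>2 * \<xi> = - k * p" "- 2 * p - \<beta> * \<eta> = - k * q"
      by (auto simp: hill_linear_def \<beta>_def)
    have "\<xi> \<noteq> 0"
    proof
      assume "\<xi> = 0"
      with e assms have "\<eta> = 0" by auto
      with \<open>\<xi> = 0\<close> e v show False by (simp add: zero_prod_def)
    qed
    moreover have "((\<beta> + k\<^sup>2) * (\<beta>\<^sup>2 - k\<^sup>2) - 4 * k\<^sup>2) * \<xi> = 0" using e by algebra
    ultimately show "is_saddle_rate (\<alpha> + 2) k"
      using assms by (simp add: is_saddle_rate_def \<beta>_def)
  }
  assume k: "is_saddle_rate (\<alpha> + 2) k"
  define h where "h = 2 * k / (\<beta> + k\<^sup>2)"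
  have "hill_linear \<alpha> (1, h, - k, - (k * h)) = (- k) *\<^sub>R (1, h, - k, - (k * h))"
    using hill_linear_stable_vector[OF assms(1) k, of h 1] by (simp add: h_def \<beta>_def)
  moreover have "(1, h, - k, - (k * h)) \<noteq> (0 :: state)" by (simp add: zero_prod_def)
  ultimately show "\<exists>v. v \<noteq> 0 \<and> hill_linear \<alpha> v = (- k) *\<^sub>R v" by blast
qed

text \<open>The eigenvalue condition behind \<open>stable_rate\<close> is equivalent to
  \<open>is_saddle_rate\<close>, which has a unique solution, so the definite description denotes
  \<open>k\<close>.\<close>

lemma stable_rate_eqI:
  assumes "0 < \<alpha>" "X\<^sup>2 = ground_radius2 \<alpha>" "is_saddle_rate (\<alpha> + 2) k"
  shows "stable_rate \<alpha> (X, 0, 0, 0) = k"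
  unfolding stable_rate_def linearization_ground_state[OF assms(1,2)]
proof (rule the_equality)
  have "0 < k" using assms(3) by (simp add: is_saddle_rate_def)
  then show "0 < k \<and> (\<exists>v. v \<noteq> 0 \<and> hill_linear \<alpha> v = (- k) *\<^sub>R v)"
    using hill_linear_eigenvalue_iff[OF assms(1)] assms(3) by blast
  fix l assume "0 < l \<and> (\<exists>v. v \<noteq> 0 \<and> hill_linear \<alpha> v = (- l) *\<^sub>R v)"
  then have "is_saddle_rate (\<alpha> + 2) l" using hill_linear_eigenvalue_iff[OF assms(1)] by blast
  then show "l = k" using is_saddle_rate_ex1[of "\<alpha> + 2"] assms by auto
qed

section \<open>Exponential convergence\<close>

text \<open>Membership in the stable manifold is tested at time 0; the equation is autonomous, so
  any point of an orbit can be moved there.\<close>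

lemma shift_solution:
  assumes "solution \<alpha> \<infinity> \<Gamma>" "0 \<le> t"
  shows "solution \<alpha> \<infinity> (\<lambda>r. \<Gamma> (r + t))"
  unfolding solution_def
proof (intro conjI ballI)
  fix r assume r: "r \<in> time_interval \<infinity>"
  then have rt: "r + t \<in> {0..}" using assms by simp
  then show "\<Gamma> (r + t) \<in> phase_space" using assms(1) by (simp add: solution_def)
  have "(\<Gamma> has_vector_derivative hill_field \<alpha> (\<Gamma> (r + t))) (at (r + t) within {0..})"
    using assms(1) rt by (simp add: solution_def)
  then have "(\<Gamma> has_vector_derivative hill_field \<alpha> (\<Gamma> (r + t))) (at (r + t) within (\<lambda>r. r + t) ` {0..})"
    by (rule has_vector_derivative_within_subset) (use assms in auto)
  moreover have "((\<lambda>r. r + t) has_real_derivative 1) (at r within {0..})"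
    by (auto intro!: derivative_eq_intros)
  ultimately have "((\<Gamma> \<circ> (\<lambda>r. r + t)) has_vector_derivative 1 *\<^sub>R hill_field \<alpha> (\<Gamma> (r + t))) (at r within {0..})"
    by (intro vector_diff_chain_within) (auto simp: has_real_derivative_iff_has_vector_derivative)
  then show "((\<lambda>r. \<Gamma> (r + t)) has_vector_derivative hill_field \<alpha> (\<Gamma> (r + t))) (at r within time_interval \<infinity>)"
    by (simp add: o_def)
qed simp

section \<open>Orbits in \<open>W_minus\<close> converging to a ground state
  \<open>(X, 0, 0, 0)\<close>\<close>

locale approaching_orbit = W_minus_orbit +
  fixes X :: real
  assumes T: "T = \<infinity>" and X2: "X\<^sup>2 = ground_radius2 \<alpha>" and tendsto_ground: "(\<Gamma> \<longlongrightarrow> (X, 0, 0, 0)) at_top"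
begin

definition "\<beta> = \<alpha> + 2"
definition "\<xi> t = x t - X"
definition "\<delta> t = R - s t"
text \<open>The rate belonging to \<open>\<delta>'' \<ge> 2 \<kappa> \<delta>\<close>. It serves as
  the positive rate required by \<open>stable_manifold\<close> and differs in general from the rate
  of the linearization.\<close>

definition "c = sqrt (2 * \<kappa>)"
definition "n2 t = (\<xi> t)\<^sup>2 + (y t)\<^sup>2 + (p t)\<^sup>2 + (q t)\<^sup>2"

lemma I_eq: "I = {0..}"
  by (simp add: T)

lemma X2_R: "X\<^sup>2 = R"
  using X2 by (simp add: R_def)

lemma X_neq_0: "X \<noteq> 0"
  using X2_R R_pos by auto

lemma \<beta>_ge: "4 \<le> \<beta>"
  using alpha by (simp add: \<beta>_def)

lemma c_pos: "0 < c" and c2: "c * c = 2 * \<kappa>"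
  using \<kappa>_pos by (simp_all add: c_def)

lemma \<Gamma>_diff: "\<Gamma> t - (X, 0, 0, 0) = (\<xi> t, y t, p t, q t)"
  by (simp add: \<Gamma>_eq \<xi>_def)

lemma n2_eq: "n2 t = (norm (\<Gamma> t - (X, 0, 0, 0)))\<^sup>2"
  unfolding \<Gamma>_diff norm_state n2_def ..

lemma \<delta>_nonneg: "0 \<le> t \<Longrightarrow> 0 \<le> \<delta> t"
  using s_le_R[of t] by (simp add: \<delta>_def I_eq)

lemma tendsto_components:
  "(\<xi> \<longlongrightarrow> 0) at_top" "(x \<longlongrightarrow> X) at_top" "(y \<longlongrightarrow> 0) at_top" "(p \<longlongrightarrow> 0) at_top" "(q \<longlongrightarrow> 0) at_top"
proof -
  show x: "(x \<longlongrightarrow> X) at_top"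
    using tendsto_fst[OF tendsto_ground] by (simp add: x_def[abs_def])
  show "(y \<longlongrightarrow> 0) at_top"
    using tendsto_fst[OF tendsto_snd[OF tendsto_ground]] by (simp add: y_def[abs_def])
  show "(p \<longlongrightarrow> 0) at_top"
    using tendsto_fst[OF tendsto_snd[OF tendsto_snd[OF tendsto_ground]]] by (simp add: p_def[abs_def])
  show "(q \<longlongrightarrow> 0) at_top"
    using tendsto_snd[OF tendsto_snd[OF tendsto_snd[OF tendsto_ground]]] by (simp add: q_def[abs_def])
  show "(\<xi> \<longlongrightarrow> 0) at_top"
    unfolding \<xi>_def[abs_def] using LIM_zero[OF x] .
qed

lemma tendsto_\<delta>: "(\<delta> \<longlongrightarrow> 0) at_top"
proof -
  have "((\<lambda>t. R - ((x t)\<^sup>2 + (y t)\<^sup>2)) \<longlongrightarrow> R - (X\<^sup>2 + 0\<^sup>2)) at_top"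
    by (intro tendsto_intros tendsto_components)
  then show ?thesis by (simp add: \<delta>_def[abs_def] s_def X2_R)
qed

lemma tendsto_n2: "(n2 \<longlongrightarrow> 0) at_top"
proof -
  have "(n2 \<longlongrightarrow> 0\<^sup>2 + 0\<^sup>2 + 0\<^sup>2 + 0\<^sup>2) at_top"
    unfolding n2_def[abs_def] by (intro tendsto_intros tendsto_components)
  then show ?thesis by simp
qed

lemma tendsto_j: "(j \<longlongrightarrow> 0) at_top"
proof -
  have "(j \<longlongrightarrow> X * 0 + 0 * 0) at_top"
    unfolding j_def[abs_def] by (intro tendsto_intros tendsto_components)
  then show ?thesis by simp
qed

lemma deriv_\<delta>:
  assumes "0 \<le> t"
  shows "(\<delta> has_real_derivative - (2 * j t)) (at t within I)"
  unfolding \<delta>_def[abs_def]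
  using DERIV_diff[OF DERIV_const deriv_s] assms by (simp add: I_eq)

text \<open>Since \<open>\<delta>'' \<ge> c\<^sup>2 \<delta>\<close>, the quantity \<open>c \<delta> + \<delta>'\<close> would grow exponentially if it were ever positive.\<close>

lemma \<delta>_decay_rate:
  assumes t: "0 \<le> t"
  shows "c * \<delta> t \<le> 2 * j t"
proof (rule ccontr)
  assume neg: "\<not> ?thesis"
  define m where "m r = c * \<delta> r - 2 * j r" for r
  have pos: "0 < m t" using neg by (simp add: m_def)
  have mono: "m t \<le> m u" if u: "t \<le> u" for u
  proof -
    have "m t * exp (c * (u - t)) \<le> m u"
    proof (rule gronwall_ge[OF u, of I])
      fix r assume "r \<in> {t..u}"
      then have r: "0 \<le> r" "r \<in> I" using t by (auto simp: I_eq)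
      show "(m has_real_derivative c * - (2 * j r) - 2 * dj r) (at r within I)"
        unfolding m_def[abs_def] by (intro DERIV_diff DERIV_cmult deriv_\<delta> deriv_j r)
      have "c * m r = 2 * (\<kappa> * \<delta> r) - c * (2 * j r)"
        unfolding m_def right_diff_distrib mult.assoc[symmetric] c2 by simp
      then show "c * m r \<le> c * - (2 * j r) - 2 * dj r"
        using virial_bound[OF r(2)] by (simp add: \<delta>_def)
    qed (use t in \<open>auto simp: I_eq\<close>)
    moreover have "1 \<le> exp (c * (u - t))" using c_pos u by simp
    then have "m t * 1 \<le> m t * exp (c * (u - t))" using pos by (intro mult_left_mono) auto
    ultimately show ?thesis by simp
  qed
  have "((\<lambda>r. c * \<delta> r - 2 * j r) \<longlongrightarrow> c * 0 - 2 * 0) at_top"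
    by (intro tendsto_intros tendsto_\<delta> tendsto_j)
  then have "(m \<longlongrightarrow> 0) at_top" by (simp add: m_def[abs_def])
  from order_tendstoD(2)[OF this pos] obtain u where "t \<le> u" "m u < m t"
    unfolding eventually_at_top_linorder by (meson linear order_refl)
  with mono[of u] show False by simp
qed

lemma \<delta>_exp_decay:
  assumes "0 \<le> t" "t \<le> u"
  shows "\<delta> u \<le> \<delta> t * exp (- c * (u - t))"
  by (rule gronwall_le[OF assms(2), of I _ "\<lambda>t. - (2 * j t)"])
    (use assms deriv_\<delta> \<delta>_decay_rate in \<open>auto simp: I_eq\<close>)

text \<open>By conservation of energy \<open>v2 + \<beta> y\<^sup>2\<close> is a function of \<open>\<delta>\<close> alone that vanishes to second
  order at \<open>0\<close>.\<close>

lemma n2_le: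
  obtains D where "0 \<le> D" and "eventually (\<lambda>t. n2 t \<le> D * (\<delta> t)\<^sup>2) at_top"
proof -
  obtain C where C: "0 \<le> C" and taylor: "\<And>s. \<bar>s - R\<bar> \<le> R / 2 \<Longrightarrow>
      \<bar>s powr - (\<alpha> / 2) - R powr - (\<alpha> / 2) - - (\<alpha> / 2) * R powr (- (\<alpha> / 2) - 1) * (s - R)\<bar> \<le> C * (s - R)\<^sup>2"
    using powr_taylor[OF R_pos] by blast
  define A where "A = (1 + C * R) / \<bar>X\<bar>"
  define D where "D = A\<^sup>2 + 2 * C + 2 * \<beta> * C"
  have "eventually (\<lambda>t. n2 t \<le> D * (\<delta> t)\<^sup>2) at_top"
  proof -
    have "eventually (\<lambda>t. \<bar>\<xi> t\<bar> < \<bar>X\<bar>) at_top"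
      using order_tendstoD(2)[OF tendsto_rabs_zero[OF tendsto_components(1)]] X_neq_0 by simp
    moreover have "eventually (\<lambda>t. \<delta> t < R / 2) at_top"
      using order_tendstoD(2)[OF tendsto_\<delta>, of "R / 2"] R_pos by simp
    ultimately show ?thesis
      using eventually_ge_at_top[of 0]
    proof eventually_elim
      case (elim t)
      then have t: "t \<in> I" and \<delta>: "0 \<le> \<delta> t" using \<delta>_nonneg by (auto simp: I_eq)
      have sR: "s t - R = - \<delta> t" by (simp add: \<delta>_def)
      have "\<bar>w t - R / \<alpha> - \<delta> t / 2\<bar> \<le> C * (\<delta> t)\<^sup>2"
        using taylor[of "s t"] elim \<delta> alpha_pos unfolding sR
        by (simp add: w_def R_def ground_radius2_powr)
      then have w: "w t \<le> R / \<alpha> + \<delta> t / 2 + C * (\<delta> t)\<^sup>2" by linarith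
      have "v2 t + \<beta> * (y t)\<^sup>2 = \<beta> * (R - \<delta> t) + 2 * (\<beta> * w t) - \<beta>\<^sup>2 * R / \<alpha>"
        using v2_y_eq[OF t] by (simp add: \<beta>_def \<delta>_def)
      also have "\<dots> \<le> \<beta> * (R - \<delta> t) + 2 * (\<beta> * (R / \<alpha> + \<delta> t / 2 + C * (\<delta> t)\<^sup>2)) - \<beta>\<^sup>2 * R / \<alpha>"
        using w \<beta>_ge by simp
      \<comment> \<open>The constant terms cancel because \<open>\<beta> = \<alpha> + 2\<close>, and
        the linear ones because \<open>s powr (- (\<alpha> / 2))\<close> has derivative -1/2 at
        \<open>R\<close>.\<close>
      also have "\<dots> = 2 * \<beta> * C * (\<delta> t)\<^sup>2"
        using alpha_pos by (simp add: \<beta>_def field_simps power2_eq_square)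
      finally have k: "v2 t + \<beta> * (y t)\<^sup>2 \<le> 2 * \<beta> * C * (\<delta> t)\<^sup>2" .
      moreover have "0 \<le> v2 t" "0 \<le> \<beta> * (y t)\<^sup>2" using \<beta>_ge by (auto simp: v2_def)
      ultimately have v: "v2 t \<le> 2 * \<beta> * C * (\<delta> t)\<^sup>2" and "\<beta> * (y t)\<^sup>2 \<le> 2 * \<beta> * C * (\<delta> t)\<^sup>2"
        by linarith+
      then have "\<beta> * (y t)\<^sup>2 \<le> \<beta> * (2 * C * (\<delta> t)\<^sup>2)" by (simp add: mult_ac)
      then have y: "(y t)\<^sup>2 \<le> 2 * C * (\<delta> t)\<^sup>2" using \<beta>_ge by (subst (asm) mult_le_cancel_left_pos) auto
      have "\<delta> t * (C * (2 * \<delta> t)) \<le> \<delta> t * (C * R)"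
        using elim \<delta> C by (intro mult_left_mono) auto
      then have y': "(y t)\<^sup>2 \<le> \<delta> t * (C * R)" using y by (simp add: power2_eq_square algebra_simps)
      \<comment> \<open>This is \<open>x^2 - X^2\<close> rewritten; near the ground state
        \<open>x + X\<close> stays away from 0, so \<xi> is controlled by \<delta>.\<close>
      have "\<xi> t * (x t + X) = - \<delta> t - (y t)\<^sup>2"
        unfolding \<delta>_def s_def X2_R[symmetric] by (simp add: \<xi>_def power2_eq_square algebra_simps)
      moreover have "\<bar>- \<delta> t - (y t)\<^sup>2\<bar> = \<delta> t + (y t)\<^sup>2" using \<delta> zero_le_power2[of "y t"] by linarith
      ultimately have "\<bar>\<xi> t\<bar> * \<bar>x t + X\<bar> = \<delta> t + (y t)\<^sup>2" by (simp add: abs_mult[symmetric])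
      also have "\<dots> \<le> \<delta> t * (1 + C * R)" using y' by (simp add: algebra_simps)
      finally have "\<bar>\<xi> t\<bar> * \<bar>x t + X\<bar> \<le> \<delta> t * (1 + C * R)" .
      moreover have "\<bar>X\<bar> \<le> \<bar>x t + X\<bar>" using elim by (simp add: \<xi>_def)
      then have "\<bar>\<xi> t\<bar> * \<bar>X\<bar> \<le> \<bar>\<xi> t\<bar> * \<bar>x t + X\<bar>" by (intro mult_left_mono) auto
      ultimately have "\<bar>\<xi> t\<bar> \<le> A * \<delta> t" using X_neq_0 by (simp add: A_def field_simps)
      then have "(\<xi> t)\<^sup>2 \<le> (A * \<delta> t)\<^sup>2" by (metis abs_ge_zero power2_abs power_mono)
      with v y show "n2 t \<le> D * (\<delta> t)\<^sup>2"
        by (simp add: n2_def v2_def D_def power_mult_distrib algebra_simps)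
    qed
  qed
  moreover have "0 \<le> D" using C \<beta>_ge by (simp add: D_def)
  ultimately show thesis by (rule that[rotated])
qed

text \<open>The converse of the comparison by \<open>n2\<close>: tangency is measured against the
  norm, whereas the deviation will be estimated by \<delta>.\<close>

lemma \<delta>_le_norm: "eventually (\<lambda>t. \<delta> t \<le> (2 * \<bar>X\<bar> + 1) * norm (\<Gamma> t - (X, 0, 0, 0))) at_top"
proof -
  have "eventually (\<lambda>t. n2 t < 1) at_top" using order_tendstoD(2)[OF tendsto_n2] by simp
  then show ?thesis
  proof eventually_elim
    case (elim t)
    define N where "N = norm (\<Gamma> t - (X, 0, 0, 0))"
    have N: "N\<^sup>2 = n2 t" "0 \<le> N" by (simp_all add: N_def n2_eq)
    have "N \<le> 1" using elim N power2_le_imp_le[of N 1] by simp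
    have "\<bar>\<xi> t\<bar> \<le> N" using N by (intro power2_le_imp_le[of "\<bar>\<xi> t\<bar>" N]) (auto simp: n2_def)
    then have "2 * \<bar>X\<bar> * \<bar>\<xi> t\<bar> \<le> 2 * \<bar>X\<bar> * N" by (intro mult_left_mono) auto
    moreover have "\<delta> t = - (2 * X * \<xi> t) - (\<xi> t)\<^sup>2 - (y t)\<^sup>2"
      unfolding \<delta>_def s_def X2_R[symmetric] by (simp add: \<xi>_def power2_eq_square algebra_simps)
    moreover have "\<bar>2 * X * \<xi> t\<bar> = 2 * \<bar>X\<bar> * \<bar>\<xi> t\<bar>" by (simp add: abs_mult)
    moreover have "- (\<xi> t)\<^sup>2 - (y t)\<^sup>2 \<le> 0" by simp
    ultimately have "\<delta> t \<le> 2 * \<bar>X\<bar> * N" by linarith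
    also have "\<dots> \<le> (2 * \<bar>X\<bar> + 1) * N" using N by (intro mult_right_mono) auto
    finally show ?case by (simp add: N_def)
  qed
qed

lemma exponential_convergence:
  obtains C where "\<And>t. 0 \<le> t \<Longrightarrow> norm (\<Gamma> t - (X, 0, 0, 0)) \<le> C * exp (- c * t)"
proof -
  obtain D where D: "0 \<le> D" and "eventually (\<lambda>t. n2 t \<le> D * (\<delta> t)\<^sup>2) at_top"
    by (rule n2_le)
  then obtain t\<^sub>1 where t\<^sub>1: "0 \<le> t\<^sub>1" "\<And>t. t\<^sub>1 \<le> t \<Longrightarrow> n2 t \<le> D * (\<delta> t)\<^sup>2"
    unfolding eventually_at_top_linorder by (metis linear order_trans)
  have "continuous_on {0..t\<^sub>1} \<Gamma>"
    using solution_continuous_on[OF sol] by (rule continuous_on_subset) (simp add: I_eq subset_iff)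
  \<comment> \<open>The comparison with \<delta> holds only from \<open>t\<^sub>1\<close> on. Before
    that, compactness gives a bound \<open>M\<close>, and the factor
    \<open>exp (c * t\<^sub>1)\<close> compensates for the decaying exponential.\<close>
  then have "compact ((\<lambda>t. norm (\<Gamma> t - (X, 0, 0, 0))) ` {0..t\<^sub>1})"
    by (intro compact_continuous_image continuous_intros) auto
  then obtain M where M: "\<And>t. t \<in> {0..t\<^sub>1} \<Longrightarrow> norm (\<Gamma> t - (X, 0, 0, 0)) \<le> M"
    using compact_imp_bounded[of "(\<lambda>t. norm (\<Gamma> t - (X, 0, 0, 0))) ` {0..t\<^sub>1}"]
    unfolding bounded_iff by fastforce
  have M0: "0 \<le> M" using M[of 0] t\<^sub>1 by (auto intro: order_trans[OF norm_ge_zero])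
  show thesis
  proof (rule that)
    fix t :: real assume t: "0 \<le> t"
    define E where "E = exp (- c * t)"
    have E: "0 < E" by (simp add: E_def)
    have A: "0 \<le> M * exp (c * t\<^sub>1) * E" "0 \<le> sqrt D * \<delta> 0 * E"
      using M0 E D \<delta>_nonneg[of 0] by auto
    have "norm (\<Gamma> t - (X, 0, 0, 0)) \<le> M * exp (c * t\<^sub>1) * E \<or> norm (\<Gamma> t - (X, 0, 0, 0)) \<le> sqrt D * \<delta> 0 * E"
    proof (cases "t \<le> t\<^sub>1")
      case True
      then have "1 \<le> exp (c * t\<^sub>1) * E" using c_pos by (simp add: E_def exp_add[symmetric])
      then have "M * 1 \<le> M * (exp (c * t\<^sub>1) * E)" using M0 by (intro mult_left_mono)
      then show ?thesis using M[of t] True t by (simp add: mult.assoc)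
    next
      case False
      have "norm (\<Gamma> t - (X, 0, 0, 0)) = sqrt (n2 t)" by (simp add: n2_eq)
      also have "\<dots> \<le> sqrt (D * (\<delta> t)\<^sup>2)" using t\<^sub>1(2)[of t] False by simp
      also have "\<dots> = sqrt D * \<delta> t" using \<delta>_nonneg[OF t] by (simp add: real_sqrt_mult)
      also have "\<dots> \<le> sqrt D * (\<delta> 0 * E)"
        using \<delta>_exp_decay[of 0 t] t D by (intro mult_left_mono) (auto simp: E_def)
      finally show ?thesis by (simp add: mult.assoc)
    qed
    then show "norm (\<Gamma> t - (X, 0, 0, 0)) \<le> (M * exp (c * t\<^sub>1) + sqrt D * \<delta> 0) * exp (- c * t)"
      using A unfolding E_def[symmetric] distrib_right by linarith
  qed
qed

end

section \<open>Tangency to the stable eigenspace\<close>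

text \<open>Completes the square \<open>(c a + n)^2 / c\<close>. With \<open>n\<close> a forcing
  term acting on a component \<open>a\<close>, the loss is at rate \<open>c\<close> only, plus a
  term quadratic in the forcing.\<close>

lemma young:
  fixes a n c :: real
  assumes "0 < c"
  shows "- (c * a\<^sup>2) - n\<^sup>2 / c \<le> 2 * a * n"
proof -
  have "0 \<le> (c * a + n)\<^sup>2 / c" using assms by simp
  also have "\<dots> = c * a\<^sup>2 + 2 * a * n + n\<^sup>2 / c"
    using assms by (simp add: power2_eq_square field_simps)
  finally show ?thesis by simp
qed

lemma sum3_power2_le: "(a + b + d)\<^sup>2 \<le> 3 * (a\<^sup>2 + b\<^sup>2 + d\<^sup>2)" for a b d :: real
proof -
  have "3 * (a\<^sup>2 + b\<^sup>2 + d\<^sup>2) - (a + b + d)\<^sup>2 = (a - b)\<^sup>2 + (b - d)\<^sup>2 + (a - d)\<^sup>2"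
    by (simp add: power2_eq_square algebra_simps)
  moreover have "0 \<le> (a - b)\<^sup>2 + (b - d)\<^sup>2 + (a - d)\<^sup>2" by simp
  ultimately show ?thesis by linarith
qed

lemma sum2_power2_le: "(a + b)\<^sup>2 \<le> 2 * (a\<^sup>2 + b\<^sup>2)" for a b :: real
  using sum_squares_bound[of a b] by (simp add: power2_sum)

context approaching_orbit
begin

definition "k = (THE k. is_saddle_rate \<beta> k)"
definition "h = 2 * k / (\<beta> + k\<^sup>2)"
text \<open>The square of the central frequency: as a quadratic in the square of the eigenvalue, the
  characteristic polynomial has roots \<open>k^2\<close> and \<open>- \<omega>2\<close> with product
  \<open>- \<beta>^3\<close>.\<close>

definition "\<omega>2 = \<beta> ^ 3 / k\<^sup>2"
definition "F\<^sub>1 t = remainder_x \<alpha> X (\<xi> t) (y t)"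
definition "F\<^sub>2 t = remainder_y \<alpha> X (\<xi> t) (y t)"

text \<open>The deviation from the stable eigenvector \<open>\<xi> (1, h, -k, -k h)\<close> is \<open>(0, d\<^sub>1, d\<^sub>2, d\<^sub>3)\<close>. Up to
  quadratic errors, \<open>d\<^sub>3\<close> and \<open>g\<close> oscillate with frequency \<open>\<omega>\<close> and \<open>u\<close> grows like \<open>exp (k t)\<close>, so
  none of them can decay faster than the quadratic errors that drive it.\<close>

definition "d\<^sub>1 t = y t - h * \<xi> t"
definition "d\<^sub>2 t = p t + k * \<xi> t"
definition "d\<^sub>3 t = q t + k * h * \<xi> t"
definition "g t = - (\<beta> * d\<^sub>1 t) + (k * h - 2) * d\<^sub>2 t"
definition "u t = - (\<beta> * d\<^sub>1 t) + (k\<^sup>2 + \<beta>) / 2 * d\<^sub>2 t + k * d\<^sub>3 t"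
text \<open>The energy of the linear oscillator \<open>d\<^sub>3' = g\<close>,
  \<open>g' = - \<omega>2 d\<^sub>3\<close> plus the square of the growing mode; the linear flow
  never decreases it.\<close>

definition "Q t = (u t)\<^sup>2 + \<omega>2 * (d\<^sub>3 t)\<^sup>2 + (g t)\<^sup>2"

lemma is_saddle_rate_k: "is_saddle_rate \<beta> k"
  unfolding k_def using theI'[OF is_saddle_rate_ex1] \<beta>_ge by simp

lemma k_pos: "0 < k"
  using is_saddle_rate_k by (simp add: is_saddle_rate_def)

lemma h_relations: "h * (\<beta> + k\<^sup>2) = 2 * k" "2 * k * h = \<beta>\<^sup>2 - k\<^sup>2"
  using saddle_rate_relations[OF _ is_saddle_rate_k] \<beta>_ge by (simp_all add: h_def)

lemma \<omega>2_pos: "0 < \<omega>2"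
  using \<beta>_ge k_pos by (simp add: \<omega>2_def)

text \<open>The sum of the roots \<open>k^2\<close> and \<open>- \<omega>2\<close> is
  \<open>\<beta>^2 - \<beta> - 4\<close>. This is the form of the frequency that appears when
  \<open>g\<close> is differentiated.\<close>

lemma \<omega>2_eq: "\<omega>2 = \<beta> + 4 - 2 * k * h"
proof -
  have "\<beta> ^ 3 = (\<beta> + 4 - 2 * k * h) * k\<^sup>2"
    using is_saddle_rate_k unfolding h_relations(2) is_saddle_rate_def by algebra
  then show ?thesis using k_pos by (simp add: \<omega>2_def)
qed

text \<open>Ensures that the deviations can be recovered from \<open>u\<close>,
  \<open>d\<^sub>3\<close> and \<open>g\<close>: it makes the coefficient of
  \<open>d\<^sub>2\<close> in \<open>u - g - k d\<^sub>3\<close> positive.\<close>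

lemma kh_less: "k * h < 2"
proof -
  have pos: "0 < \<beta> + k\<^sup>2" using \<beta>_ge by (simp add: add_pos_nonneg)
  have "k * h * (\<beta> + k\<^sup>2) = 2 * k\<^sup>2" using h_relations(1) by algebra
  also have "\<dots> < 2 * (\<beta> + k\<^sup>2)" using \<beta>_ge by simp
  finally show ?thesis using pos by (rule mult_right_less_imp_less[OF _ less_imp_le])
qed

lemma
  assumes "0 \<le> t"
  shows deriv_\<xi>: "(\<xi> has_real_derivative p t) (at t within I)"
    and deriv_p': "(p has_real_derivative 2 * q t + \<beta>\<^sup>2 * \<xi> t + F\<^sub>1 t) (at t within I)"
    and deriv_q': "(q has_real_derivative - 2 * p t - \<beta> * y t + F\<^sub>2 t) (at t within I)"
proof -
  have t: "t \<in> I" using assms by (simp add: I_eq)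
  show "(\<xi> has_real_derivative p t) (at t within I)"
    unfolding \<xi>_def[abs_def] using DERIV_diff[OF deriv_x[OF t] DERIV_const] by simp
  have "X + \<xi> t = x t" by (simp add: \<xi>_def)
  then have "2 * q t + \<beta>\<^sup>2 * \<xi> t + F\<^sub>1 t = 2 * q t + (\<alpha> + 2) * x t - (\<alpha> + 2) * \<alpha> * x t * \<phi> t"
    "- 2 * p t - \<beta> * y t + F\<^sub>2 t = - 2 * p t - (\<alpha> + 2) * \<alpha> * y t * \<phi> t"
    by (simp_all add: F\<^sub>1_def F\<^sub>2_def remainder_x_def remainder_y_def \<beta>_def \<phi>_def s_def)
  then show "(p has_real_derivative 2 * q t + \<beta>\<^sup>2 * \<xi> t + F\<^sub>1 t) (at t within I)"
    "(q has_real_derivative - 2 * p t - \<beta> * y t + F\<^sub>2 t) (at t within I)"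
    using deriv_p[OF t] deriv_q[OF t] by metis+
qed

lemma
  assumes "0 \<le> t"
  shows deriv_d\<^sub>1: "(d\<^sub>1 has_real_derivative q t - h * p t) (at t within I)"
    and deriv_d\<^sub>2: "(d\<^sub>2 has_real_derivative 2 * q t + \<beta>\<^sup>2 * \<xi> t + F\<^sub>1 t + k * p t) (at t within I)"
    and deriv_d\<^sub>3': "(d\<^sub>3 has_real_derivative - 2 * p t - \<beta> * y t + F\<^sub>2 t + k * h * p t) (at t within I)"
proof -
  have t: "t \<in> I" using assms by (simp add: I_eq)
  show "(d\<^sub>1 has_real_derivative q t - h * p t) (at t within I)"
    unfolding d\<^sub>1_def[abs_def] by (intro DERIV_diff DERIV_cmult deriv_y deriv_\<xi> t assms)
  show "(d\<^sub>2 has_real_derivative 2 * q t + \<beta>\<^sup>2 * \<xi> t + F\<^sub>1 t + k * p t) (at t within I)"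
    unfolding d\<^sub>2_def[abs_def] by (intro DERIV_add DERIV_cmult deriv_p' deriv_\<xi> assms)
  show "(d\<^sub>3 has_real_derivative - 2 * p t - \<beta> * y t + F\<^sub>2 t + k * h * p t) (at t within I)"
    unfolding d\<^sub>3_def[abs_def] by (intro DERIV_add DERIV_cmult deriv_q' deriv_\<xi> assms)
qed

text \<open>\<open>g\<close> is defined to be the linear part of this derivative; the \<xi>-terms
  introduced by \<open>d\<^sub>1\<close> and \<open>d\<^sub>2\<close> cancel because
  \<open>h (\<beta> + k^2) = 2 k\<close>.\<close>

lemma deriv_d\<^sub>3:
  assumes "0 \<le> t"
  shows "(d\<^sub>3 has_real_derivative g t + F\<^sub>2 t) (at t within I)"
proof -
  have "- 2 * p t - \<beta> * y t + F\<^sub>2 t + k * h * p t = g t + F\<^sub>2 t"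
    unfolding g_def d\<^sub>1_def d\<^sub>2_def using h_relations(1) by algebra
  then show ?thesis using deriv_d\<^sub>3'[OF assms] by metis
qed

lemma deriv_g:
  assumes "0 \<le> t"
  shows "(g has_real_derivative - (\<omega>2 * d\<^sub>3 t) + (k * h - 2) * F\<^sub>1 t) (at t within I)"
proof -
  have "(g has_real_derivative - (\<beta> * (q t - h * p t)) + (k * h - 2) * (2 * q t + \<beta>\<^sup>2 * \<xi> t + F\<^sub>1 t + k * p t)) (at t within I)"
    unfolding g_def[abs_def]
    by (intro DERIV_add DERIV_minus DERIV_cmult deriv_d\<^sub>1 deriv_d\<^sub>2 assms)
  moreover have "- (\<beta> * (q t - h * p t)) + (k * h - 2) * (2 * q t + \<beta>\<^sup>2 * \<xi> t + F\<^sub>1 t + k * p t) =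
      - (\<omega>2 * d\<^sub>3 t) + (k * h - 2) * F\<^sub>1 t"
    unfolding d\<^sub>3_def \<omega>2_eq using h_relations by algebra
  ultimately show ?thesis by simp
qed

text \<open>As a functional of the displacement, \<open>u\<close> is a left eigenvector of the
  linearization for the eigenvalue \<open>+ k\<close>.\<close>

lemma deriv_u:
  assumes "0 \<le> t"
  shows "(u has_real_derivative k * u t + ((k\<^sup>2 + \<beta>) / 2 * F\<^sub>1 t + k * F\<^sub>2 t)) (at t within I)"
proof -
  have "(u has_real_derivative - (\<beta> * (q t - h * p t)) + (k\<^sup>2 + \<beta>) / 2 * (2 * q t + \<beta>\<^sup>2 * \<xi> t + F\<^sub>1 t + k * p t)
      + k * (- 2 * p t - \<beta> * y t + F\<^sub>2 t + k * h * p t)) (at t within I)"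
    unfolding u_def[abs_def]
    by (intro DERIV_add DERIV_minus DERIV_cmult deriv_d\<^sub>1 deriv_d\<^sub>2 deriv_d\<^sub>3' assms)
  moreover have "- (\<beta> * (q t - h * p t)) + (k\<^sup>2 + \<beta>) / 2 * (2 * q t + \<beta>\<^sup>2 * \<xi> t + F\<^sub>1 t + k * p t)
      + k * (- 2 * p t - \<beta> * y t + F\<^sub>2 t + k * h * p t) = k * u t + ((k\<^sup>2 + \<beta>) / 2 * F\<^sub>1 t + k * F\<^sub>2 t)"
    unfolding u_def d\<^sub>1_def d\<^sub>2_def d\<^sub>3_def using h_relations by algebra
  ultimately show ?thesis by simp
qed

definition "dQ t = 2 * u t * (k * u t + ((k\<^sup>2 + \<beta>) / 2 * F\<^sub>1 t + k * F\<^sub>2 t)) + \<omega>2 * (2 * d\<^sub>3 t * (g t + F\<^sub>2 t))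
  + 2 * g t * (- (\<omega>2 * d\<^sub>3 t) + (k * h - 2) * F\<^sub>1 t)"

lemma deriv_Q:
  assumes "0 \<le> t"
  shows "(Q has_real_derivative dQ t) (at t within I)"
  unfolding Q_def[abs_def]
  by (rule derivative_eq_intros deriv_u deriv_d\<^sub>3 deriv_g assms refl)+ (simp add: dQ_def algebra_simps)

lemma dQ_ge:
  obtains A where "0 \<le> A" and "\<And>t. - (c * Q t) - A * ((F\<^sub>1 t)\<^sup>2 + (F\<^sub>2 t)\<^sup>2) \<le> dQ t"
proof -
  define a where "a = (k\<^sup>2 + \<beta>) / 2"
  define A where "A = 2 * a\<^sup>2 + 2 * k\<^sup>2 + \<omega>2 + (k * h - 2)\<^sup>2"
  have A: "0 \<le> A" using \<omega>2_pos by (simp add: A_def)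
  have "- (c * Q t) - A / c * ((F\<^sub>1 t)\<^sup>2 + (F\<^sub>2 t)\<^sup>2) \<le> dQ t" for t
  proof -
    define N\<^sub>1 N\<^sub>2 where "N\<^sub>1 = a * F\<^sub>1 t + k * F\<^sub>2 t" and "N\<^sub>2 = (k * h - 2) * F\<^sub>1 t"
    \<comment> \<open>The coupling terms \<open>2 \<omega>2 d\<^sub>3 g\<close> of the oscillator
      cancel, so the linear part contributes only the nonnegative growth of
      \<open>u\<close>.\<close>
    have dQ: "dQ t = 2 * (k * (u t)\<^sup>2) + 2 * u t * N\<^sub>1 + \<omega>2 * (2 * d\<^sub>3 t * F\<^sub>2 t) + 2 * g t * N\<^sub>2"
      by (simp add: dQ_def N\<^sub>1_def N\<^sub>2_def a_def power2_eq_square algebra_simps)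
    have "- (c * (u t)\<^sup>2) - N\<^sub>1\<^sup>2 / c \<le> 2 * u t * N\<^sub>1" "- (c * (g t)\<^sup>2) - N\<^sub>2\<^sup>2 / c \<le> 2 * g t * N\<^sub>2"
      using c_pos by (rule young)+
    moreover have "\<omega>2 * (- (c * (d\<^sub>3 t)\<^sup>2) - (F\<^sub>2 t)\<^sup>2 / c) \<le> \<omega>2 * (2 * d\<^sub>3 t * F\<^sub>2 t)"
      using \<omega>2_pos young[OF c_pos] by (intro mult_left_mono) auto
    moreover have "0 \<le> 2 * (k * (u t)\<^sup>2)" using k_pos by simp
    ultimately have 1: "- (c * Q t) - (N\<^sub>1\<^sup>2 + \<omega>2 * (F\<^sub>2 t)\<^sup>2 + N\<^sub>2\<^sup>2) / c \<le> dQ t"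
      unfolding dQ Q_def by (simp add: algebra_simps add_divide_distrib)
    have "N\<^sub>1\<^sup>2 \<le> 2 * (a\<^sup>2 * (F\<^sub>1 t)\<^sup>2 + k\<^sup>2 * (F\<^sub>2 t)\<^sup>2)"
      using sum2_power2_le[of "a * F\<^sub>1 t" "k * F\<^sub>2 t"] by (simp add: N\<^sub>1_def power_mult_distrib)
    moreover have "N\<^sub>2\<^sup>2 = (k * h - 2)\<^sup>2 * (F\<^sub>1 t)\<^sup>2" by (simp add: N\<^sub>2_def power_mult_distrib)
    moreover have "0 \<le> (2 * k\<^sup>2 + \<omega>2) * (F\<^sub>1 t)\<^sup>2" "0 \<le> (2 * a\<^sup>2 + (k * h - 2)\<^sup>2) * (F\<^sub>2 t)\<^sup>2"
      using \<omega>2_pos by simp_all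
    ultimately have "N\<^sub>1\<^sup>2 + \<omega>2 * (F\<^sub>2 t)\<^sup>2 + N\<^sub>2\<^sup>2 \<le> A * ((F\<^sub>1 t)\<^sup>2 + (F\<^sub>2 t)\<^sup>2)"
      unfolding A_def distrib_left distrib_right by linarith
    then have "(N\<^sub>1\<^sup>2 + \<omega>2 * (F\<^sub>2 t)\<^sup>2 + N\<^sub>2\<^sup>2) / c \<le> A / c * ((F\<^sub>1 t)\<^sup>2 + (F\<^sub>2 t)\<^sup>2)"
      using c_pos by (simp add: divide_right_mono)
    with 1 show ?thesis by linarith
  qed
  moreover have "0 \<le> A / c" using A c_pos by simp
  ultimately show thesis by (rule that[rotated])
qed

lemma Q_le_n2:
  obtains A where "0 \<le> A" and "\<And>t. Q t \<le> A * n2 t"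
proof -
  \<comment> \<open>Coefficient vectors of \<open>u\<close>, \<open>d\<^sub>3\<close> and
    \<open>g\<close> in the displacement \<open>(\<xi>, y, p, q)\<close>, prepared for
    Cauchy-Schwarz.\<close>
  define U\<^sub>1 U\<^sub>2 U\<^sub>3 :: state where
    "U\<^sub>1 = (\<beta> * h + (k\<^sup>2 + \<beta>) / 2 * k + k * (k * h), - \<beta>, (k\<^sup>2 + \<beta>) / 2, k)" and
    "U\<^sub>2 = (k * h, 0, 0, 1)" and "U\<^sub>3 = (\<beta> * h + (k * h - 2) * k, - \<beta>, k * h - 2, 0)"
  have le: "(inner (\<Gamma> t - (X, 0, 0, 0)) U)\<^sup>2 \<le> (norm U)\<^sup>2 * n2 t" for t U
    using power_mono[OF Cauchy_Schwarz_ineq2[of "\<Gamma> t - (X, 0, 0, 0)" U], of 2]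
    by (simp add: n2_eq power_mult_distrib mult.commute)
  have "u t = inner (\<Gamma> t - (X, 0, 0, 0)) U\<^sub>1" for t
    unfolding \<Gamma>_diff by (simp add: U\<^sub>1_def u_def d\<^sub>1_def d\<^sub>2_def d\<^sub>3_def field_simps)
  then have "(u t)\<^sup>2 \<le> (norm U\<^sub>1)\<^sup>2 * n2 t" for t using le[of t U\<^sub>1] by simp
  moreover have "(d\<^sub>3 t)\<^sup>2 \<le> (norm U\<^sub>2)\<^sup>2 * n2 t" for t
    using le[of t U\<^sub>2] unfolding \<Gamma>_diff by (simp add: U\<^sub>2_def d\<^sub>3_def algebra_simps)
  then have "\<omega>2 * (d\<^sub>3 t)\<^sup>2 \<le> \<omega>2 * ((norm U\<^sub>2)\<^sup>2 * n2 t)" for t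
    using \<omega>2_pos by (intro mult_left_mono) auto
  moreover have "(g t)\<^sup>2 \<le> (norm U\<^sub>3)\<^sup>2 * n2 t" for t
    using le[of t U\<^sub>3] unfolding \<Gamma>_diff
    by (simp add: U\<^sub>3_def g_def d\<^sub>1_def d\<^sub>2_def algebra_simps)
  ultimately have "Q t \<le> ((norm U\<^sub>1)\<^sup>2 + \<omega>2 * (norm U\<^sub>2)\<^sup>2 + (norm U\<^sub>3)\<^sup>2) * n2 t" for t
    unfolding Q_def distrib_right mult.assoc by (intro add_mono)
  moreover have "0 \<le> (norm U\<^sub>1)\<^sup>2 + \<omega>2 * (norm U\<^sub>2)\<^sup>2 + (norm U\<^sub>3)\<^sup>2" using \<omega>2_pos by simp
  ultimately show thesis by (rule that[rotated])
qed

text \<open>An excess of \<open>Q\<close> over \<open>K \<delta>^4\<close> could shrink at most like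
  \<open>exp (- c t)\<close>, whereas \<open>Q\<close>, bounded by the squared distance, is of size
  at most \<open>exp (- 2 c t)\<close>.\<close>

lemma Q_le_\<delta>:
  obtains K where "0 \<le> K" and "eventually (\<lambda>t. Q t \<le> K * (\<delta> t) ^ 4) at_top"
proof -
  obtain A where A: "0 \<le> A" and dQ: "\<And>t. - (c * Q t) - A * ((F\<^sub>1 t)\<^sup>2 + (F\<^sub>2 t)\<^sup>2) \<le> dQ t"
    using dQ_ge by blast
  obtain A\<^sub>2 where A\<^sub>2: "0 \<le> A\<^sub>2" and Qn: "\<And>t. Q t \<le> A\<^sub>2 * n2 t" using Q_le_n2 by blast
  obtain D where D: "0 \<le> D" and n2D: "eventually (\<lambda>t. n2 t \<le> D * (\<delta> t)\<^sup>2) at_top" by (rule n2_le)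
  obtain C \<rho> where C: "0 \<le> C" and \<rho>: "0 < \<rho>" and rem: "\<And>\<xi> \<eta>. \<xi>\<^sup>2 + \<eta>\<^sup>2 \<le> \<rho>\<^sup>2 \<Longrightarrow>
    (X + \<xi>, \<eta>) \<noteq> (0, 0) \<and> \<bar>remainder_x \<alpha> X \<xi> \<eta>\<bar> \<le> C * (\<xi>\<^sup>2 + \<eta>\<^sup>2) \<and>
    \<bar>remainder_y \<alpha> X \<xi> \<eta>\<bar> \<le> C * (\<xi>\<^sup>2 + \<eta>\<^sup>2)"
    using remainder_bound[OF alpha_pos X2] by blast
  define B where "B = A * (2 * (C * D)\<^sup>2)"
  have B: "0 \<le> B" using A by (simp add: B_def)
  have "eventually (\<lambda>t. n2 t < \<rho>\<^sup>2) at_top" using order_tendstoD(2)[OF tendsto_n2] \<rho> by simp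
  with n2D have "eventually (\<lambda>t. 0 \<le> t \<and> n2 t \<le> D * (\<delta> t)\<^sup>2 \<and> - (c * Q t) - B * (\<delta> t) ^ 4 \<le> dQ t) at_top"
    using eventually_ge_at_top[of 0]
  proof eventually_elim
    case (elim t)
    have n: "(\<xi> t)\<^sup>2 + (y t)\<^sup>2 \<le> n2 t" by (simp add: n2_def)
    have "C * ((\<xi> t)\<^sup>2 + (y t)\<^sup>2) \<le> C * (D * (\<delta> t)\<^sup>2)" using n elim C by (intro mult_left_mono) auto
    then have F: "\<bar>F\<^sub>1 t\<bar> \<le> C * D * (\<delta> t)\<^sup>2" "\<bar>F\<^sub>2 t\<bar> \<le> C * D * (\<delta> t)\<^sup>2"
      using rem[of "\<xi> t" "y t"] n elim unfolding F\<^sub>1_def F\<^sub>2_def mult.assoc by linarith+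
    have "(F\<^sub>1 t)\<^sup>2 \<le> (C * D * (\<delta> t)\<^sup>2)\<^sup>2" "(F\<^sub>2 t)\<^sup>2 \<le> (C * D * (\<delta> t)\<^sup>2)\<^sup>2"
      using F by (metis abs_ge_zero power2_abs power_mono)+
    then have "A * ((F\<^sub>1 t)\<^sup>2 + (F\<^sub>2 t)\<^sup>2) \<le> A * (2 * (C * D * (\<delta> t)\<^sup>2)\<^sup>2)"
      using A by (intro mult_left_mono) auto
    also have "\<dots> = B * (\<delta> t) ^ 4" by (simp add: B_def power_mult_distrib power_mult[symmetric])
    finally show ?case using dQ[of t] elim by simp
  qed
  then obtain t\<^sub>1 where t\<^sub>1: "\<And>t. t\<^sub>1 \<le> t \<Longrightarrow> 0 \<le> t" "\<And>t. t\<^sub>1 \<le> t \<Longrightarrow> n2 t \<le> D * (\<delta> t)\<^sup>2"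
    "\<And>t. t\<^sub>1 \<le> t \<Longrightarrow> - (c * Q t) - B * (\<delta> t) ^ 4 \<le> dQ t"
    unfolding eventually_at_top_linorder by blast
  \<comment> \<open>With \<open>c K = B\<close> the derivative of \<open>- K \<delta>^4\<close> is
    at least \<open>4 B \<delta>^4\<close>. This absorbs the forcing \<open>B \<delta>^4\<close> and
    the term \<open>c K \<delta>^4\<close>, so that \<open>m' \<ge> - c m\<close>.\<close>
  define K where "K = B / c"
  have K: "0 \<le> K" "c * K = B" using B c_pos by (simp_all add: K_def)
  define m where "m t = Q t - K * (\<delta> t) ^ 4" for t
  have "m t \<le> 0" if t: "t\<^sub>1 \<le> t" for t
  proof (rule ccontr)
    assume "\<not> ?thesis"
    then have pos: "0 < m t" by simp
    have t0: "0 \<le> t" using t\<^sub>1 t by simp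
    define H where "H = A\<^sub>2 * D * (\<delta> t)\<^sup>2"
    have H: "0 \<le> H" using A\<^sub>2 D by (simp add: H_def)
    have bound: "m t * exp (c * r) \<le> H" if r: "0 \<le> r" for r
    proof -
      have le: "t \<le> t + r" using r by simp
      have sub: "{t..t + r} \<subseteq> I" using t0 by (auto simp: I_eq)
      have "m t * exp (- c * (t + r - t)) \<le> m (t + r)"
      proof (rule gronwall_ge[OF le sub])
        fix v assume "v \<in> {t..t + r}"
        then have v: "t\<^sub>1 \<le> v" "0 \<le> v" using t t0 by auto
        show "(m has_real_derivative dQ v - K * (of_nat 4 * (- (2 * j v) * \<delta> v ^ (4 - Suc 0)))) (at v within I)"
          unfolding m_def[abs_def] by (intro DERIV_diff DERIV_cmult DERIV_power deriv_Q deriv_\<delta> v)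
        have "4 * K * \<delta> v ^ 3 * (c * \<delta> v) \<le> 4 * K * \<delta> v ^ 3 * (2 * j v)"
          using K \<delta>_nonneg[OF v(2)] \<delta>_decay_rate[OF v(2)] by (intro mult_left_mono) auto
        moreover have "4 * K * \<delta> v ^ 3 * (c * \<delta> v) = 4 * (B * \<delta> v ^ 4)"
          unfolding K(2)[symmetric] by (simp add: power_numeral_reduce)
        moreover have "0 \<le> B * \<delta> v ^ 4" using B by simp
        moreover have "- c * m v = - (c * Q v) + B * \<delta> v ^ 4"
          unfolding K(2)[symmetric] by (simp add: m_def algebra_simps)
        moreover have "K * (of_nat 4 * (- (2 * j v) * \<delta> v ^ (4 - Suc 0))) = - (4 * K * \<delta> v ^ 3 * (2 * j v))"
          by simp
        ultimately show "- c * m v \<le> dQ v - K * (of_nat 4 * (- (2 * j v) * \<delta> v ^ (4 - Suc 0)))"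
          using t\<^sub>1(3)[OF v(1)] by linarith
      qed
      also have "m (t + r) \<le> Q (t + r)" using K by (simp add: m_def)
      also have "\<dots> \<le> A\<^sub>2 * n2 (t + r)" by (rule Qn)
      also have "\<dots> \<le> A\<^sub>2 * (D * (\<delta> (t + r))\<^sup>2)" using A\<^sub>2 t\<^sub>1(2)[of "t + r"] t r by (intro mult_left_mono) auto
      also have "\<dots> \<le> A\<^sub>2 * (D * (\<delta> t * exp (- c * r))\<^sup>2)"
        using A\<^sub>2 D \<delta>_nonneg[of "t + r"] \<delta>_exp_decay[of t "t + r"] t0 r
        by (intro mult_left_mono power_mono) auto
      also have "\<dots> = H * (exp (- c * r) * exp (- c * r))" by (simp add: H_def power2_eq_square)
      finally have "m t * exp (- c * r) * exp (c * r) * exp (c * r) \<le> H * (exp (- c * r) * exp (- c * r)) * exp (c * r) * exp (c * r)"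
        by (intro mult_right_mono) auto
      then show ?thesis by (simp add: mult.assoc exp_add[symmetric])
    qed
    \<comment> \<open>Chosen so that already the linear bound \<open>1 + c r\<close> for the
      exponential gives \<open>m t + H \<le> H\<close>.\<close>
    define r where "r = H / (c * m t)"
    have r: "0 \<le> r" using H c_pos pos by (simp add: r_def)
    have "m t * (1 + c * r) \<le> m t * exp (c * r)" using pos by (intro mult_left_mono exp_ge_add_one_self) auto
    also have "\<dots> \<le> H" by (rule bound[OF r])
    finally show False using c_pos pos by (simp add: r_def distrib_left)
  qed
  then have "eventually (\<lambda>t. Q t \<le> K * (\<delta> t) ^ 4) at_top"
    unfolding eventually_at_top_linorder m_def by (intro exI[of _ t\<^sub>1]) auto
  with K(1) show thesis by (rule that)
qed

text \<open>Inverts the linear change of coordinates: \<open>u - g\<close> no longer contains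
  \<open>d\<^sub>1\<close>, so \<open>d\<^sub>2\<close> is recovered from \<open>u\<close>,
  \<open>g\<close> and \<open>d\<^sub>3\<close>, and then \<open>d\<^sub>1\<close> from
  \<open>g\<close>.\<close>

lemma deviation_le_Q:
  obtains A where "0 \<le> A" and "\<And>t. (d\<^sub>1 t)\<^sup>2 + (d\<^sub>2 t)\<^sup>2 + (d\<^sub>3 t)\<^sup>2 \<le> A * Q t"
proof -
  define \<gamma> where "\<gamma> = (k\<^sup>2 + \<beta>) / 2 + (2 - k * h)"
  have \<gamma>: "0 < \<gamma>"
    unfolding \<gamma>_def using kh_less \<beta>_ge k_pos by (intro add_pos_pos divide_pos_pos) auto
  define A\<^sub>2 where "A\<^sub>2 = 3 * (2 + k\<^sup>2 / \<omega>2) / \<gamma>\<^sup>2"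
  define A\<^sub>1 where "A\<^sub>1 = 2 * ((k * h - 2)\<^sup>2 * A\<^sub>2 + 1) / \<beta>\<^sup>2"
  have A: "0 \<le> A\<^sub>2" "0 \<le> A\<^sub>1" using \<omega>2_pos by (simp_all add: A\<^sub>2_def A\<^sub>1_def)
  have "(d\<^sub>1 t)\<^sup>2 + (d\<^sub>2 t)\<^sup>2 + (d\<^sub>3 t)\<^sup>2 \<le> (A\<^sub>1 + A\<^sub>2 + 1 / \<omega>2) * Q t" for t
  proof -
    have uQ: "(u t)\<^sup>2 \<le> Q t" and gQ: "(g t)\<^sup>2 \<le> Q t" and "\<omega>2 * (d\<^sub>3 t)\<^sup>2 \<le> Q t"
      using \<omega>2_pos by (simp_all add: Q_def)
    then have d\<^sub>3: "(d\<^sub>3 t)\<^sup>2 \<le> 1 / \<omega>2 * Q t" using \<omega>2_pos by (simp add: field_simps)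
    have "\<gamma> * d\<^sub>2 t = u t + - g t + - (k * d\<^sub>3 t)"
      by (simp add: \<gamma>_def u_def g_def algebra_simps)
    then have "(\<gamma> * d\<^sub>2 t)\<^sup>2 \<le> 3 * ((u t)\<^sup>2 + (g t)\<^sup>2 + k\<^sup>2 * (d\<^sub>3 t)\<^sup>2)"
      using sum3_power2_le[of "u t" "- g t" "- (k * d\<^sub>3 t)"] by (simp add: power_mult_distrib)
    also have "\<dots> \<le> 3 * (Q t + Q t + k\<^sup>2 * (1 / \<omega>2 * Q t))"
      using uQ gQ d\<^sub>3 by (intro mult_left_mono add_mono) auto
    also have "\<dots> = \<gamma>\<^sup>2 * (A\<^sub>2 * Q t)" using \<gamma> by (simp add: A\<^sub>2_def algebra_simps add_divide_distrib)
    finally have d\<^sub>2: "(d\<^sub>2 t)\<^sup>2 \<le> A\<^sub>2 * Q t" using \<gamma> by (simp add: power_mult_distrib)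
    have "\<beta> * d\<^sub>1 t = (k * h - 2) * d\<^sub>2 t + - g t" by (simp add: g_def)
    then have "(\<beta> * d\<^sub>1 t)\<^sup>2 \<le> 2 * ((k * h - 2)\<^sup>2 * (d\<^sub>2 t)\<^sup>2 + (g t)\<^sup>2)"
      using sum2_power2_le[of "(k * h - 2) * d\<^sub>2 t" "- g t"] by (simp add: power_mult_distrib)
    also have "\<dots> \<le> 2 * ((k * h - 2)\<^sup>2 * (A\<^sub>2 * Q t) + Q t)"
      using d\<^sub>2 gQ by (intro mult_left_mono add_mono) auto
    also have "\<dots> = \<beta>\<^sup>2 * (A\<^sub>1 * Q t)" using \<beta>_ge by (simp add: A\<^sub>1_def algebra_simps add_divide_distrib)
    finally have "(d\<^sub>1 t)\<^sup>2 \<le> A\<^sub>1 * Q t" using \<beta>_ge by (simp add: power_mult_distrib)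
    with d\<^sub>2 d\<^sub>3 show ?thesis by (simp add: distrib_right)
  qed
  moreover have "0 \<le> A\<^sub>1 + A\<^sub>2 + 1 / \<omega>2" using A \<omega>2_pos by simp
  ultimately show thesis by (rule that[rotated])
qed

text \<open>The comparison point is the stable eigenvector with the same \<xi>-coordinate, from
  which the displacement differs by \<open>(0, d\<^sub>1, d\<^sub>2, d\<^sub>3)\<close>.\<close>

lemma infdist_stable_eigenspace_le:
  "infdist (\<Gamma> t - (X, 0, 0, 0)) (stable_eigenspace \<alpha> (X, 0, 0, 0)) \<le> sqrt ((d\<^sub>1 t)\<^sup>2 + (d\<^sub>2 t)\<^sup>2 + (d\<^sub>3 t)\<^sup>2)"
proof -
  define e where "e = (\<xi> t, h * \<xi> t, - (k * \<xi> t), - (k * h * \<xi> t))"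
  have k: "is_saddle_rate (\<alpha> + 2) k" using is_saddle_rate_k by (simp add: \<beta>_def)
  have "e \<in> stable_eigenspace \<alpha> (X, 0, 0, 0)"
    using hill_linear_stable_vector[OF alpha_pos k, of h "\<xi> t"]
    by (simp add: stable_eigenspace_def linearization_ground_state[OF alpha_pos X2]
        stable_rate_eqI[OF alpha_pos X2 k] e_def h_def \<beta>_def)
  then have "infdist (\<Gamma> t - (X, 0, 0, 0)) (stable_eigenspace \<alpha> (X, 0, 0, 0)) \<le> dist (\<Gamma> t - (X, 0, 0, 0)) e"
    by (rule infdist_le)
  also have "\<dots> = norm (0 :: real, d\<^sub>1 t, d\<^sub>2 t, d\<^sub>3 t)"
    unfolding dist_norm \<Gamma>_diff e_def by (simp add: d\<^sub>1_def d\<^sub>2_def d\<^sub>3_def)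
  also have "\<dots> = sqrt ((d\<^sub>1 t)\<^sup>2 + (d\<^sub>2 t)\<^sup>2 + (d\<^sub>3 t)\<^sup>2)"
    by (simp add: norm_Pair add.assoc)
  finally show ?thesis .
qed

lemma tangent_to_stable_eigenspace:
  "(\<lambda>t. infdist (\<Gamma> t - (X, 0, 0, 0)) (stable_eigenspace \<alpha> (X, 0, 0, 0)))
    \<in> o[at_top](\<lambda>t. norm (\<Gamma> t - (X, 0, 0, 0)))"
proof (rule landau_o.smallI)
  fix \<epsilon> :: real assume \<epsilon>: "0 < \<epsilon>"
  obtain K where K: "0 \<le> K" and QK: "eventually (\<lambda>t. Q t \<le> K * (\<delta> t) ^ 4) at_top" by (rule Q_le_\<delta>)
  obtain A where A: "0 \<le> A" and dA: "\<And>t. (d\<^sub>1 t)\<^sup>2 + (d\<^sub>2 t)\<^sup>2 + (d\<^sub>3 t)\<^sup>2 \<le> A * Q t" using deviation_le_Q by blast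
  define S M where "S = sqrt (A * K)" and "M = 2 * \<bar>X\<bar> + 1"
  have S: "0 \<le> S" and M: "0 < M" using A K by (auto simp: S_def M_def)
  have "((\<lambda>t. S * \<delta> t * M) \<longlongrightarrow> S * 0 * M) at_top" by (intro tendsto_intros tendsto_\<delta>)
  then have "eventually (\<lambda>t. S * \<delta> t * M < \<epsilon>) at_top" using order_tendstoD(2) \<epsilon> by fastforce
  then show "eventually (\<lambda>t. norm (infdist (\<Gamma> t - (X, 0, 0, 0)) (stable_eigenspace \<alpha> (X, 0, 0, 0)))
      \<le> \<epsilon> * norm (norm (\<Gamma> t - (X, 0, 0, 0)))) at_top"
    using QK \<delta>_le_norm eventually_ge_at_top[of 0]
  proof eventually_elim
    case (elim t)
    define N where "N = norm (\<Gamma> t - (X, 0, 0, 0))"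
    have \<delta>: "0 \<le> \<delta> t" using \<delta>_nonneg elim by simp
    have "(d\<^sub>1 t)\<^sup>2 + (d\<^sub>2 t)\<^sup>2 + (d\<^sub>3 t)\<^sup>2 \<le> A * (K * (\<delta> t) ^ 4)"
      using dA[of t] mult_left_mono[OF elim(2) A] by linarith
    also have "\<dots> = A * K * ((\<delta> t)\<^sup>2)\<^sup>2" by (simp add: power_mult[symmetric])
    finally have "sqrt ((d\<^sub>1 t)\<^sup>2 + (d\<^sub>2 t)\<^sup>2 + (d\<^sub>3 t)\<^sup>2) \<le> sqrt (A * K * ((\<delta> t)\<^sup>2)\<^sup>2)"
      by (rule real_sqrt_le_mono)
    also have "\<dots> = S * \<delta> t * \<delta> t" unfolding real_sqrt_mult S_def by (simp add: power2_eq_square)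
    \<comment> \<open>Of the two factors \<delta>, one is exchanged for the norm and the other
      supplies the smallness.\<close>
    also have "\<dots> \<le> S * \<delta> t * (M * N)"
      using elim(3) S \<delta> by (intro mult_left_mono) (auto simp: M_def N_def)
    also have "\<dots> = S * \<delta> t * M * N" by simp
    also have "\<dots> \<le> \<epsilon> * N" using elim(1) by (intro mult_right_mono) (auto simp: N_def)
    finally show ?case
      using infdist_stable_eigenspace_le[of t] by (simp add: N_def infdist_nonneg)
  qed
qed

lemma initial_in_stable_manifold: "\<Gamma> 0 \<in> stable_manifold \<alpha> (X, 0, 0, 0)"
proof -
  obtain C where "\<And>t. 0 \<le> t \<Longrightarrow> norm (\<Gamma> t - (X, 0, 0, 0)) \<le> C * exp (- c * t)"
    using exponential_convergence by blast
  then have "\<exists>C c. c > 0 \<and> (\<forall>t \<ge> 0. norm (\<Gamma> t - (X, 0, 0, 0)) \<le> C * exp (- c * t))"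
    using c_pos by blast
  then show ?thesis
    unfolding stable_manifold_def using sol T tangent_to_stable_eigenspace by blast
qed

end

text \<open>The result for initial points is applied to the orbit restarted at time
  \<open>t\<close>, which by invariance starts in \<open>W_minus\<close> again.\<close>

lemma approaching_orbit_in_stable_manifold:
  assumes \<alpha>: "2 \<le> \<alpha>" and max: "maximal_solution \<alpha> T \<Gamma>" and init: "\<Gamma> 0 \<in> W_minus \<alpha>"
    and P: "P \<in> {ground_state \<alpha>, - ground_state \<alpha>}" and app: "approaches T \<Gamma> P"
    and t: "t \<in> time_interval T"
  shows "\<Gamma> t \<in> stable_manifold \<alpha> P"
proof -
  have T: "T = \<infinity>" and lim: "(\<Gamma> \<longlongrightarrow> P) at_top" using app by (auto simp: approaches_def)
  have t0: "0 \<le> t" using t by (simp add: T)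
  have "0 < \<alpha>" using \<alpha> by simp
  then obtain X where X: "P = (X, 0, 0, 0)" "X\<^sup>2 = ground_radius2 \<alpha>"
    using ground_stateE[OF _ P] by blast
  have sol: "solution \<alpha> \<infinity> \<Gamma>" using max unfolding T maximal_solution_def by blast
  have "\<Gamma> t \<in> W_minus \<alpha>"
    using invariant_W_minus[OF \<alpha>] max init t unfolding invariant_set_def by blast
  moreover have "filterlim (\<lambda>r. r + t) at_top at_top"
    using filterlim_tendsto_add_at_top[OF tendsto_const[of t] filterlim_ident] by (simp add: add.commute)
  then have "((\<lambda>r. \<Gamma> (r + t)) \<longlongrightarrow> P) at_top" by (rule filterlim_compose[OF lim])
  ultimately interpret approaching_orbit \<alpha> \<infinity> "\<lambda>r. \<Gamma> (r + t)" X
    using \<alpha> X shift_solution[OF sol t0] by unfold_locales auto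
  show ?thesis using initial_in_stable_manifold X by simp
qed

theorem theorem2:
  fixes \<alpha> :: real
  assumes "\<alpha> \<ge> 2"
  shows "invariant_set \<alpha> (W_plus \<alpha>) \<and> invariant_set \<alpha> (W_minus \<alpha>) \<and>
    (\<forall>T \<Gamma>. maximal_solution \<alpha> T \<Gamma> \<and> \<Gamma> 0 \<in> W_minus \<alpha> \<longrightarrow>
       (finite_time_collision T \<Gamma> \<or>
        approaches T \<Gamma> (ground_state \<alpha>) \<or> approaches T \<Gamma> (- ground_state \<alpha>)) \<and>
       (\<forall>P \<in> {ground_state \<alpha>, - ground_state \<alpha>}. approaches T \<Gamma> P \<longrightarrow>
          (\<forall>t \<in> time_interval T. \<Gamma> t \<in> stable_manifold \<alpha> P))) \<and>
    (\<forall>T \<Gamma>. maximal_solution \<alpha> T \<Gamma> \<and> \<Gamma> 0 \<in> W_plus \<alpha> \<longrightarrow> T = \<infinity>)"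
proof (intro conjI allI impI ballI)
  show "invariant_set \<alpha> (W_plus \<alpha>)" "invariant_set \<alpha> (W_minus \<alpha>)"
    using assms by (rule invariant_W_plus invariant_W_minus)+
  fix T \<Gamma>
  show "T = \<infinity>" if "maximal_solution \<alpha> T \<Gamma> \<and> \<Gamma> 0 \<in> W_plus \<alpha>"
    using W_plus_global[OF assms] that by blast
  assume a: "maximal_solution \<alpha> T \<Gamma> \<and> \<Gamma> 0 \<in> W_minus \<alpha>"
  then have max: "maximal_solution \<alpha> T \<Gamma>" by blast
  interpret W_minus_orbit \<alpha> T \<Gamma>
    unfolding W_minus_orbit_def W_minus_orbit_axioms_def
    using maximal_solution_imp_hill_orbit[OF assms max] a by blast
  \<comment> \<open>Excludes \<open>T = -\<infinity>\<close>, so that finite and infinite life span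
    are the only cases.\<close>
  have "0 < T" using sol by (simp add: solution_def)
  then show "finite_time_collision T \<Gamma> \<or>
      approaches T \<Gamma> (ground_state \<alpha>) \<or> approaches T \<Gamma> (- ground_state \<alpha>)"
    using collision_if_finite[OF max] approaches_if_global by (cases T) auto
  fix P t assume "P \<in> {ground_state \<alpha>, - ground_state \<alpha>}" "approaches T \<Gamma> P" "t \<in> time_interval T"
  then show "\<Gamma> t \<in> stable_manifold \<alpha> P"
    using approaching_orbit_in_stable_manifold[OF assms max] a by blast
qed

end
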